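(* Let $M$ be a (complex) projective manifold and let $\mathcal{D}$ be an integrable singular holomorphic distribution on $M$. Then there is a rational vector field $X$ on $M$ such that $\mathbb{C}(X)=\mathbb{C}(\mathcal{D})$.
   Context: If $X$ is a rational vector field on $M$, a rational first integral of $X$ is a rational function on $M$ that is constant along the integral curves of $X$; $\mathbb{C}(X)$ denotes the field of rational first integrals of $X$. If $\mathcal{D}$ is a singular holomorphic distribution on $M$, a rational function $h$ on $M$ is a rational first integral of $\mathcal{D}$ if $h\in\mathbb{C}(X)$ for every rational vector field $X$ tangent to $\mathcal{D}$; $\mathbb{C}(\mathcal{D})$ denotes the field of rational first integrals of $\mathcal{D}$. Integrable means integrable in the sense of Frobenius (at generic points, the local sections of $\mathcal{D}$ are closed under Lie bracket), so that $\mathcal{D}$ defines a singular holomorphic foliation. *)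

theory Defs
  imports "HOL-Analysis.Analysis"
begin

section \<open>Complex projective space\<close>

definition proportional :: "complex ^ 'n::finite \<Rightarrow> complex ^ 'n \<Rightarrow> bool" where
  "proportional x y \<longleftrightarrow> x \<noteq> 0 \<and> (\<exists>c. c \<noteq> 0 \<and> y = c *s x)"

text \<open>The projective space of dimension \<open>CARD('n) - 1\<close>, with homogeneous coordinates indexed
  by \<open>'n\<close>; \<open>rep_cproj p\<close> is a nonzero vector of homogeneous coordinates of \<open>p\<close>.\<close>

quotient_type (overloaded) 'n cproj = "complex ^ ('n::finite)" / partial: proportional
proof (rule part_equivpI)
  show "\<exists>x::complex^'n. proportional x x"
    by (rule exI[of _ "1"]) (auto simp: proportional_def intro!: exI[of _ 1])
  show "symp (proportional :: complex^'n \<Rightarrow> _)"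
  proof (rule sympI)
    fix x y :: "complex^'n"
    assume "proportional x y"
    then obtain c where "x \<noteq> 0" "c \<noteq> 0" "y = c *s x"
      by (auto simp: proportional_def)
    then show "proportional y x"
      by (auto simp: proportional_def intro!: exI[of _ "inverse c"])
  qed
  show "transp (proportional :: complex^'n \<Rightarrow> _)"
  proof (rule transpI)
    fix x y z :: "complex^'n"
    assume "proportional x y" "proportional y z"
    then obtain c d where "x \<noteq> 0" "c \<noteq> 0" "y = c *s x" "d \<noteq> 0" "z = d *s y"
      by (auto simp: proportional_def)
    then show "proportional x z"
      by (auto simp: proportional_def intro!: exI[of _ "d * c"])
  qed
qed

instantiation cproj :: (finite) topological_space
begin

definition open_cproj :: "'a cproj set \<Rightarrow> bool" where
  "open_cproj A \<longleftrightarrow> open {x. x \<noteq> 0 \<and> abs_cproj x \<in> A}"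

instance
proof
  have "{x::complex^'a. x \<noteq> 0 \<and> abs_cproj x \<in> (UNIV :: 'a cproj set)} = - {0}"
    by auto
  then show "open (UNIV :: 'a cproj set)"
    by (simp add: open_cproj_def open_Compl)
next
  fix S T :: "'a cproj set"
  assume "open S" "open T"
  moreover have "{x. x \<noteq> 0 \<and> abs_cproj x \<in> S \<inter> T} =
      {x. x \<noteq> 0 \<and> abs_cproj x \<in> S} \<inter> {x. x \<noteq> 0 \<and> abs_cproj x \<in> T}"
    by auto
  ultimately show "open (S \<inter> T)"
    by (simp add: open_cproj_def open_Int)
next
  fix K :: "'a cproj set set"
  assume "\<forall>S\<in>K. open S"
  moreover have "{x. x \<noteq> 0 \<and> abs_cproj x \<in> \<Union>K} =
      (\<Union>S\<in>K. {x. x \<noteq> 0 \<and> abs_cproj x \<in> S})"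
    by auto
  ultimately show "open (\<Union>K)"
    by (simp add: open_cproj_def open_UN)
qed

end

text \<open>The affine chart \<open>x\<^sub>i \<noteq> 0\<close> is identified with the hyperplane \<open>y\<^sub>i = 1\<close> by normalising
  homogeneous coordinates.  Outside its domain the chart has the value \<open>0\<close>, which
  is not on that hyperplane.\<close>

definition chart_dom :: "'n::finite \<Rightarrow> 'n cproj set" where
  "chart_dom i = {p. rep_cproj p $ i \<noteq> 0}"

definition chart :: "'n::finite \<Rightarrow> 'n cproj \<Rightarrow> complex ^ 'n" where
  "chart i p = inverse (rep_cproj p $ i) *s rep_cproj p"

section \<open>Projective manifolds\<close>

definition holomorphic_mv :: "(complex ^ 'n::finite \<Rightarrow> complex) \<Rightarrow> (complex ^ 'n) set \<Rightarrow> bool" where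
  "holomorphic_mv F V \<longleftrightarrow> open V \<and>
     (\<forall>x\<in>V. \<exists>F'. (F has_derivative F') (at x) \<and> (\<forall>c v. F' (c *s v) = c * F' v))"

definition biholomorphic ::
    "(complex ^ 'n::finite \<Rightarrow> complex ^ 'n) \<Rightarrow> (complex ^ 'n) set \<Rightarrow> (complex ^ 'n) set \<Rightarrow> bool" where
  "biholomorphic \<Phi> U V \<longleftrightarrow> \<Phi> ` U = V \<and> (\<forall>k. holomorphic_mv (\<lambda>x. \<Phi> x $ k) U) \<and>
     (\<exists>\<Psi>. (\<forall>x\<in>U. \<Psi> (\<Phi> x) = x) \<and> (\<forall>k. holomorphic_mv (\<lambda>y. \<Psi> y $ k) V))"

definition complex_submanifold :: "nat \<Rightarrow> (complex ^ 'n::finite) set \<Rightarrow> bool" where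
  "complex_submanifold m S \<longleftrightarrow>
     (\<forall>x\<in>S. \<exists>U V \<Phi> L. open U \<and> x \<in> U \<and> biholomorphic \<Phi> U V \<and>
        vec.subspace L \<and> vec.dim L = m \<and> \<Phi> ` (S \<inter> U) = L \<inter> V)"

text \<open>A projective manifold is a (nonempty) connected closed complex submanifold of a projective
  space, submanifolds being recognised in the affine charts.\<close>

definition projective_manifold :: "'n::finite cproj set \<Rightarrow> bool" where
  "projective_manifold M \<longleftrightarrow> M \<noteq> {} \<and> closed M \<and> connected M \<and>
     (\<exists>m. \<forall>i. complex_submanifold m (chart i ` (M \<inter> chart_dom i)))"

section \<open>Curves, tangent vectors and holomorphic vector fields\<close>

text \<open>A tangent vector at \<open>p\<close> is given by the family of its coordinate vectors in the
  affine charts around \<open>p\<close>, with zero entries for the charts that do not contain \<open>p\<close>.  That the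
  entries are related by the differentials of the coordinate changes need not be
  postulated: it holds for velocities of curves, and those are the only tangent vectors considered.\<close>

type_synonym 'n tvec = "complex ^ 'n ^ 'n"

definition tscale :: "complex \<Rightarrow> 'n::finite tvec \<Rightarrow> 'n tvec" where
  "tscale c w = (\<chi> i. c *s (w $ i))"

definition velocity :: "(complex \<Rightarrow> 'n::finite cproj) \<Rightarrow> complex \<Rightarrow> 'n tvec \<Rightarrow> bool" where
  "velocity \<gamma> t w \<longleftrightarrow>
     (\<forall>i. if \<gamma> t \<in> chart_dom i
          then ((\<lambda>s. chart i (\<gamma> s)) has_derivative (\<lambda>h. h *s (w $ i))) (at t)
          else w $ i = 0)"

definition holomorphic_curve ::
    "'n::finite cproj set \<Rightarrow> complex set \<Rightarrow> (complex \<Rightarrow> 'n cproj) \<Rightarrow> bool" where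
  "holomorphic_curve M T \<gamma> \<longleftrightarrow>
     open T \<and> continuous_on T \<gamma> \<and> \<gamma> ` T \<subseteq> M \<and> (\<forall>t\<in>T. \<exists>w. velocity \<gamma> t w)"

definition curve_through ::
    "'n::finite cproj set \<Rightarrow> 'n cproj \<Rightarrow> 'n tvec \<Rightarrow> (complex \<Rightarrow> 'n cproj) \<Rightarrow> bool" where
  "curve_through M p w \<gamma> \<longleftrightarrow>
     (\<exists>r>0. holomorphic_curve M (ball 0 r) \<gamma>) \<and> \<gamma> 0 = p \<and> velocity \<gamma> 0 w"

definition tangent_space :: "'n::finite cproj set \<Rightarrow> 'n cproj \<Rightarrow> 'n tvec set" where
  "tangent_space M p = {w. \<exists>\<gamma>. curve_through M p w \<gamma>}"

abbreviation open_in :: "'n::finite cproj set \<Rightarrow> 'n cproj set \<Rightarrow> bool" where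
  "open_in M U \<equiv> openin (top_of_set M) U"

abbreviation dense_open_in :: "'n::finite cproj set \<Rightarrow> 'n cproj set \<Rightarrow> bool" where
  "dense_open_in M V \<equiv> open_in M V \<and> M \<subseteq> closure V"

text \<open>Holomorphic functions on an open subset of a submanifold are the local restrictions of
  holomorphic functions of the ambient coordinates.\<close>

definition holomorphic_fun :: "'n::finite cproj set \<Rightarrow> ('n cproj \<Rightarrow> complex) \<Rightarrow> bool" where
  "holomorphic_fun U f \<longleftrightarrow>
     (\<forall>i. \<forall>p \<in> U \<inter> chart_dom i. \<exists>V F. chart i p \<in> V \<and> holomorphic_mv F V \<and>
        (\<forall>q \<in> U \<inter> chart_dom i. chart i q \<in> V \<longrightarrow> f q = F (chart i q)))"

definition holomorphic_vector_field ::
    "'n::finite cproj set \<Rightarrow> 'n cproj set \<Rightarrow> ('n cproj \<Rightarrow> 'n tvec) \<Rightarrow> bool" where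
  "holomorphic_vector_field M U X \<longleftrightarrow>
     (\<forall>p\<in>U. X p \<in> tangent_space M p) \<and>
     (\<forall>i k. holomorphic_fun (U \<inter> chart_dom i) (\<lambda>p. X p $ i $ k))"

definition dir_deriv ::
    "'n::finite cproj set \<Rightarrow> ('n cproj \<Rightarrow> complex) \<Rightarrow> 'n cproj \<Rightarrow> 'n tvec \<Rightarrow> complex" where
  "dir_deriv M f p w =
     (THE c. \<exists>\<gamma>. curve_through M p w \<gamma> \<and> ((\<lambda>s. f (\<gamma> s)) has_field_derivative c) (at 0))"

definition lie_deriv ::
    "'n::finite cproj set \<Rightarrow> ('n cproj \<Rightarrow> 'n tvec) \<Rightarrow> ('n cproj \<Rightarrow> complex) \<Rightarrow> 'n cproj \<Rightarrow> complex" where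
  "lie_deriv M X f p = dir_deriv M f p (X p)"

text \<open>\<open>Z = [X, Y]\<close> on \<open>U\<close>, as derivations of the sheaf of holomorphic functions.\<close>

definition is_lie_bracket ::
    "'n::finite cproj set \<Rightarrow> 'n cproj set \<Rightarrow> ('n cproj \<Rightarrow> 'n tvec) \<Rightarrow> ('n cproj \<Rightarrow> 'n tvec)
      \<Rightarrow> ('n cproj \<Rightarrow> 'n tvec) \<Rightarrow> bool" where
  "is_lie_bracket M U X Y Z \<longleftrightarrow> holomorphic_vector_field M U Z \<and>
     (\<forall>V f. open_in M V \<and> V \<subseteq> U \<and> holomorphic_fun V f \<longrightarrow>
        (\<forall>p\<in>V. lie_deriv M Z f p =
           lie_deriv M X (lie_deriv M Y f) p - lie_deriv M Y (lie_deriv M X f) p))"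

section \<open>Rational functions and rational vector fields\<close>

definition homogeneous :: "nat \<Rightarrow> (complex ^ 'n::finite \<Rightarrow> complex) \<Rightarrow> bool" where
  "homogeneous d P \<longleftrightarrow>
     (\<exists>c. P = (\<lambda>x. \<Sum>\<alpha> | (\<Sum>i\<in>UNIV. \<alpha> i) = d. c \<alpha> * (\<Prod>i\<in>UNIV. x $ i ^ \<alpha> i)))"

text \<open>The field \<open>\<complex>(M)\<close>.  The class of a fraction \<open>P/Q\<close> of forms of the same degree is
  represented by the partial function on its full domain of regularity: it has a value at \<open>p\<close> if
  some fraction that is equal to \<open>P/Q\<close> on \<open>M\<close> has a denominator not vanishing at \<open>p\<close>.\<close>

definition rational_functions :: "'n::finite cproj set \<Rightarrow> ('n cproj \<rightharpoonup> complex) set" where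
  "rational_functions M = {f. \<exists>d P Q. homogeneous d P \<and> homogeneous d Q \<and>
     (\<exists>q\<in>M. Q (rep_cproj q) \<noteq> 0) \<and>
     (\<forall>p c. f p = Some c \<longleftrightarrow> p \<in> M \<and>
        (\<exists>e P' Q'. homogeneous e P' \<and> homogeneous e Q' \<and>
           (\<forall>q\<in>M. P (rep_cproj q) * Q' (rep_cproj q) = P' (rep_cproj q) * Q (rep_cproj q)) \<and>
           Q' (rep_cproj p) \<noteq> 0 \<and> c = P' (rep_cproj p) / Q' (rep_cproj p)))}"

text \<open>A rational vector field is likewise taken on its full domain of regularity: its components
  in each affine chart are rational functions on \<open>M\<close>, and it is defined where they all are.\<close>

definition rational_vector_field :: "'n::finite cproj set \<Rightarrow> ('n cproj \<rightharpoonup> 'n tvec) \<Rightarrow> bool" where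
  "rational_vector_field M X \<longleftrightarrow>
     (\<exists>a. (\<forall>i k. a i k \<in> rational_functions M) \<and>
        (\<forall>p. X p =
          (if p \<in> M \<and> (\<forall>i k. p \<in> chart_dom i \<longrightarrow> p \<in> dom (a i k))
           then Some (\<chi> i k. if p \<in> chart_dom i then the (a i k p) else 0)
           else None))) \<and>
     (\<forall>p w. X p = Some w \<longrightarrow> w \<in> tangent_space M p)"

definition integral_curve ::
    "'n::finite cproj set \<Rightarrow> ('n cproj \<rightharpoonup> 'n tvec) \<Rightarrow> complex set \<Rightarrow> (complex \<Rightarrow> 'n cproj) \<Rightarrow> bool" where
  "integral_curve M X T \<gamma> \<longleftrightarrow> connected T \<and> holomorphic_curve M T \<gamma> \<and> \<gamma> ` T \<subseteq> dom X \<and>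
     (\<forall>t\<in>T. velocity \<gamma> t (the (X (\<gamma> t))))"

definition first_integrals ::
    "'n::finite cproj set \<Rightarrow> ('n cproj \<rightharpoonup> 'n tvec) \<Rightarrow> ('n cproj \<rightharpoonup> complex) set" where
  "first_integrals M X = {h \<in> rational_functions M.
     \<forall>T \<gamma>. integral_curve M X T \<gamma> \<and> \<gamma> ` T \<subseteq> dom h \<longrightarrow> (\<lambda>t. h (\<gamma> t)) constant_on T}"

section \<open>Singular holomorphic distributions\<close>

text \<open>A singular holomorphic distribution is a coherent subsheaf of the tangent sheaf.  Sections
  over \<open>U\<close> are represented by total functions whose values outside \<open>U\<close> are irrelevant.  A subsheaf
  of finite type of a locally free sheaf is coherent by Oka's theorem, so that finite type is
  all that has to be required.\<close>

definition tangent_subsheaf ::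
    "'n::finite cproj set \<Rightarrow> ('n cproj set \<Rightarrow> ('n cproj \<Rightarrow> 'n tvec) set) \<Rightarrow> bool" where
  "tangent_subsheaf M D \<longleftrightarrow>
     (\<forall>U. open_in M U \<longrightarrow>
        (\<forall>X\<in>D U. holomorphic_vector_field M U X) \<and>
        (\<lambda>p. 0) \<in> D U \<and>
        (\<forall>X\<in>D U. \<forall>Y\<in>D U. (\<lambda>p. X p + Y p) \<in> D U) \<and>
        (\<forall>X\<in>D U. \<forall>f. holomorphic_fun U f \<longrightarrow> (\<lambda>p. tscale (f p) (X p)) \<in> D U) \<and>
        (\<forall>X\<in>D U. \<forall>Y. (\<forall>p\<in>U. X p = Y p) \<longrightarrow> Y \<in> D U) \<and>
        (\<forall>X\<in>D U. \<forall>V. open_in M V \<and> V \<subseteq> U \<longrightarrow> X \<in> D V) \<and>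
        (\<forall>X. (\<forall>p\<in>U. \<exists>V. open_in M V \<and> p \<in> V \<and> V \<subseteq> U \<and> X \<in> D V) \<longrightarrow> X \<in> D U))"

definition finite_type ::
    "'n::finite cproj set \<Rightarrow> ('n cproj set \<Rightarrow> ('n cproj \<Rightarrow> 'n tvec) set) \<Rightarrow> bool" where
  "finite_type M D \<longleftrightarrow>
     (\<forall>p\<in>M. \<exists>U G. open_in M U \<and> p \<in> U \<and> finite G \<and> G \<subseteq> D U \<and>
        (\<forall>V X q. open_in M V \<and> V \<subseteq> U \<and> X \<in> D V \<and> q \<in> V \<longrightarrow>
           (\<exists>W f. open_in M W \<and> q \<in> W \<and> W \<subseteq> V \<and> (\<forall>g\<in>G. holomorphic_fun W (f g)) \<and>
              (\<forall>x\<in>W. X x = (\<Sum>g\<in>G. tscale (f g x) (g x))))))"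

definition singular_distribution ::
    "'n::finite cproj set \<Rightarrow> ('n cproj set \<Rightarrow> ('n cproj \<Rightarrow> 'n tvec) set) \<Rightarrow> bool" where
  "singular_distribution M D \<longleftrightarrow> tangent_subsheaf M D \<and> finite_type M D"

text \<open>Below, ``generically'' means on a dense open subset.  Since \<open>D\<close> is coherent, the loci where
  bracket closure or tangency fails are supports of coherent sheaves, so this is the same as
  requiring the condition off a nowhere dense analytic subset.\<close>

definition integrable_distribution ::
    "'n::finite cproj set \<Rightarrow> ('n cproj set \<Rightarrow> ('n cproj \<Rightarrow> 'n tvec) set) \<Rightarrow> bool" where
  "integrable_distribution M D \<longleftrightarrow>
     (\<exists>V. dense_open_in M V \<and>
        (\<forall>U. open_in M U \<and> U \<subseteq> V \<longrightarrow>
           (\<forall>X\<in>D U. \<forall>Y\<in>D U. \<exists>Z\<in>D U. is_lie_bracket M U X Y Z)))"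

definition tangent_to ::
    "'n::finite cproj set \<Rightarrow> ('n cproj \<rightharpoonup> 'n tvec) \<Rightarrow>
      ('n cproj set \<Rightarrow> ('n cproj \<Rightarrow> 'n tvec) set) \<Rightarrow> bool" where
  "tangent_to M X D \<longleftrightarrow>
     (\<exists>V. dense_open_in M V \<and> V \<subseteq> dom X \<and> (\<lambda>p. the (X p)) \<in> D V)"

definition distribution_first_integrals ::
    "'n::finite cproj set \<Rightarrow> ('n cproj set \<Rightarrow> ('n cproj \<Rightarrow> 'n tvec) set) \<Rightarrow>
      ('n cproj \<rightharpoonup> complex) set" where
  "distribution_first_integrals M D = {h \<in> rational_functions M.
     \<forall>X. rational_vector_field M X \<and> tangent_to M X D \<longrightarrow> h \<in> first_integrals M X}"

end

theory Submission
  imports Defs "HOL-Complex_Analysis.Conformal_Mappings"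
begin

text \<open>
  A rational function \<open>h\<close> is a first integral of \<open>\<D>\<close> exactly when it is killed by a family of derivations of the
  function field \<open>\<complex>(M)\<close>, namely by the rational vector fields tangent to \<open>\<D>\<close>.  The common kernel \<open>K\<close> of
  any family of derivations is a subfield that contains \<open>\<complex>\<close> and is algebraically closed in \<open>\<complex>(M)\<close>: if
  \<open>q(h) = 0\<close> is an equation of least degree over \<open>K\<close> and \<open>X\<close> kills \<open>K\<close>, then \<open>q'(h) \<cdot> X h = 0\<close>.  It is
  therefore enough to produce one rational vector field \<open>X\<close> whose kernel is a given field \<open>K\<close> of this
  kind.

  Choose a transcendence basis \<open>u\<^sub>0, \<dots>, u\<^sub>s\<^sub>-\<^sub>1\<close> of \<open>\<complex>(M)\<close> over \<open>\<complex>\<close> whose first \<open>s\<^sub>0\<close> members form a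
  transcendence basis of \<open>K\<close>, and let \<open>X u\<^sub>j = 0\<close> for \<open>j < s\<^sub>0\<close> and \<open>X u\<^sub>j = c\<^sub>j u\<^sub>j\<close> for the other \<open>j\<close>, where
  the complex numbers \<open>c\<^sub>j\<close> are linearly independent over the rationals.  The monomials in the \<open>u\<^sub>j\<close> with
  \<open>j \<ge> s\<^sub>0\<close> are eigenfunctions of \<open>X\<close> with distinct eigenvalues.  If \<open>X h = 0\<close>, a polynomial relation
  between \<open>h\<close> and the \<open>u\<^sub>j\<close> is a sum of eigenfunctions, so it splits into relations between \<open>h\<close> and
  the \<open>u\<^sub>j\<close> with \<open>j < s\<^sub>0\<close>.  Hence \<open>h\<close> is algebraic over \<open>K\<close> and belongs to \<open>K\<close>
  (\<open>constants_algebraic_over_kernel_part\<close>, \<open>der_algebraic_zero\<close>).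

  The derivation \<open>X\<close> has to be a vector field on \<open>M\<close>, so its values must be tangent to \<open>M\<close>, and this is
  where compactness enters: more than \<open>m = dim M\<close> rational functions are algebraically dependent
  (\<open>algebraic_dependence\<close>, a theorem of Siegel), so that \<open>s \<le> m\<close>.  At a generic point \<open>p\<close> the affine
  coordinates are algebraic over the \<open>u\<^sub>j\<close>, so a tangent vector annihilated by all the differentials
  \<open>du\<^sub>j\<close> vanishes; as \<open>s \<le> m\<close>, these differentials then take any prescribed values on a unique vector
  of \<open>T\<^sub>pM\<close>.  Differentiating the algebraic relations shows that the components of that vector are
  rational functions of \<open>p\<close>
  (\<open>tangent_vector_with_prescribed_differentials\<close>).  Tangency passes from generic points to the whole
  domain of regularity of \<open>X\<close> by continuity (\<open>tangency_closure\<close>).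

  Siegel's theorem rests on a version of the Schwarz lemma: on a compact manifold of dimension \<open>m\<close>, a
  form of degree \<open>N\<close> that vanishes at certain \<open>O(N\<^sup>m)\<close> points vanishes on the whole manifold
  (\<open>finite_determination_of_forms\<close>), while there are about \<open>e\<^sup>m\<^sup>+\<^sup>1\<close> monomials of degree at most \<open>e\<close> in
  each of \<open>m + 1\<close> functions.

  Since first integrals are defined by means of integral curves, kernels of derivations have to be
  compared with them.  If \<open>h\<close> is constant along integral curves then \<open>X h = 0\<close> because an integral
  curve passes through every generic point: the differential equation is solved in the ambient affine
  space, and its solutions stay on \<open>M\<close> (\<open>integral_curve_exists\<close>).  Conversely the function \<open>X h\<close> is
  continuous where \<open>X\<close> and \<open>h\<close> are regular, so it vanishes there once it vanishes generically
  (\<open>first_integral_of_der_zero\<close>).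
\<close>

section \<open>Linear systems and interpolation at roots of unity\<close>

text \<open>Each equation eliminates one unknown.  The index sets are arbitrary because the lemma serves
  twice: for monomials against points of evaluation, and for tangent vectors against differentials.\<close>

lemma homogeneous_linear_system_nontrivial_solution:
  fixes A :: "'j \<Rightarrow> 'i \<Rightarrow> 'a::field"
  assumes "finite J" "finite I" "card J < card I"
  shows "\<exists>c. (\<exists>i\<in>I. c i \<noteq> 0) \<and> (\<forall>j\<in>J. (\<Sum>i\<in>I. A j i * c i) = 0)"
  using assms
proof (induction J arbitrary: I A rule: finite_induct)
  case empty
  then obtain i where "i \<in> I" by (metis card_gt_0_iff card.empty ex_in_conv)
  then show ?case by (intro exI[of _ "\<lambda>_. 1"]) auto
next
  case (insert j J)
  show ?case
  proof (cases "\<forall>i\<in>I. A j i = 0")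
    case True
    have "card J < card I" using insert by simp
    then obtain c where "\<exists>i\<in>I. c i \<noteq> 0" "\<forall>j\<in>J. (\<Sum>i\<in>I. A j i * c i) = 0"
      using insert.IH[of I A] insert.prems by auto
    then show ?thesis using True by (intro exI[of _ c]) auto
  next
    case False
    then obtain k where k: "k \<in> I" "A j k \<noteq> 0" by auto
    define I' where "I' = I - {k}"
    define A' where "A' = (\<lambda>l i. A l i - A l k * A j i / A j k)"
    have "finite I'" "card J < card I'"
      using insert k by (auto simp: I'_def)
    then obtain c where c: "\<exists>i\<in>I'. c i \<noteq> 0" "\<forall>l\<in>J. (\<Sum>i\<in>I'. A' l i * c i) = 0"
      using insert.IH[of I' A'] by auto
    define c' where "c' = c(k := - (\<Sum>i\<in>I'. A j i * c i) / A j k)"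
    have split: "(\<Sum>i\<in>I. A l i * c' i) = A l k * c' k + (\<Sum>i\<in>I'. A l i * c i)" for l
    proof -
      have "(\<Sum>i\<in>I. A l i * c' i) = A l k * c' k + (\<Sum>i\<in>I'. A l i * c' i)"
        unfolding I'_def using insert.prems k by (simp add: sum.remove)
      also have "(\<Sum>i\<in>I'. A l i * c' i) = (\<Sum>i\<in>I'. A l i * c i)"
        by (rule sum.cong) (auto simp: I'_def c'_def)
      finally show ?thesis .
    qed
    have "(\<Sum>i\<in>I. A l i * c' i) = 0" if "l \<in> J" for l
    proof -
      have "(\<Sum>i\<in>I'. A' l i * c i) = (\<Sum>i\<in>I'. A l i * c i) - A l k / A j k * (\<Sum>i\<in>I'. A j i * c i)"
        by (simp add: A'_def sum_subtractf sum_distrib_left algebra_simps)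
      then show ?thesis using c(2) that split[of l] by (simp add: c'_def field_simps)
    qed
    moreover have "(\<Sum>i\<in>I. A j i * c' i) = 0"
      using split[of j] k by (simp add: c'_def)
    moreover have "\<exists>i\<in>I. c' i \<noteq> 0"
      using c(1) by (auto simp: I'_def c'_def)
    ultimately show ?thesis by (intro exI[of _ c']) auto
  qed
qed

lemma root_of_unity_power_sum:
  fixes w :: complex
  assumes "w ^ k = 1" "w \<noteq> 1"
  shows "(\<Sum>j<k. w ^ j) = 0"
  using assms by (simp add: geometric_sum)

lemma norm_root_of_unity:
  fixes a :: complex
  assumes "a ^ k = 1" "k \<ge> 1"
  shows "norm a = 1"
proof -
  have "norm a ^ k = 1 ^ k" using assms(1) by (simp flip: norm_power)
  then show ?thesis using assms(2) power_eq_imp_eq_base[of "norm a" k 1] by simp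
qed

text \<open>Discrete Fourier inversion bounds every coefficient by the maximum over the roots of unity.
  The loss of the factor \<open>k\<close> is harmless below, where it competes with a factor exponential in \<open>k\<close>.\<close>

lemma polynomial_bound_by_roots_of_unity:
  fixes c :: "nat \<Rightarrow> complex"
  assumes k: "k \<ge> 1" and e: "\<And>a. a ^ k = 1 \<Longrightarrow> norm (\<Sum>n<k. c n * a ^ n) \<le> e" and z: "norm z \<le> 1"
  shows "norm (\<Sum>n<k. c n * z ^ n) \<le> real k * e"
proof -
  define w where "w = cis (2 * pi / k)"
  have wk: "w ^ k = 1" using k by (simp add: w_def Complex.DeMoivre)
  have nw: "norm w = 1" by (simp add: w_def)
  have w0: "w \<noteq> 0" using nw by auto
  have prim: "w ^ n \<noteq> 1" if "0 < n" "n < k" for n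
  proof
    assume "w ^ n = 1"
    then have "cis (2 * pi * (n / k)) = 1" by (simp add: w_def Complex.DeMoivre algebra_simps)
    then have "cos (2 * pi * (n / k)) = 1" by (simp add: complex_eq_iff)
    then obtain i::int where "2 * pi * (n / k) = i * 2 * pi" using cos_one_2pi_int by auto
    then have "n / k = i" using k by (simp add: field_simps)
    moreover have "0 < real n / k" "real n / k < 1" using that by auto
    ultimately have "0 < real_of_int i" "real_of_int i < 1" by metis+
    then have "0 < i" "i < 1" by simp_all
    then show False by linarith
  qed
  define T where "T = (\<lambda>z. \<Sum>n<k. c n * z ^ n)"
  have coeff: "c n * k = (\<Sum>j<k. T (w ^ j) * inverse (w ^ (j * n)))" if "n < k" for n
  proof -
    have "(\<Sum>j<k. T (w ^ j) * inverse (w ^ (j * n))) = (\<Sum>j<k. \<Sum>l<k. c l * (w ^ (j * l) * inverse (w ^ (j * n))))"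
      by (simp add: T_def sum_distrib_right power_mult mult.assoc)
    also have "\<dots> = (\<Sum>l<k. \<Sum>j<k. c l * (w ^ (j * l) * inverse (w ^ (j * n))))"
      by (rule sum.swap)
    also have "\<dots> = (\<Sum>l<k. if l = n then c n * k else 0)"
    proof (rule sum.cong[OF refl])
      fix l assume l: "l \<in> {..<k}"
      define v where "v = w ^ l * inverse (w ^ n)"
      have "(\<Sum>j<k. c l * (w ^ (j * l) * inverse (w ^ (j * n)))) = c l * (\<Sum>j<k. v ^ j)"
        unfolding sum_distrib_left v_def
        by (rule sum.cong) (auto simp: power_mult_distrib power_inverse power_mult[symmetric] mult.commute)
      also have "\<dots> = (if l = n then c n * k else 0)"
      proof (cases "l = n")
        case True
        then have "v = 1" using w0 by (simp add: v_def)
        then show ?thesis using True by simp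
      next
        case False
        have "v \<noteq> 1"
        proof
          assume "v = 1"
          then have "w ^ l = w ^ n" using w0 by (simp add: v_def field_simps)
          then have "w ^ (max l n - min l n) = 1"
            using w0 power_diff[of w "min l n" "max l n"] by (auto simp: max_def min_def split: if_splits)
          moreover have "0 < max l n - min l n" using False by (simp add: max_def min_def)
          moreover have "max l n - min l n < k" using l that by (simp add: max_def min_def less_imp_diff_less)
          ultimately show False using prim by blast
        qed
        moreover have "v ^ k = (w ^ k) ^ l * inverse ((w ^ k) ^ n)"
          unfolding v_def by (simp add: power_mult_distrib power_inverse power_mult[symmetric] mult.commute)
        then have "v ^ k = 1" using wk by simp
        ultimately show ?thesis using False root_of_unity_power_sum by auto
      qed
      finally show "(\<Sum>j<k. c l * (w ^ (j * l) * inverse (w ^ (j * n)))) = (if l = n then c n * k else 0)" .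
    qed
    also have "\<dots> = c n * k" using that by simp
    finally show ?thesis by simp
  qed
  have cb: "norm (c n) \<le> e" if "n < k" for n
  proof -
    have Te: "norm (T (w ^ j)) \<le> e" for j
    proof -
      have "(w ^ j) ^ k = 1" using wk by (metis power_mult mult.commute power_one)
      then show ?thesis using e unfolding T_def by blast
    qed
    have "norm (c n) * k = norm (c n * k)" by (simp add: norm_mult)
    also have "\<dots> \<le> (\<Sum>j<k. norm (T (w ^ j) * inverse (w ^ (j * n))))"
      unfolding coeff[OF that] by (rule norm_sum)
    also have "\<dots> \<le> (\<Sum>j<k. e)"
      using Te nw by (intro sum_mono) (simp add: norm_mult norm_inverse norm_power)
    finally have "norm (c n) * k \<le> e * k" by (simp add: mult.commute)
    then show ?thesis using k by (simp)
  qed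
  have "norm (\<Sum>n<k. c n * z ^ n) \<le> (\<Sum>n<k. norm (c n * z ^ n))" by (rule norm_sum)
  also have "\<dots> \<le> (\<Sum>n<k. e)"
  proof (rule sum_mono)
    fix n assume n: "n \<in> {..<k}"
    have "norm (c n * z ^ n) \<le> norm (c n) * 1"
      unfolding norm_mult norm_power using z by (intro mult_left_mono) (auto simp: power_le_one)
    then show "norm (c n * z ^ n) \<le> e" using cb n by force
  qed
  finally show ?thesis by simp
qed

text \<open>A Schwarz lemma in which a zero of order \<open>k\<close> at the origin is replaced by (approximate) zeros
  at the \<open>k\<close>-th roots of unity.  On the unit disc \<open>g\<close> differs from its Taylor polynomial of degree
  below \<open>k\<close> by at most \<open>2 * S / 2 ^ k\<close>, by Cauchy's estimates on the disc of radius 2, and that polynomial is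
  controlled by its values at the roots of unity.  Only values of \<open>g\<close> enter, no derivatives, which
  makes the passage to several variables easy.\<close>

lemma holomorphic_bound_by_roots_of_unity:
  fixes S e :: real
  assumes k: "k \<ge> 1" and hol: "g holomorphic_on ball 0 3"
    and S: "\<And>z. z \<in> ball 0 3 \<Longrightarrow> norm (g z) \<le> S"
    and e: "\<And>a. a ^ k = 1 \<Longrightarrow> norm (g a) \<le> e" and z: "norm z \<le> 1"
  shows "norm (g z) \<le> real k * e + real (k + 1) * (2 * S / 2 ^ k)"
proof -
  define c where "c = (\<lambda>n. (deriv ^^ n) g 0 / fact n)"
  have cn: "norm (c n) \<le> S / 2 ^ n" for n
  proof -
    have "norm ((deriv ^^ n) g 0) \<le> fact n * S / 2 ^ n"
    proof (rule Cauchy_inequality)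
      show "g holomorphic_on ball 0 2" using hol by (rule holomorphic_on_subset) auto
      show "continuous_on (cball 0 2) g"
        by (rule holomorphic_on_imp_continuous_on, rule holomorphic_on_subset[OF hol]) auto
    qed (use S in auto)
    then show ?thesis by (simp add: c_def norm_divide field_simps)
  qed
  define T where "T = (\<lambda>z. \<Sum>n<k. c n * z ^ n)"
  define d where "d = 2 * S / 2 ^ k"
  have rest: "norm (g z - T z) \<le> d" if "norm z \<le> 1" for z
  proof -
    have "(\<lambda>n. c n * (z - 0) ^ n) sums g z"
      unfolding c_def using holomorphic_power_series[OF hol, of z] that by auto
    then have "(\<lambda>n. c (n + k) * z ^ (n + k)) sums (g z - T z)"
      unfolding T_def using sums_iff_shift[of "\<lambda>n. c n * z ^ n" k "g z - (\<Sum>n<k. c n * z ^ n)"] by simp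
    moreover have "norm (c (n + k) * z ^ (n + k)) \<le> S / 2 ^ k * (1/2) ^ n" for n
    proof -
      have "norm (c (n + k) * z ^ (n + k)) \<le> norm (c (n + k)) * 1"
        unfolding norm_mult norm_power using that by (intro mult_left_mono) (auto simp: power_le_one)
      also have "\<dots> \<le> S / 2 ^ (n + k)" using cn by simp
      finally show ?thesis by (simp add: power_add field_simps)
    qed
    moreover have "(\<lambda>n. S / 2 ^ k * (1/2) ^ n) sums (S / 2 ^ k * 2)"
      using sums_mult[OF geometric_sums[of "1/2::real"], of "S / 2 ^ k"] by simp
    ultimately have "norm (g z - T z) \<le> S / 2 ^ k * 2"
      using norm_suminf_le[of "\<lambda>n. c (n + k) * z ^ (n + k)" "\<lambda>n. S / 2 ^ k * (1/2) ^ n"]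
      unfolding sums_iff by simp
    then show ?thesis by (simp add: d_def mult.commute)
  qed
  have "norm (T z) \<le> k * (e + d)"
    unfolding T_def
  proof (rule polynomial_bound_by_roots_of_unity[OF k _ z])
    fix a :: complex assume a: "a ^ k = 1"
    then have "norm a = 1" using norm_root_of_unity k by blast
    then have "norm (g a - T a) \<le> d" by (intro rest) simp
    moreover have "norm (T a) \<le> norm (g a) + norm (g a - T a)"
      using norm_triangle_ineq4[of "g a" "g a - T a"] by simp
    ultimately have "norm (T a) \<le> norm (g a) + d" by linarith
    then show "norm (\<Sum>n<k. c n * a ^ n) \<le> e + d"
      using e[OF a] unfolding T_def by linarith
  qed
  moreover have "norm (g z) \<le> norm (T z) + norm (g z - T z)"
    using norm_triangle_ineq[of "T z" "g z - T z"] by simp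
  ultimately have "norm (g z) \<le> k * (e + d) + d" using rest[OF z] by linarith
  then show ?thesis by (simp add: d_def algebra_simps add_divide_distrib)
qed

text \<open>The coordinates are released one after the other from the roots of unity into the disc, with
  the previous lemma applied in one variable each time; \<open>G\<close> needs to be holomorphic only in each
  variable separately.\<close>

lemma polydisc_bound_by_roots_of_unity:
  fixes G :: "('b \<Rightarrow> complex) \<Rightarrow> complex" and S :: real
  assumes k: "k \<ge> 1" and B: "finite B"
    and hol: "\<And>t b. b \<in> B \<Longrightarrow> (\<And>b. b \<in> B \<Longrightarrow> norm (t b) < 3) \<Longrightarrow> (\<lambda>z. G (t(b := z))) holomorphic_on ball 0 3"
    and S: "\<And>t. (\<And>b. b \<in> B \<Longrightarrow> norm (t b) < 3) \<Longrightarrow> norm (G t) \<le> S"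
    and zero: "\<And>t. (\<And>b. b \<in> B \<Longrightarrow> t b ^ k = 1) \<Longrightarrow> (\<And>b. b \<notin> B \<Longrightarrow> t b = 0) \<Longrightarrow> G t = 0"
    and t: "\<And>b. b \<in> B \<Longrightarrow> norm (t b) \<le> 1" "\<And>b. b \<notin> B \<Longrightarrow> t b = 0"
  shows "norm (G t) \<le> 2 * card B * (k + 1) ^ card B * S / 2 ^ k"
proof -
  have unit: "norm a = 1" if "a ^ k = 1" for a :: complex
    using that k norm_root_of_unity by blast
  have S0: "S \<ge> 0" using order_trans[OF norm_ge_zero S[of "\<lambda>_. 0"]] by simp
  \<comment> \<open>The variables in \<open>F\<close> range over the disc already, the others are still roots of unity.\<close>
  have "norm (G t) \<le> 2 * card F * (k + 1) ^ card F * S / 2 ^ k"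
    if "F \<subseteq> B" "\<And>b. b \<in> F \<Longrightarrow> norm (t b) \<le> 1" "\<And>b. b \<in> B - F \<Longrightarrow> t b ^ k = 1" "\<And>b. b \<notin> B \<Longrightarrow> t b = 0" for F t
  proof -
    have "finite F" using that(1) B finite_subset by auto
    then show ?thesis using that
    proof (induction F arbitrary: t rule: finite_induct)
      case empty
      then show ?case using zero[of t] by auto
    next
      case (insert b F)
      have b: "b \<in> B" using insert by auto
      define e where "e = 2 * card F * (k + 1) ^ card F * S / 2 ^ k"
      have tn: "norm (t b) \<le> 1" if "b \<in> B" for b
        using that insert.prems unit by (metis DiffI order_refl)
      have "norm (G (t(b := t b))) \<le> real k * e + real (k + 1) * (2 * S / 2 ^ k)"
      proof (rule holomorphic_bound_by_roots_of_unity[where g = "\<lambda>z. G (t(b := z))" and z = "t b", OF k])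
        show "(\<lambda>z. G (t(b := z))) holomorphic_on ball 0 3"
          by (rule hol[OF b]) (use tn in force)
        show "norm (G (t(b := z))) \<le> S" if "z \<in> ball 0 3" for z
          by (rule S) (use tn that in force)
        show "norm (G (t(b := a))) \<le> e" if "a ^ k = 1" for a
          unfolding e_def
          by (rule insert.IH) (use insert.prems insert.hyps that b in auto)
        show "norm (t b) \<le> 1" using tn b by auto
      qed
      also have "\<dots> \<le> 2 * card (insert b F) * (k + 1) ^ card (insert b F) * S / 2 ^ k"
      proof -
        define q where "q = real ((k + 1) ^ card F)"
        define s where "s = 2 * S / 2 ^ k"
        have q: "q \<ge> 1" unfolding q_def by simp
        have s: "s \<ge> 0" using S0 by (simp add: s_def)
        have "k * (card F * q * s) + (k + 1) * s \<le> (k + 1) * (card F * q * s) + (k + 1) * (q * s)"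
          using q s by (intro add_mono mult_right_mono mult_left_mono) (auto simp: mult_le_cancel_right1)
        also have "\<dots> = (card F + 1) * ((k + 1) * q) * s" by (simp add: algebra_simps)
        finally show ?thesis
          using insert.hyps by (simp add: e_def q_def s_def algebra_simps add_divide_distrib)
      qed
      finally show ?case by simp
    qed
  qed
  from this[of B t] show ?thesis using t by auto
qed

section \<open>Holomorphic maps in several variables\<close>

lemma norm_vector_smult: "norm (c *s (x :: complex ^ 'n)) = norm c * norm x"
  by (simp add: norm_vec_def norm_mult L2_set_right_distrib)

lemma scaleR_eq_smult: "r *\<^sub>R (x :: complex ^ 'n) = complex_of_real r *s x"
  by (simp add: vec_eq_iff scaleR_conv_of_real[where 'a = complex])

lemma norm_le_sum_components: "norm (x :: complex ^ 'n) \<le> (\<Sum>k\<in>UNIV. norm (x $ k))"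
  unfolding norm_vec_def by (rule L2_set_le_sum) simp

lemma has_derivative_vec_iff:
  fixes f :: "'a::real_normed_vector \<Rightarrow> complex ^ 'n"
  shows "(f has_derivative f') (at x within S) \<longleftrightarrow>
    (\<forall>k. ((\<lambda>x. f x $ k) has_derivative (\<lambda>h. f' h $ k)) (at x within S))" (is "?l \<longleftrightarrow> ?r")
proof
  show "?r" if "?l"
    using bounded_linear.has_derivative[OF bounded_linear_vec_nth that] by blast
  assume r: "?r"
  show "?l"
  proof (subst has_derivative_componentwise_within, intro ballI)
    fix b :: "complex ^ 'n"
    assume "b \<in> Basis"
    then obtain k c where b: "b = axis k c" by (auto simp: Basis_vec_def)
    have "((\<lambda>x. inner (f x $ k) c) has_derivative (\<lambda>h. inner (f' h $ k) c)) (at x within S)"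
      using r by (intro has_derivative_inner_left) auto
    then show "((\<lambda>x. inner (f x) b) has_derivative (\<lambda>h. inner (f' h) b)) (at x within S)"
      by (simp add: b inner_axis)
  qed
qed

lemma has_derivative_smult_iff:
  fixes \<gamma> :: "complex \<Rightarrow> complex ^ 'n"
  shows "(\<gamma> has_derivative (\<lambda>h. h *s v)) (at t within T) \<longleftrightarrow>
    (\<forall>k. ((\<lambda>s. \<gamma> s $ k) has_field_derivative v $ k) (at t within T))"
  unfolding has_derivative_vec_iff has_field_derivative_def
  by (simp add: mult.commute[of "v $ _"] mult_commute_abs)

definition mvd :: "(complex ^ 'n::finite \<Rightarrow> complex) \<Rightarrow> complex ^ 'n \<Rightarrow> complex ^ 'n \<Rightarrow> complex" where
  "mvd F x = frechet_derivative F (at x)"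

lemma holomorphic_mvD:
  assumes "holomorphic_mv F V" "x \<in> V"
  shows "(F has_derivative mvd F x) (at x)" "mvd F x (c *s v) = c * mvd F x v"
proof -
  obtain F' where F': "(F has_derivative F') (at x)" "\<And>c v. F' (c *s v) = c * F' v"
    using assms by (auto simp: holomorphic_mv_def)
  then have "mvd F x = F'" unfolding mvd_def using frechet_derivative_at by metis
  then show "(F has_derivative mvd F x) (at x)" "mvd F x (c *s v) = c * mvd F x v"
    using F' by auto
qed

lemma mvd_eqI: "(F has_derivative F') (at x) \<Longrightarrow> mvd F x = F'"
  unfolding mvd_def using frechet_derivative_at by metis

lemma holomorphic_mv_open: "holomorphic_mv F V \<Longrightarrow> open V"
  by (simp add: holomorphic_mv_def)

lemma holomorphic_mv_subset: "holomorphic_mv F V \<Longrightarrow> open U \<Longrightarrow> U \<subseteq> V \<Longrightarrow> holomorphic_mv F U"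
  by (auto simp: holomorphic_mv_def)

lemma mvd_linear:
  assumes "holomorphic_mv F V" "x \<in> V"
  shows "mvd F x (v + w) = mvd F x v + mvd F x w" "mvd F x (v - w) = mvd F x v - mvd F x w"
    "mvd F x 0 = 0"
proof -
  interpret bounded_linear "mvd F x"
    using holomorphic_mvD(1)[OF assms] by (rule has_derivative_bounded_linear)
  show "mvd F x (v + w) = mvd F x v + mvd F x w" "mvd F x (v - w) = mvd F x v - mvd F x w"
    "mvd F x 0 = 0" by (simp_all add: add diff)
qed

lemma holomorphic_mv_continuous_on: "holomorphic_mv F V \<Longrightarrow> continuous_on V F"
  by (meson continuous_at_imp_continuous_on has_derivative_continuous holomorphic_mvD(1))

lemma holomorphic_mv_along_curve:
  assumes "holomorphic_mv F V" "(\<gamma> has_derivative (\<lambda>h. h *s v)) (at t within T)" "\<gamma> t \<in> V"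
  shows "((\<lambda>s. F (\<gamma> s)) has_field_derivative mvd F (\<gamma> t) v) (at t within T)"
proof -
  have "((\<lambda>s. F (\<gamma> s)) has_derivative (\<lambda>h. mvd F (\<gamma> t) (h *s v))) (at t within T)"
    using has_derivative_compose[OF assms(2) holomorphic_mvD(1)[OF assms(1,3)]] .
  then show ?thesis
    unfolding has_field_derivative_def holomorphic_mvD(2)[OF assms(1,3)]
    by (simp add: mult_commute_abs)
qed

lemma has_derivative_line: "((\<lambda>s::complex. x + s *s v) has_derivative (\<lambda>h. h *s v)) (at t within T)"
  unfolding has_derivative_smult_iff by (auto intro!: derivative_eq_intros)

lemma holomorphic_mv_on_line:
  assumes "holomorphic_mv F V" "(\<lambda>s. x + s *s v) ` T \<subseteq> V"
  shows "(\<lambda>s. F (x + s *s v)) holomorphic_on T"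
  unfolding holomorphic_on_def field_differentiable_def
  using holomorphic_mv_along_curve[OF assms(1) has_derivative_line] assms(2) by blast

subsection \<open>Arithmetic\<close>

lemma holomorphic_mv_const [intro]: "open V \<Longrightarrow> holomorphic_mv (\<lambda>x. c) V"
  by (auto simp: holomorphic_mv_def intro!: exI[of _ "\<lambda>_. 0"])

lemma holomorphic_mv_coord [intro]: "open V \<Longrightarrow> holomorphic_mv (\<lambda>x. x $ i) V"
  by (auto simp: holomorphic_mv_def intro!: exI[of _ "\<lambda>x. x $ i"] bounded_linear.has_derivative[OF bounded_linear_vec_nth] has_derivative_ident)

lemma holomorphic_mv_add [intro]:
  assumes "holomorphic_mv F V" "holomorphic_mv G V"
  shows "holomorphic_mv (\<lambda>x. F x + G x) V"
  unfolding holomorphic_mv_def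
proof (intro conjI ballI)
  show "open V" using assms by (simp add: holomorphic_mv_def)
  fix x assume x: "x \<in> V"
  show "\<exists>F'. ((\<lambda>x. F x + G x) has_derivative F') (at x) \<and> (\<forall>c v. F' (c *s v) = c * F' v)"
    using has_derivative_add[OF holomorphic_mvD(1)[OF assms(1) x] holomorphic_mvD(1)[OF assms(2) x]]
      holomorphic_mvD(2)[OF assms(1) x] holomorphic_mvD(2)[OF assms(2) x]
    by (auto intro!: exI[of _ "\<lambda>h. mvd F x h + mvd G x h"] simp: distrib_left)
qed

lemma holomorphic_mv_mult [intro]:
  assumes "holomorphic_mv F V" "holomorphic_mv G V"
  shows "holomorphic_mv (\<lambda>x. F x * G x) V"
  unfolding holomorphic_mv_def
proof (intro conjI ballI)
  show "open V" using assms by (simp add: holomorphic_mv_def)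
  fix x assume x: "x \<in> V"
  show "\<exists>F'. ((\<lambda>x. F x * G x) has_derivative F') (at x) \<and> (\<forall>c v. F' (c *s v) = c * F' v)"
    using has_derivative_mult[OF holomorphic_mvD(1)[OF assms(1) x] holomorphic_mvD(1)[OF assms(2) x]]
      holomorphic_mvD(2)[OF assms(1) x] holomorphic_mvD(2)[OF assms(2) x]
    by (auto intro!: exI[of _ "\<lambda>h. F x * mvd G x h + mvd F x h * G x"] simp: algebra_simps)
qed

lemma holomorphic_mv_inverse:
  assumes "holomorphic_mv F V" "\<And>x. x \<in> V \<Longrightarrow> F x \<noteq> 0"
  shows "holomorphic_mv (\<lambda>x. inverse (F x)) V"
  unfolding holomorphic_mv_def
proof (intro conjI ballI)
  show "open V" using assms by (simp add: holomorphic_mv_def)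
  fix x assume x: "x \<in> V"
  show "\<exists>F'. ((\<lambda>x. inverse (F x)) has_derivative F') (at x) \<and> (\<forall>c v. F' (c *s v) = c * F' v)"
    using Deriv.has_derivative_inverse[OF assms(2)[OF x] holomorphic_mvD(1)[OF assms(1) x]]
      holomorphic_mvD(2)[OF assms(1) x]
    by (auto intro!: exI[of _ "\<lambda>h. - (inverse (F x) * mvd F x h * inverse (F x))"] simp: algebra_simps)
qed

lemma holomorphic_mv_diff:
  assumes "holomorphic_mv F V" "holomorphic_mv G V"
  shows "holomorphic_mv (\<lambda>x. F x - G x) V"
  using holomorphic_mv_add[OF assms(1) holomorphic_mv_mult[OF holomorphic_mv_const[of V "-1"] assms(2)]] 
    assms by (simp add: holomorphic_mv_open)

lemma holomorphic_mv_divide: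
  assumes "holomorphic_mv F V" "holomorphic_mv G V" "\<And>x. x \<in> V \<Longrightarrow> G x \<noteq> 0"
  shows "holomorphic_mv (\<lambda>x. F x / G x) V"
  unfolding divide_inverse using assms by (intro holomorphic_mv_mult holomorphic_mv_inverse) auto

lemma holomorphic_mv_sum:
  assumes "open V" "\<And>a. a \<in> A \<Longrightarrow> holomorphic_mv (F a) V"
  shows "holomorphic_mv (\<lambda>x. \<Sum>a\<in>A. F a x) V"
  using assms(2)
proof (induction A rule: infinite_finite_induct)
  case (insert a A)
  then show ?case using holomorphic_mv_add[of "F a" V "\<lambda>x. \<Sum>a\<in>A. F a x"] by simp
qed (use assms(1) in auto)

lemma holomorphic_mv_power: "holomorphic_mv F V \<Longrightarrow> holomorphic_mv (\<lambda>x. F x ^ k) V"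
  by (induction k) (auto intro: holomorphic_mv_mult holomorphic_mv_open)

lemma holomorphic_mv_prod:
  assumes "open V" "\<And>a. a \<in> A \<Longrightarrow> holomorphic_mv (F a) V"
  shows "holomorphic_mv (\<lambda>x. \<Prod>a\<in>A. F a x) V"
  using assms(2)
proof (induction A rule: infinite_finite_induct)
  case (insert a A)
  then show ?case using holomorphic_mv_mult[of "F a" V "\<lambda>x. \<Prod>a\<in>A. F a x"] by simp
qed (use assms(1) in auto)

lemma mvd_diff:
  assumes "holomorphic_mv F V" "holomorphic_mv G V" "x \<in> V"
  shows "mvd (\<lambda>x. F x - G x) x v = mvd F x v - mvd G x v"
  using mvd_eqI[OF has_derivative_diff[OF holomorphic_mvD(1)[OF assms(1,3)] holomorphic_mvD(1)[OF assms(2,3)]]]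
  by simp

lemma holomorphic_mv_translate:
  assumes "holomorphic_mv F V"
  shows "holomorphic_mv (\<lambda>z. F (z + a)) ((\<lambda>z. z + a) -` V)"
    and "x + a \<in> V \<Longrightarrow> mvd (\<lambda>z. F (z + a)) x v = mvd F (x + a) v"
proof -
  have *: "((\<lambda>z. F (z + a)) has_derivative mvd F (x + a)) (at x)" if "x + a \<in> V" for x
  proof -
    have "((\<lambda>z. z + a) has_derivative (\<lambda>h. h)) (at x)" by (auto intro!: derivative_eq_intros)
    from has_derivative_compose[OF this holomorphic_mvD(1)[OF assms that]] show ?thesis .
  qed
  show "holomorphic_mv (\<lambda>z. F (z + a)) ((\<lambda>z. z + a) -` V)"
    unfolding holomorphic_mv_def
  proof (intro conjI ballI)
    show "open ((\<lambda>z. z + a) -` V)"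
      by (rule open_vimage) (auto intro: holomorphic_mv_open[OF assms] continuous_intros)
    show "\<exists>F'. ((\<lambda>z. F (z + a)) has_derivative F') (at x) \<and> (\<forall>c v. F' (c *s v) = c * F' v)"
      if "x \<in> (\<lambda>z. z + a) -` V" for x
      using *[of x] holomorphic_mvD(2)[OF assms, of "x + a"] that by (intro exI[of _ "mvd F (x + a)"]) auto
  qed
  show "x + a \<in> V \<Longrightarrow> mvd (\<lambda>z. F (z + a)) x v = mvd F (x + a) v"
    using mvd_eqI[OF *[of x]] by simp
qed

subsection \<open>Cauchy estimates\<close>

text \<open>The one-variable estimate on the complex line through \<open>x\<close> in the direction \<open>v\<close>.\<close>

lemma holomorphic_mv_Cauchy_estimate:
  assumes F: "holomorphic_mv F V" and r: "r > 0" "cball x r \<subseteq> V"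
    and B: "\<And>y. y \<in> cball x r \<Longrightarrow> norm (F y) \<le> B"
  shows "norm (mvd F x v) \<le> B / r * norm v"
proof (cases "v = 0")
  case True
  then show ?thesis using mvd_linear(3)[OF F, of x] r by (simp add: subset_iff)
next
  case False
  define \<rho> where "\<rho> = r / norm v"
  have \<rho>: "\<rho> > 0" using r False by (simp add: \<rho>_def)
  define g where "g = (\<lambda>s. F (x + s *s v))"
  have sub: "x + s *s v \<in> cball x r" if "s \<in> cball 0 \<rho>" for s
    using that False by (simp add: \<rho>_def dist_norm norm_vector_smult field_simps)
  have hol: "g holomorphic_on cball 0 \<rho>"
    unfolding g_def by (rule holomorphic_mv_on_line[OF F]) (use sub r(2) in blast)
  have "(g has_field_derivative mvd F (x + 0 *s v) v) (at 0)"
    unfolding g_def by (rule holomorphic_mv_along_curve[OF F has_derivative_line]) (use r in auto)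
  then have "deriv g 0 = mvd F x v" using DERIV_imp_deriv by force
  moreover have "norm ((deriv ^^ 1) g 0) \<le> fact 1 * B / \<rho> ^ 1"
  proof (rule Cauchy_inequality)
    show "g holomorphic_on ball 0 \<rho>" using hol by (rule holomorphic_on_subset) auto
    show "continuous_on (cball 0 \<rho>) g" using hol by (rule holomorphic_on_imp_continuous_on)
    show "norm (g s) \<le> B" if "norm (0 - s) = \<rho>" for s
      unfolding g_def using that by (intro B sub) simp
  qed (use \<rho> in auto)
  ultimately show ?thesis using False r by (simp add: \<rho>_def field_simps)
qed

text \<open>Holomorphic functions of several variables are defined by pointwise differentiability; this
  is the \<open>C\<^sup>1\<close> regularity that the later arguments rely on.  The Lipschitz bound for the derivative is
  the Cauchy estimate for the function \<open>F z - F (z + a)\<close>, which is small because \<open>F\<close> is Lipschitz.\<close>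

lemma holomorphic_mv_locally_Lipschitz:
  assumes F: "holomorphic_mv F V" and x0: "x0 \<in> V"
  shows "\<exists>d>0. \<exists>L\<ge>0. ball x0 d \<subseteq> V \<and> (\<forall>x\<in>ball x0 d. \<forall>y\<in>ball x0 d. norm (F x - F y) \<le> L * norm (x - y) \<and>
     (\<forall>v. norm (mvd F x v) \<le> L * norm v \<and> norm (mvd F x v - mvd F y v) \<le> L * norm (x - y) * norm v))"
proof -
  obtain e where e: "e > 0" "cball x0 e \<subseteq> V"
    using holomorphic_mv_open[OF F] x0 open_contains_cball by blast
  define r where "r = e / 3"
  have r: "r > 0" "3 * r = e" using e by (auto simp: r_def)
  have "compact (F ` cball x0 e)"
    using compact_continuous_image[OF continuous_on_subset[OF holomorphic_mv_continuous_on[OF F] e(2)]] by auto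
  then have "bounded (F ` cball x0 e)" by (rule compact_imp_bounded)
  then obtain B where B: "\<And>y. y \<in> cball x0 e \<Longrightarrow> norm (F y) \<le> B"
    unfolding bounded_iff by (metis imageI)
  have B0: "B \<ge> 0" using order_trans[OF norm_ge_zero B[of x0]] e by auto
  have sub: "cball z r \<subseteq> cball x0 e" if "z \<in> ball x0 (2*r)" for z
  proof
    fix y assume "y \<in> cball z r"
    then show "y \<in> cball x0 e" using that dist_triangle[of x0 y z] r by simp
  qed
  have bd: "norm (mvd F z v) \<le> B / r * norm v" if "z \<in> ball x0 (2*r)" for z v
    using sub[OF that] e(2) B by (intro holomorphic_mv_Cauchy_estimate[OF F r(1)]) auto
  have inV: "z \<in> V" if "z \<in> ball x0 (2*r)" for z
    using that e r by (auto simp: subset_iff)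
  have lip: "norm (F x - F y) \<le> B / r * norm (x - y)" if "x \<in> ball x0 (2*r)" "y \<in> ball x0 (2*r)" for x y
  proof (rule differentiable_bound[of "ball x0 (2*r)" F "\<lambda>x. mvd F x"])
    show "(F has_derivative mvd F z) (at z within ball x0 (2*r))" if "z \<in> ball x0 (2*r)" for z
      using holomorphic_mvD(1)[OF F inV[OF that]] has_derivative_at_withinI by blast
    show "onorm (mvd F z) \<le> B / r" if "z \<in> ball x0 (2*r)" for z
      by (rule onorm_le) (use bd that in auto)
  qed (use that in auto)
  define L where "L = max (B / r) (B / r / r)"
  have L: "L \<ge> 0" "B / r \<le> L" "B / r / r \<le> L" using B0 r by (auto simp: L_def max_def)
  have main: "norm (mvd F x v - mvd F y v) \<le> B / r / r * norm (x - y) * norm v"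
    if "x \<in> ball x0 r" "y \<in> ball x0 r" for x y v
  proof -
    define a where "a = y - x"
    define W where "W = ball x0 (2*r) \<inter> (\<lambda>z. z + a) -` ball x0 (2*r)"
    have F1: "holomorphic_mv F (ball x0 (2*r))"
      by (intro holomorphic_mv_subset[OF F] open_ball subsetI inV)
    have W: "open W" unfolding W_def
      by (intro open_Int open_vimage) (auto intro: continuous_intros)
    have h1: "holomorphic_mv F W" using holomorphic_mv_subset[OF F1 W] by (auto simp: W_def)
    have h2: "holomorphic_mv (\<lambda>z. F (z + a)) W"
      using holomorphic_mv_subset[OF holomorphic_mv_translate(1)[OF F1] W] by (auto simp: W_def)
    have cb: "cball x r \<subseteq> W"
    proof
      fix z assume z: "z \<in> cball x r"
      have "dist x0 z < 2 * r" using z that dist_triangle[of x0 z x] by simp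
      moreover have "dist y (z + a) = dist x z" by (simp add: a_def dist_norm algebra_simps)
      then have "dist x0 (z + a) < 2 * r" using z that dist_triangle[of x0 "z + a" y] by simp
      ultimately show "z \<in> W" by (simp add: W_def)
    qed
    have "norm (mvd (\<lambda>z. F z - F (z + a)) x v) \<le> (B / r * norm (x - y)) / r * norm v"
    proof (rule holomorphic_mv_Cauchy_estimate[OF holomorphic_mv_diff[OF h1 h2] r(1) cb])
      fix z assume "z \<in> cball x r"
      then have "z \<in> W" using cb by auto
      then show "norm (F z - F (z + a)) \<le> B / r * norm (x - y)"
        using lip[of z "z + a"] by (simp add: W_def a_def norm_minus_commute)
    qed
    moreover have "x \<in> W" using cb r by auto
    then have "mvd (\<lambda>z. F z - F (z + a)) x v = mvd F x v - mvd F y v"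
      using mvd_diff[OF h1 h2] holomorphic_mv_translate(2)[OF F1, of x a v] by (simp add: W_def a_def)
    ultimately show ?thesis by (simp add: field_simps)
  qed
  show ?thesis
  proof (rule exI[of _ r], rule conjI[OF r(1)], rule exI[of _ L], intro conjI ballI allI)
    show "ball x0 r \<subseteq> V" using inV r by auto
    fix x y assume xy: "x \<in> ball x0 r" "y \<in> ball x0 r"
    then have xy2: "x \<in> ball x0 (2*r)" "y \<in> ball x0 (2*r)" using r by auto
    show "norm (F x - F y) \<le> L * norm (x - y)"
      using lip[OF xy2] mult_right_mono[OF L(2) norm_ge_zero[of "x - y"]] by linarith
    fix v
    show "norm (mvd F x v) \<le> L * norm v"
      using bd[OF xy2(1), of v] mult_right_mono[OF L(2) norm_ge_zero[of v]] by linarith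
    show "norm (mvd F x v - mvd F y v) \<le> L * norm (x - y) * norm v"
      using main[OF xy, of v] mult_right_mono[OF L(3), of "norm (x - y) * norm v"] by (simp add: mult.assoc)
  qed (use r L in auto)
qed

subsection \<open>Vector-valued maps\<close>

definition holomorphic_map :: "(complex ^ 'n::finite \<Rightarrow> complex ^ 'n) \<Rightarrow> (complex ^ 'n) set \<Rightarrow> bool" where
  "holomorphic_map \<Phi> V \<longleftrightarrow> (\<forall>k. holomorphic_mv (\<lambda>x. \<Phi> x $ k) V)"

definition mapd :: "(complex ^ 'n::finite \<Rightarrow> complex ^ 'n) \<Rightarrow> complex ^ 'n \<Rightarrow> complex ^ 'n \<Rightarrow> complex ^ 'n" where
  "mapd \<Phi> x v = (\<chi> k. mvd (\<lambda>x. \<Phi> x $ k) x v)"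

lemma holomorphic_map_open: "holomorphic_map \<Phi> V \<Longrightarrow> open V"
  by (auto simp: holomorphic_map_def holomorphic_mv_def)

lemma holomorphic_map_subset: "holomorphic_map F V \<Longrightarrow> open U \<Longrightarrow> U \<subseteq> V \<Longrightarrow> holomorphic_map F U"
  unfolding holomorphic_map_def using holomorphic_mv_subset by blast

lemma holomorphic_map_has_derivative:
  "holomorphic_map \<Phi> V \<Longrightarrow> x \<in> V \<Longrightarrow> (\<Phi> has_derivative mapd \<Phi> x) (at x)"
  unfolding has_derivative_vec_iff by (simp add: mapd_def holomorphic_map_def) (blast intro: holomorphic_mvD(1))

lemma holomorphic_map_continuous_on: "holomorphic_map \<Phi> V \<Longrightarrow> continuous_on V \<Phi>"
  by (meson continuous_at_imp_continuous_on has_derivative_continuous holomorphic_map_has_derivative)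

lemma mapd_linear:
  assumes "holomorphic_map \<Phi> V" "x \<in> V"
  shows "mapd \<Phi> x (c *s v) = c *s mapd \<Phi> x v" "mapd \<Phi> x (v + w) = mapd \<Phi> x v + mapd \<Phi> x w"
    "mapd \<Phi> x (v - w) = mapd \<Phi> x v - mapd \<Phi> x w" "mapd \<Phi> x 0 = 0"
proof -
  have F: "holomorphic_mv (\<lambda>x. \<Phi> x $ k) V" for k using assms(1) by (simp add: holomorphic_map_def)
  show "mapd \<Phi> x (c *s v) = c *s mapd \<Phi> x v" "mapd \<Phi> x (v + w) = mapd \<Phi> x v + mapd \<Phi> x w"
    "mapd \<Phi> x (v - w) = mapd \<Phi> x v - mapd \<Phi> x w" "mapd \<Phi> x 0 = 0"
    by (simp_all add: mapd_def vec_eq_iff holomorphic_mvD(2)[OF F assms(2)] mvd_linear[OF F assms(2)])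
qed

lemma holomorphic_map_along_curve:
  assumes "holomorphic_map \<Phi> V" "(\<gamma> has_derivative (\<lambda>h. h *s v)) (at t within T)" "\<gamma> t \<in> V"
  shows "((\<lambda>s. \<Phi> (\<gamma> s)) has_derivative (\<lambda>h. h *s mapd \<Phi> (\<gamma> t) v)) (at t within T)"
  unfolding has_derivative_smult_iff mapd_def
  using holomorphic_mv_along_curve[OF _ assms(2,3)] assms(1) by (auto simp: holomorphic_map_def)

lemma holomorphic_map_locally_Lipschitz:
  fixes F :: "complex ^ 'n::finite \<Rightarrow> complex ^ 'n"
  assumes F: "holomorphic_map F V" and x0: "x0 \<in> V"
  shows "\<exists>d>0. \<exists>L\<ge>0. ball x0 d \<subseteq> V \<and> (\<forall>x\<in>ball x0 d. \<forall>y\<in>ball x0 d. norm (F x - F y) \<le> L * norm (x - y) \<and>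
     (\<forall>v. norm (mapd F x v) \<le> L * norm v \<and> norm (mapd F x v - mapd F y v) \<le> L * norm (x - y) * norm v))"
proof -
  have "\<forall>k. \<exists>d L. d > 0 \<and> L \<ge> 0 \<and> ball x0 d \<subseteq> V \<and> (\<forall>x\<in>ball x0 d. \<forall>y\<in>ball x0 d. norm (F x $ k - F y $ k) \<le> L * norm (x - y) \<and>
     (\<forall>v. norm (mvd (\<lambda>x. F x $ k) x v) \<le> L * norm v \<and> norm (mvd (\<lambda>x. F x $ k) x v - mvd (\<lambda>x. F x $ k) y v) \<le> L * norm (x - y) * norm v))"
    using holomorphic_mv_locally_Lipschitz[OF _ x0] F unfolding holomorphic_map_def by blast
  then obtain d L :: "'n \<Rightarrow> real" where dL: "\<And>k. d k > 0" "\<And>k. L k \<ge> 0" "\<And>k. ball x0 (d k) \<subseteq> V"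
    "\<And>k x y. x \<in> ball x0 (d k) \<Longrightarrow> y \<in> ball x0 (d k) \<Longrightarrow> norm (F x $ k - F y $ k) \<le> L k * norm (x - y)"
    "\<And>k x y v. x \<in> ball x0 (d k) \<Longrightarrow> y \<in> ball x0 (d k) \<Longrightarrow> norm (mvd (\<lambda>x. F x $ k) x v) \<le> L k * norm v"
    "\<And>k x y v. x \<in> ball x0 (d k) \<Longrightarrow> y \<in> ball x0 (d k) \<Longrightarrow> norm (mvd (\<lambda>x. F x $ k) x v - mvd (\<lambda>x. F x $ k) y v) \<le> L k * norm (x - y) * norm v"
    by metis
  define D where "D = Min (range d)"
  have D: "D > 0" "\<And>k. D \<le> d k" using dL(1) by (auto simp: D_def)
  define M where "M = sum L UNIV"
  have M: "M \<ge> 0" using dL(2) by (auto simp: M_def intro: sum_nonneg)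
  have in_ball: "x \<in> ball x0 (d k)" if "x \<in> ball x0 D" for x k
    using that D(2)[of k] by simp
  have bound: "norm w \<le> M * r" if "\<And>k. norm (w $ k) \<le> L k * r" for w :: "complex ^ 'n" and r
    using order_trans[OF norm_le_sum_components sum_mono[of UNIV, OF that]]
    by (simp add: M_def sum_distrib_right)
  show ?thesis
  proof (rule exI[of _ D], rule conjI[OF D(1)], rule exI[of _ M], intro conjI ballI allI)
    show "ball x0 D \<subseteq> V" using dL(3) in_ball by blast
    fix x y assume xy: "x \<in> ball x0 D" "y \<in> ball x0 D"
    show "norm (F x - F y) \<le> M * norm (x - y)"
      using dL(4)[OF in_ball in_ball] xy by (intro bound) simp
    fix v
    show "norm (mapd F x v) \<le> M * norm v"
      using dL(5)[OF in_ball in_ball] xy by (intro bound) (simp add: mapd_def)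
    show "norm (mapd F x v - mapd F y v) \<le> M * norm (x - y) * norm v"
      using dL(6)[OF in_ball in_ball] xy unfolding mult.assoc by (intro bound) (simp add: mapd_def mult.assoc)
  qed (use D M in auto)
qed

section \<open>Homogeneous coordinates and forms\<close>

lemma rep_cproj_nonzero [simp]: "rep_cproj p \<noteq> 0"
  using Quotient3_rep_reflp[OF Quotient3_cproj, of p] by (simp add: proportional_def)

lemma abs_rep_cproj [simp]: "abs_cproj (rep_cproj p) = p"
  by (rule Quotient3_abs_rep[OF Quotient3_cproj])

lemma proportional_refl: "x \<noteq> 0 \<Longrightarrow> proportional x x"
  by (auto simp: proportional_def intro: exI[of _ 1])

lemma abs_cproj_smult: "x \<noteq> 0 \<Longrightarrow> c \<noteq> 0 \<Longrightarrow> abs_cproj (c *s x) = abs_cproj x"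
  by (rule Quotient3_rel_abs[OF Quotient3_cproj, symmetric]) (auto simp: proportional_def)

lemma rep_abs_cproj:
  assumes "x \<noteq> 0"
  obtains c where "c \<noteq> 0" "rep_cproj (abs_cproj x) = c *s x"
proof -
  have "proportional (rep_cproj (abs_cproj x)) x"
    by (rule Quotient3_rep_abs[OF Quotient3_cproj proportional_refl[OF assms]])
  then obtain c where c: "c \<noteq> 0" "x = c *s rep_cproj (abs_cproj x)"
    by (auto simp: proportional_def)
  have "rep_cproj (abs_cproj x) = inverse c *s (c *s rep_cproj (abs_cproj x))" using c(1) by simp
  then show ?thesis using that[of "inverse c"] c by simp
qed

lemma chart_nth [simp]: "p \<in> chart_dom i \<Longrightarrow> chart i p $ i = 1"
  by (simp add: chart_def chart_dom_def)

lemma chart_nonzero: "p \<in> chart_dom i \<Longrightarrow> chart i p \<noteq> 0"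
  by (metis chart_nth zero_index zero_neq_one)

lemma chart_outside: "p \<notin> chart_dom i \<Longrightarrow> chart i p = 0"
  by (simp add: chart_def chart_dom_def)

lemma chart_dom_iff: "p \<in> chart_dom i \<longleftrightarrow> chart i p $ i \<noteq> 0"
  using chart_nth chart_outside by fastforce

lemma abs_chart [simp]: "p \<in> chart_dom i \<Longrightarrow> abs_cproj (chart i p) = p"
  unfolding chart_def using abs_cproj_smult[of "rep_cproj p" "inverse (rep_cproj p $ i)"]
  by (simp add: chart_dom_def)

lemma rep_eq_chart: "p \<in> chart_dom i \<Longrightarrow> rep_cproj p = rep_cproj p $ i *s chart i p"
  by (simp add: chart_def chart_dom_def vec_eq_iff)

lemma chart_abs: "x $ i \<noteq> 0 \<Longrightarrow> abs_cproj x \<in> chart_dom i \<and> chart i (abs_cproj x) = inverse (x $ i) *s x"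
proof -
  assume x: "x $ i \<noteq> 0"
  then have "x \<noteq> 0" by auto
  then obtain c where "c \<noteq> 0" "rep_cproj (abs_cproj x) = c *s x" by (rule rep_abs_cproj)
  then show ?thesis using x by (auto simp: chart_def chart_dom_def vec_eq_iff field_simps)
qed

lemma abs_in_chart_dom_iff: "x \<noteq> 0 \<Longrightarrow> abs_cproj x \<in> chart_dom i \<longleftrightarrow> x $ i \<noteq> 0"
proof -
  assume "x \<noteq> 0"
  then obtain c where "c \<noteq> 0" "rep_cproj (abs_cproj x) = c *s x" by (rule rep_abs_cproj)
  then show ?thesis by (auto simp: chart_dom_def)
qed

lemma ex_chart_dom: "\<exists>i. p \<in> chart_dom i"
  using rep_cproj_nonzero[of p] unfolding chart_dom_def by (metis (mono_tags) mem_Collect_eq vec_eq_iff zero_index)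

lemma chart_inj: "p \<in> chart_dom i \<Longrightarrow> q \<in> chart_dom i \<Longrightarrow> chart i p = chart i q \<Longrightarrow> p = q"
  by (metis abs_chart)

lemma chart_transition: "p \<in> chart_dom i \<Longrightarrow> p \<in> chart_dom j \<Longrightarrow> chart j p = inverse (chart i p $ j) *s chart i p"
  using rep_eq_chart[of p i] by (simp add: chart_def chart_dom_def vec_eq_iff field_simps)

lemma chart_in_other_dom: "p \<in> chart_dom i \<Longrightarrow> p \<in> chart_dom j \<longleftrightarrow> chart i p $ j \<noteq> 0"
  by (auto simp: chart_def chart_dom_def)

subsection \<open>Topology\<close>

lemma open_cproj_iff: "open (A :: 'n::finite cproj set) \<longleftrightarrow> open {x. x \<noteq> 0 \<and> abs_cproj x \<in> A}"
  by (simp add: open_cproj_def)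

lemma continuous_on_abs_cproj: "continuous_on (- {0}) (abs_cproj :: complex ^ 'n::finite \<Rightarrow> 'n cproj)"
proof (subst continuous_on_open_vimage)
  show "open (- {0 :: complex ^ 'n})" by (rule open_Compl) simp
  have "abs_cproj -` B \<inter> - {0 :: complex ^ 'n} = {x. x \<noteq> 0 \<and> abs_cproj x \<in> B}" for B by auto
  then show "\<forall>B. open B \<longrightarrow> open (abs_cproj -` B \<inter> - {0 :: complex ^ 'n})"
    by (simp add: open_cproj_iff)
qed

lemma compact_UNIV_cproj: "compact (UNIV :: 'n::finite cproj set)"
proof -
  have "(UNIV :: 'n cproj set) = abs_cproj ` sphere 0 1"
  proof (intro equalityI subsetI)
    fix p :: "'n cproj" assume "p \<in> UNIV"
    define c where "c = complex_of_real (inverse (norm (rep_cproj p)))"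
    have c: "c \<noteq> 0" by (simp add: c_def)
    have "norm (c *s rep_cproj p) = 1" by (simp add: norm_vector_smult c_def norm_inverse)
    moreover have "abs_cproj (c *s rep_cproj p) = p" using abs_cproj_smult[OF rep_cproj_nonzero c] by simp
    ultimately show "p \<in> abs_cproj ` sphere 0 1" by (metis image_eqI mem_sphere_0)
  qed auto
  moreover have "compact (abs_cproj ` sphere (0 :: complex ^ 'n) 1)"
    by (intro compact_continuous_image continuous_on_subset[OF continuous_on_abs_cproj]) auto
  ultimately show ?thesis by simp
qed

lemma open_chart_preimage:
  assumes "open U"
  shows "open (chart_dom i \<inter> chart i -` U)"
proof -
  have "{x. x \<noteq> 0 \<and> abs_cproj x \<in> chart_dom i \<inter> chart i -` U} = {x. x $ i \<noteq> 0} \<inter> (\<lambda>x. inverse (x $ i) *s x) -` U"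
    using chart_abs[of _ i] abs_in_chart_dom_iff[of _ i] by (auto simp del: chart_nth)
  moreover have "open ((\<lambda>x :: complex ^ 'a. inverse (x $ i) *s x) -` U \<inter> {x. x $ i \<noteq> 0})"
  proof -
    have o: "open {x :: complex ^ 'a. x $ i \<noteq> 0}"
      by (intro open_Collect_neq continuous_intros)
    have "continuous_on {x :: complex ^ 'a. x $ i \<noteq> 0} (\<lambda>x. \<chi> k. inverse (x $ i) * x $ k)"
      by (intro continuous_intros) auto
    then have "continuous_on {x :: complex ^ 'a. x $ i \<noteq> 0} (\<lambda>x. inverse (x $ i) *s x)"
      by (simp add: vector_scalar_mult_def)
    then show ?thesis using continuous_on_open_vimage[OF o] assms by blast
  qed
  ultimately show ?thesis by (simp add: open_cproj_iff Int_commute)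
qed

lemma open_chart_dom: "open (chart_dom i)"
  using open_chart_preimage[of UNIV i] by simp

lemma continuous_on_chart: "continuous_on (chart_dom i) (chart i)"
  unfolding continuous_on_open_vimage[OF open_chart_dom]
  using open_chart_preimage by (metis Int_commute)

lemma continuous_on_abs_cproj_affine: "continuous_on {x. x $ i = 1} abs_cproj"
  by (rule continuous_on_subset[OF continuous_on_abs_cproj]) auto

subsection \<open>Forms\<close>

definition multi_indices :: "nat \<Rightarrow> ('n::finite \<Rightarrow> nat) set" where
  "multi_indices d = {\<alpha>. (\<Sum>i\<in>UNIV. \<alpha> i) = d}"

lemma finite_multi_indices: "finite (multi_indices d :: ('n::finite \<Rightarrow> nat) set)"
proof -
  have "multi_indices d \<subseteq> (PiE UNIV (\<lambda>_. {..d}) :: ('n \<Rightarrow> nat) set)"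
    by (auto simp: multi_indices_def PiE_def extensional_def intro: member_le_sum)
  then show ?thesis by (rule finite_subset) (intro finite_PiE, auto)
qed

lemma homogeneous_iff:
  "homogeneous d P \<longleftrightarrow> (\<exists>c. P = (\<lambda>x. \<Sum>\<alpha>\<in>multi_indices d. c \<alpha> * (\<Prod>i\<in>UNIV. x $ i ^ \<alpha> i)))"
  by (simp add: homogeneous_def multi_indices_def)

lemma homogeneous_smult: "homogeneous d P \<Longrightarrow> P (c *s x) = c ^ d * P x"
proof -
  assume "homogeneous d P"
  then obtain b where P: "P = (\<lambda>x. \<Sum>\<alpha>\<in>multi_indices d. b \<alpha> * (\<Prod>i\<in>UNIV. x $ i ^ \<alpha> i))"
    by (auto simp: homogeneous_iff)
  have "(\<Prod>i\<in>UNIV. (c * x $ i) ^ \<alpha> i) = c ^ d * (\<Prod>i\<in>UNIV. x $ i ^ \<alpha> i)" if "\<alpha> \<in> multi_indices d" for \<alpha>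
    using that by (simp add: multi_indices_def power_mult_distrib prod.distrib flip: power_sum)
  then show ?thesis by (simp add: P sum_distrib_left mult.left_commute)
qed

lemma homogeneous_holomorphic: "homogeneous d P \<Longrightarrow> open V \<Longrightarrow> holomorphic_mv P V"
  unfolding homogeneous_iff
  by (auto intro!: holomorphic_mv_sum holomorphic_mv_mult holomorphic_mv_const holomorphic_mv_prod holomorphic_mv_power holomorphic_mv_coord)

lemma homogeneous_continuous: "homogeneous d P \<Longrightarrow> continuous_on S P"
  using holomorphic_mv_continuous_on[OF homogeneous_holomorphic[of d P UNIV]] continuous_on_subset by blast

lemma homogeneous_add:
  assumes "homogeneous d P" "homogeneous d Q"
  shows "homogeneous d (\<lambda>x. P x + Q x)"
proof -
  obtain b c where "P = (\<lambda>x. \<Sum>\<alpha>\<in>multi_indices d. b \<alpha> * (\<Prod>i\<in>UNIV. x $ i ^ \<alpha> i))"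
    "Q = (\<lambda>x. \<Sum>\<alpha>\<in>multi_indices d. c \<alpha> * (\<Prod>i\<in>UNIV. x $ i ^ \<alpha> i))"
    using assms by (auto simp: homogeneous_iff)
  then show ?thesis unfolding homogeneous_iff
    by (intro exI[of _ "\<lambda>\<alpha>. b \<alpha> + c \<alpha>"]) (simp add: sum.distrib distrib_right)
qed

lemma homogeneous_cmult: "homogeneous d P \<Longrightarrow> homogeneous d (\<lambda>x. a * P x)"
proof -
  assume "homogeneous d P"
  then obtain b where "P = (\<lambda>x. \<Sum>\<alpha>\<in>multi_indices d. b \<alpha> * (\<Prod>i\<in>UNIV. x $ i ^ \<alpha> i))"
    by (auto simp: homogeneous_iff)
  then show ?thesis unfolding homogeneous_iff
    by (intro exI[of _ "\<lambda>\<alpha>. a * b \<alpha>"]) (simp add: sum_distrib_left mult.assoc)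
qed

lemma homogeneous_zero: "homogeneous d (\<lambda>x. 0)"
  unfolding homogeneous_iff by (intro exI[of _ "\<lambda>_. 0"]) simp

lemma homogeneous_monomial:
  assumes "\<alpha> \<in> multi_indices d"
  shows "homogeneous d (\<lambda>x. \<Prod>i\<in>UNIV. x $ i ^ \<alpha> i)"
  unfolding homogeneous_iff
  using assms by (intro exI[of _ "\<lambda>\<beta>. if \<beta> = \<alpha> then 1 else 0"]) (simp add: if_distrib[of "\<lambda>u. u * _"] finite_multi_indices cong: if_cong)

lemma homogeneous_sum:
  assumes "\<And>a. a \<in> A \<Longrightarrow> homogeneous d (P a)"
  shows "homogeneous d (\<lambda>x. \<Sum>a\<in>A. P a x)"
  using assms by (induction A rule: infinite_finite_induct) (auto intro: homogeneous_zero homogeneous_add)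

lemma homogeneous_mult:
  assumes "homogeneous d P" "homogeneous e Q"
  shows "homogeneous (d + e) (\<lambda>x. P x * Q x)"
proof -
  obtain b c where P: "P = (\<lambda>x. \<Sum>\<alpha>\<in>multi_indices d. b \<alpha> * (\<Prod>i\<in>UNIV. x $ i ^ \<alpha> i))"
    and Q: "Q = (\<lambda>x. \<Sum>\<alpha>\<in>multi_indices e. c \<alpha> * (\<Prod>i\<in>UNIV. x $ i ^ \<alpha> i))"
    using assms by (auto simp: homogeneous_iff)
  have "(\<lambda>x. P x * Q x) = (\<lambda>x. \<Sum>\<alpha>\<in>multi_indices d. \<Sum>\<beta>\<in>multi_indices e.
      (b \<alpha> * c \<beta>) * (\<Prod>i\<in>UNIV. x $ i ^ (\<alpha> i + \<beta> i)))"
    unfolding P Q sum_product by (simp add: power_add prod.distrib mult_ac)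
  moreover have "homogeneous (d + e) \<dots>"
    by (intro homogeneous_sum homogeneous_cmult homogeneous_monomial) (auto simp: multi_indices_def sum.distrib)
  ultimately show ?thesis by simp
qed

lemma homogeneous_const: "homogeneous 0 (\<lambda>x. a)"
  using homogeneous_cmult[OF homogeneous_monomial[of "\<lambda>_. 0" 0], of a] by (simp add: multi_indices_def)

lemma homogeneous_coord: "homogeneous 1 (\<lambda>x. x $ i)"
proof -
  have "(\<Prod>j\<in>UNIV. x $ j ^ (if j = i then 1 else 0)) = x $ i" for x :: "complex ^ 'a"
    by (simp add: if_distrib[of "\<lambda>u. _ ^ u"] cong: if_cong)
  then show ?thesis
    using homogeneous_monomial[of "\<lambda>j. if j = i then 1 else 0" 1] by (simp add: multi_indices_def)
qed

lemma homogeneous_power: "homogeneous d P \<Longrightarrow> homogeneous (d * k) (\<lambda>x. P x ^ k)"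
  by (induction k) (auto intro: homogeneous_const dest: homogeneous_mult)

lemma homogeneous_prod:
  assumes "finite A" "\<And>a. a \<in> A \<Longrightarrow> homogeneous (d a) (P a)"
  shows "homogeneous (\<Sum>a\<in>A. d a) (\<lambda>x. \<Prod>a\<in>A. P a x)"
  using assms by (induction A rule: finite_induct) (auto intro: homogeneous_const homogeneous_mult)

lemma homogeneous_rep_abs_zero_iff:
  assumes "homogeneous d P" "x \<noteq> 0"
  shows "P (rep_cproj (abs_cproj x)) = 0 \<longleftrightarrow> P x = 0"
proof -
  obtain c where "c \<noteq> 0" "rep_cproj (abs_cproj x) = c *s x" using rep_abs_cproj[OF assms(2)] .
  then show ?thesis using homogeneous_smult[OF assms(1)] by simp
qed

lemma homogeneous_chart_zero_iff:
  assumes "homogeneous d P" "p \<in> chart_dom i"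
  shows "P (chart i p) = 0 \<longleftrightarrow> P (rep_cproj p) = 0"
  using homogeneous_rep_abs_zero_iff[OF assms(1) chart_nonzero[OF assms(2)]] assms(2) by simp

lemma homogeneous_chart_quotient:
  assumes "homogeneous d P" "homogeneous d Q" "p \<in> chart_dom i"
  shows "P (rep_cproj p) / Q (rep_cproj p) = P (chart i p) / Q (chart i p)"
proof -
  have "rep_cproj p $ i \<noteq> 0" using assms(3) by (simp add: chart_dom_def)
  then show ?thesis
    using homogeneous_smult[OF assms(1), of "rep_cproj p $ i" "chart i p"]
      homogeneous_smult[OF assms(2), of "rep_cproj p $ i" "chart i p"] rep_eq_chart[OF assms(3)] by simp
qed

lemma open_nonzero_form:
  assumes "homogeneous d Q"
  shows "open {p. Q (rep_cproj p) \<noteq> 0}"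
proof -
  have "{x. x \<noteq> 0 \<and> abs_cproj x \<in> {p. Q (rep_cproj p) \<noteq> 0}} = - {0} \<inter> {x. Q x \<noteq> 0}"
    using homogeneous_rep_abs_zero_iff[OF assms] by auto
  moreover have "open {x. Q x \<noteq> 0}"
    using homogeneous_continuous[OF assms] by (intro open_Collect_neq) auto
  ultimately show ?thesis unfolding open_cproj_iff by (auto intro!: open_Int)
qed

section \<open>Straightened local charts\<close>

lemma complex_linear_holomorphic_map:
  fixes A :: "complex ^ 'n::finite \<Rightarrow> complex ^ 'n"
  assumes "\<And>x y. A (x + y) = A x + A y" "\<And>c x. A (c *s x) = c *s A x"
  shows "holomorphic_map A UNIV"
proof -
  have "linear A" by (rule linearI) (simp_all add: assms scaleR_eq_smult)
  then have bl: "bounded_linear A" by (simp add: linear_conv_bounded_linear)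
  have "((\<lambda>x. A x $ k) has_derivative (\<lambda>x. A x $ k)) (at x)" for x k
    by (rule bounded_linear_imp_has_derivative) (rule bounded_linear_compose[OF bounded_linear_vec_nth bl])
  then show ?thesis
    unfolding holomorphic_map_def holomorphic_mv_def
    by (metis (no_types, lifting) assms(2) open_UNIV vector_smult_component)
qed

lemma holomorphic_mv_compose:
  assumes F: "holomorphic_mv F W" and G: "holomorphic_map G U" and sub: "G ` U \<subseteq> W"
  shows "holomorphic_mv (\<lambda>x. F (G x)) U"
  unfolding holomorphic_mv_def
proof (intro conjI ballI)
  show "open U" using G by (rule holomorphic_map_open)
  fix x assume x: "x \<in> U"
  then have Gx: "G x \<in> W" using sub by auto
  have "((\<lambda>x. F (G x)) has_derivative (\<lambda>h. mvd F (G x) (mapd G x h))) (at x)"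
    by (rule has_derivative_compose[OF holomorphic_map_has_derivative[OF G x] holomorphic_mvD(1)[OF F Gx]])
  then show "\<exists>F'. ((\<lambda>x. F (G x)) has_derivative F') (at x) \<and> (\<forall>c v. F' (c *s v) = c * F' v)"
    using mapd_linear(1)[OF G x] holomorphic_mvD(2)[OF F Gx] by auto
qed

lemma holomorphic_map_compose:
  "holomorphic_map F W \<Longrightarrow> holomorphic_map G U \<Longrightarrow> G ` U \<subseteq> W \<Longrightarrow> holomorphic_map (\<lambda>x. F (G x)) U"
  using holomorphic_mv_compose unfolding holomorphic_map_def[of F] holomorphic_map_def[of "\<lambda>x. F (G x)"] by blast

text \<open>After a linear change of coordinates the model subspace of a submanifold chart becomes a
  coordinate subspace.  Membership is then the vanishing of certain components, which can be
  differentiated and passed to the limit one at a time.\<close>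

lemma subspace_straightening:
  fixes L :: "(complex ^ 'n::finite) set"
  assumes "vec.subspace L" "vec.dim L = m"
  obtains A A' :: "complex ^ 'n \<Rightarrow> complex ^ 'n" and J :: "'n set"
  where "\<And>x. A' (A x) = x" "\<And>x. A (A' x) = x"
    "holomorphic_map A UNIV" "holomorphic_map A' UNIV" "card J = m"
    "\<And>x. x \<in> L \<longleftrightarrow> (\<forall>k. k \<notin> J \<longrightarrow> A x $ k = 0)"
proof -
  obtain B where B: "B \<subseteq> L" "vec.independent B" "vec.span B = L" "card B = m"
    using vec.basis_exists[of L] assms by (metis vec.span_subspace)
  obtain C where C: "B \<subseteq> C" "vec.independent C" "vec.span C = UNIV"
    using vec.extend_basis_superset[OF B(2)] vec.independent_extend_basis[OF B(2)] vec.span_extend_basis[OF B(2)] by blast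
  have fC: "finite C" using C(2) by (rule vec.finiteI_independent)
  have "card C = CARD('n)"
    using vec.dim_eq_card_independent[OF C(2)] vec.dim_span[of C] unfolding C(3) vec_dim_card by simp
  then obtain f where f: "bij_betw f C (UNIV :: 'n set)"
    using finite_same_card_bij[OF fC finite_class.finite_UNIV] by auto
  define g where "g = the_inv_into C f"
  have g: "bij_betw g UNIV C" unfolding g_def by (rule bij_betw_the_inv_into[OF f])
  have fg: "f (g k) = k" for k using f by (simp add: g_def f_the_inv_into_f_bij_betw)
  have gC: "g k \<in> C" for k using g by (auto simp: bij_betw_def)
  have gf: "g (f c) = c" if "c \<in> C" for c using f that by (simp add: g_def the_inv_into_f_f bij_betw_def)
  define A where "A = (\<lambda>y. \<chi> k. vec.representation C y (g k))"
  define A' where "A' = (\<lambda>x. \<Sum>k\<in>(UNIV :: 'n set). x $ k *s g k)"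
  have inspan: "y \<in> vec.span C" for y using C by simp
  have A'A: "A' (A y) = y" for y
  proof -
    have "A' (A y) = (\<Sum>c\<in>C. vec.representation C y c *s c)"
      unfolding A'_def A_def using sum.reindex_bij_betw[OF g, of "\<lambda>c. vec.representation C y c *s c"] by simp
    also have "\<dots> = y" by (rule vec.sum_representation_eq[OF C(2) inspan fC order_refl])
    finally show ?thesis .
  qed
  have Alin: "A (x + y) = A x + A y" "A (c *s x) = c *s A x" for x y c
    using vec.representation_add[OF C(2) inspan inspan] vec.representation_scale[OF C(2) inspan]
    by (auto simp: A_def vec_eq_iff)
  have Ag: "A (g k) = axis k 1" for k
    using vec.representation_basis[OF C(2) gC] g by (auto simp: A_def vec_eq_iff axis_def bij_betw_def inj_on_def)
  have A'lin: "A' (x + y) = A' x + A' y" "A' (c *s x) = c *s A' x" for x y c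
    by (auto simp: A'_def vec.scale_left_distrib sum.distrib vec.scale_sum_right)
  have A0: "A 0 = 0" using Alin(2)[of 0 0] by simp
  have Asum: "A (\<Sum>k\<in>K. h k) = (\<Sum>k\<in>K. A (h k))" for K :: "'n set" and h
    by (induction K rule: infinite_finite_induct) (auto simp: A0 Alin)
  have AA': "A (A' x) = x" for x
    unfolding A'_def Asum Alin Ag by (simp add: vec_eq_iff axis_def if_distrib[of "\<lambda>u. _ * u"] cong: if_cong)
  define J where "J = f ` B"
  have cJ: "card J = m"
    using B(4) C(1) f by (metis J_def bij_betw_def card_image inj_on_subset)
  have L: "x \<in> L \<longleftrightarrow> (\<forall>k. k \<notin> J \<longrightarrow> A x $ k = 0)" for x
  proof
    assume x: "x \<in> L"
    then have "vec.representation C x = vec.representation B x"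
      using vec.representation_extend[OF C(2) _ C(1)] B(3) by auto
    moreover have "g k \<notin> B" if "k \<notin> J" for k using that fg by (metis J_def imageI)
    ultimately show "\<forall>k. k \<notin> J \<longrightarrow> A x $ k = 0"
      using vec.representation_ne_zero by (auto simp: A_def)
  next
    assume k: "\<forall>k. k \<notin> J \<longrightarrow> A x $ k = 0"
    have "(A x $ k) *s g k \<in> vec.span B" for k
    proof (cases "k \<in> J")
      case True
      then have "g k \<in> B" using gf C(1) by (auto simp: J_def)
      then show ?thesis by (intro vec.span_scale vec.span_base)
    next
      case False
      then show ?thesis using k by (simp add: vec.span_zero)
    qed
    then have "A' (A x) \<in> vec.span B" unfolding A'_def by (intro vec.span_sum)
    then show "x \<in> L" using A'A B(3) by simp
  qed
  show ?thesis
    by (rule that[OF A'A AA' complex_linear_holomorphic_map[OF Alin] complex_linear_holomorphic_map[OF A'lin] cJ L])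
qed

section \<open>Velocities in affine charts\<close>

text \<open>The differential of the coordinate change \<open>x \<mapsto> x / x\<^sub>j\<close> applied to \<open>v\<close>: the tangent
  vector with coordinate vector \<open>v\<close> in the chart \<open>i\<close>, provided that \<open>v\<close> has component \<open>v\<^sub>i = 0\<close>.\<close>

definition tvec_of :: "'n::finite \<Rightarrow> 'n cproj \<Rightarrow> complex ^ 'n \<Rightarrow> 'n tvec" where
  "tvec_of i p v = (\<chi> j k. if p \<in> chart_dom j
     then (v $ k * chart i p $ j - chart i p $ k * v $ j) / (chart i p $ j)\<^sup>2 else 0)"

lemma velocity_chart:
  "velocity \<gamma> t w \<Longrightarrow> \<gamma> t \<in> chart_dom i \<Longrightarrow> ((\<lambda>s. chart i (\<gamma> s)) has_derivative (\<lambda>h. h *s (w $ i))) (at t)"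
  by (auto simp: velocity_def split: if_splits)

lemma eventually_in_chart_dom:
  assumes "((\<lambda>s. chart i (\<gamma> s)) has_derivative f') (at t)" "\<gamma> t \<in> chart_dom i" "chart i (\<gamma> t) $ j \<noteq> 0"
  shows "\<forall>\<^sub>F s in nhds t. \<gamma> s \<in> chart_dom i \<and> chart i (\<gamma> s) $ j \<noteq> 0"
proof -
  have c: "isCont (\<lambda>s. chart i (\<gamma> s)) t" using assms(1) by (rule has_derivative_continuous)
  have "\<forall>\<^sub>F s in nhds t. chart i (\<gamma> s) $ k \<noteq> 0" if "chart i (\<gamma> t) $ k \<noteq> 0" for k
  proof -
    have "((\<lambda>s. chart i (\<gamma> s) $ k) \<longlongrightarrow> chart i (\<gamma> t) $ k) (nhds t)"
      using c unfolding isCont_def by (intro tendsto_vec_nth) (simp add: tendsto_nhds_iff)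
    then show ?thesis using that by (metis tendsto_imp_eventually_ne)
  qed
  from eventually_conj[OF this[of i] this[of j]] show ?thesis
    using assms(2,3) by (simp add: chart_dom_iff)
qed

lemma velocity_tvec_of:
  assumes d: "((\<lambda>s. chart i (\<gamma> s)) has_derivative (\<lambda>h. h *s v)) (at t)" and i: "\<gamma> t \<in> chart_dom i"
  shows "velocity \<gamma> t (tvec_of i (\<gamma> t) v)"
  unfolding velocity_def
proof (intro allI)
  fix j
  show "if \<gamma> t \<in> chart_dom j
          then ((\<lambda>s. chart j (\<gamma> s)) has_derivative (\<lambda>h. h *s (tvec_of i (\<gamma> t) v $ j))) (at t)
          else tvec_of i (\<gamma> t) v $ j = 0"
  proof (cases "\<gamma> t \<in> chart_dom j")
    case True
    then have zj: "chart i (\<gamma> t) $ j \<noteq> 0" using chart_in_other_dom[OF i] by simp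
    have comp: "((\<lambda>s. chart i (\<gamma> s) $ k) has_field_derivative v $ k) (at t)" for k
      using d unfolding has_derivative_smult_iff by blast
    have "((\<lambda>s. chart j (\<gamma> s) $ k) has_field_derivative tvec_of i (\<gamma> t) v $ j $ k) (at t)" for k
    proof -
      have "((\<lambda>s. chart i (\<gamma> s) $ k / chart i (\<gamma> s) $ j) has_field_derivative tvec_of i (\<gamma> t) v $ j $ k) (at t)"
        using DERIV_divide[OF comp[of k] comp[of j] zj] True by (simp add: tvec_of_def power2_eq_square)
      moreover have "\<forall>\<^sub>F s in nhds t. chart i (\<gamma> s) $ k / chart i (\<gamma> s) $ j = chart j (\<gamma> s) $ k"
        using eventually_in_chart_dom[OF d i zj]
      proof eventually_elim
        case (elim s)
        then have "\<gamma> s \<in> chart_dom j" using chart_in_other_dom by blast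
        then have "chart j (\<gamma> s) = inverse (chart i (\<gamma> s) $ j) *s chart i (\<gamma> s)"
          using chart_transition elim by blast
        then show ?case by (simp add: field_simps)
      qed
      ultimately show ?thesis by (subst (asm) DERIV_cong_ev[OF refl _ refl]) auto
    qed
    then show ?thesis using True unfolding has_derivative_smult_iff by simp
  next
    case False
    then show ?thesis by (simp add: tvec_of_def vec_eq_iff)
  qed
qed

lemma velocity_unique:
  assumes "velocity \<gamma> t w" "velocity \<gamma> t w'"
  shows "w = w'"
proof -
  have "w $ i = w' $ i" for i
  proof (cases "\<gamma> t \<in> chart_dom i")
    case True
    have "(\<lambda>h. h *s (w $ i)) = (\<lambda>h. h *s (w' $ i))"
      using has_derivative_unique[OF velocity_chart[OF assms(1) True] velocity_chart[OF assms(2) True]] .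
    from fun_cong[OF this, of 1] show ?thesis by simp
  next
    case False
    then show ?thesis using assms by (auto simp: velocity_def split: if_splits dest!: spec[of _ i])
  qed
  then show ?thesis by (simp add: vec_eq_iff)
qed

lemma velocity_eq_tvec_of:
  "velocity \<gamma> t w \<Longrightarrow> \<gamma> t \<in> chart_dom i \<Longrightarrow> w = tvec_of i (\<gamma> t) (w $ i)"
  by (rule velocity_unique[OF _ velocity_tvec_of[OF velocity_chart]])

lemma tvec_of_self: "p \<in> chart_dom i \<Longrightarrow> v $ i = 0 \<Longrightarrow> tvec_of i p v $ i = v"
  by (simp add: tvec_of_def vec_eq_iff)

section \<open>The manifold and its tangent spaces\<close>

locale projective_mfd =
  fixes M :: "'n::finite cproj set" and m :: nat
  assumes nonempty: "M \<noteq> {}" and closed: "closed M" and conn: "connected M"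
    and submanifold: "complex_submanifold m (chart i ` (M \<inter> chart_dom i))"
begin

definition affine_part :: "'n \<Rightarrow> (complex ^ 'n) set" where
  "affine_part i = chart i ` (M \<inter> chart_dom i)"

lemma affine_partD: "x \<in> affine_part i \<Longrightarrow> x $ i = 1 \<and> abs_cproj x \<in> M \<and> abs_cproj x \<in> chart_dom i \<and> chart i (abs_cproj x) = x"
  by (auto simp: affine_part_def)

lemma chart_in_affine_part: "p \<in> chart_dom i \<Longrightarrow> chart i p \<in> affine_part i \<longleftrightarrow> p \<in> M"
  by (auto simp: affine_part_def dest: chart_inj)

text \<open>A holomorphic chart of the affine space in which \<open>M\<close> is the coordinate subspace of the indices
  in \<open>J\<close>.\<close>

definition local_chart where
  "local_chart i U V \<Phi> \<Psi> J \<longleftrightarrow> holomorphic_map \<Phi> U \<and> holomorphic_map \<Psi> V \<and> \<Phi> ` U = V \<and>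
     (\<forall>x\<in>U. \<Psi> (\<Phi> x) = x) \<and> card J = m \<and>
     (\<forall>x\<in>U. x \<in> affine_part i \<longleftrightarrow> (\<forall>k. k \<notin> J \<longrightarrow> \<Phi> x $ k = 0))"

lemma local_chart_exists:
  assumes "p \<in> M" "p \<in> chart_dom i"
  obtains U V \<Phi> \<Psi> and J :: "'n set" where "local_chart i U V \<Phi> \<Psi> J" "chart i p \<in> U"
proof -
  have "chart i p \<in> chart i ` (M \<inter> chart_dom i)" using assms by auto
  then obtain U V \<Phi> L where U: "open U" "chart i p \<in> U" and bi: "biholomorphic \<Phi> U V"
    and L: "vec.subspace L" "vec.dim L = m" and img: "\<Phi> ` (affine_part i \<inter> U) = L \<inter> V"
    using submanifold[of i] unfolding complex_submanifold_def affine_part_def by metis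
  obtain \<Psi> where \<Phi>: "\<Phi> ` U = V" "holomorphic_map \<Phi> U" and \<Psi>: "\<And>x. x \<in> U \<Longrightarrow> \<Psi> (\<Phi> x) = x" "holomorphic_map \<Psi> V"
    using bi unfolding biholomorphic_def holomorphic_map_def by blast
  obtain A A' :: "complex ^ 'n \<Rightarrow> complex ^ 'n" and J where
    A: "\<And>x. A' (A x) = x" "\<And>x. A (A' x) = x" "holomorphic_map A UNIV" "holomorphic_map A' UNIV"
    "card J = m" "\<And>x. x \<in> L \<longleftrightarrow> (\<forall>k. k \<notin> J \<longrightarrow> A x $ k = 0)"
    by (rule subspace_straightening[OF L]) (rule that)
  have "open V" using \<Psi>(2) by (rule holomorphic_map_open)
  then have oV: "open (A' -` V)"
    by (rule open_vimage) (use holomorphic_map_continuous_on[OF A(4)] in auto)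
  have "local_chart i U (A' -` V) (\<lambda>x. A (\<Phi> x)) (\<lambda>y. \<Psi> (A' y)) J"
    unfolding local_chart_def
  proof (intro conjI ballI)
    show "holomorphic_map (\<lambda>x. A (\<Phi> x)) U" by (rule holomorphic_map_compose[OF A(3) \<Phi>(2)]) auto
    show "holomorphic_map (\<lambda>y. \<Psi> (A' y)) (A' -` V)"
      by (rule holomorphic_map_compose[OF \<Psi>(2) holomorphic_map_subset[OF A(4) oV]]) auto
    show "(\<lambda>x. A (\<Phi> x)) ` U = A' -` V" 
    proof (intro equalityI subsetI)
      fix y assume "y \<in> (\<lambda>x. A (\<Phi> x)) ` U"
      then show "y \<in> A' -` V" using \<Phi>(1) A(1) by auto
    next
      fix y assume "y \<in> A' -` V"
      then obtain x where "x \<in> U" "A' y = \<Phi> x" using \<Phi>(1) by auto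
      then show "y \<in> (\<lambda>x. A (\<Phi> x)) ` U" using A(2)[of y] by (metis imageI)
    qed
    show "\<Psi> (A' (A (\<Phi> x))) = x" if "x \<in> U" for x using \<Psi>(1) that A(1) by simp
    show "x \<in> affine_part i \<longleftrightarrow> (\<forall>k. k \<notin> J \<longrightarrow> A (\<Phi> x) $ k = 0)" if x: "x \<in> U" for x
    proof -
      have "x \<in> affine_part i \<longleftrightarrow> \<Phi> x \<in> L"
      proof
        assume "x \<in> affine_part i"
        then have "\<Phi> x \<in> \<Phi> ` (affine_part i \<inter> U)" using x by (intro imageI IntI)
        then show "\<Phi> x \<in> L" using img by simp
      next
        assume "\<Phi> x \<in> L"
        moreover have "\<Phi> x \<in> V" using imageI[OF x, of \<Phi>] \<Phi>(1) by simp
        ultimately have "\<Phi> x \<in> \<Phi> ` (affine_part i \<inter> U)" using img by simp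
        then obtain x' where x': "x' \<in> affine_part i" "x' \<in> U" "\<Phi> x = \<Phi> x'" by (elim imageE IntE)
        have "x = \<Psi> (\<Phi> x)" using \<Psi>(1)[OF x] by (rule sym)
        also have "\<dots> = x'" unfolding x'(3) by (rule \<Psi>(1)[OF x'(2)])
        finally have "x = x'" .
        then show "x \<in> affine_part i" using x' by simp
      qed
      then show ?thesis using A(6) by simp
    qed
  qed (rule A(5))
  then show ?thesis using that U(2) by blast
qed

lemma local_chartD:
  assumes "local_chart i U V \<Phi> \<Psi> J"
  shows "open U" "open V" "holomorphic_map \<Phi> U" "holomorphic_map \<Psi> V" "\<And>x. x \<in> U \<Longrightarrow> \<Phi> x \<in> V"
    "\<And>y. y \<in> V \<Longrightarrow> \<Psi> y \<in> U" "\<And>x. x \<in> U \<Longrightarrow> \<Psi> (\<Phi> x) = x" "\<And>y. y \<in> V \<Longrightarrow> \<Phi> (\<Psi> y) = y" "card J = m"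
    "\<And>x. x \<in> U \<Longrightarrow> x \<in> affine_part i \<longleftrightarrow> (\<forall>k. k \<notin> J \<longrightarrow> \<Phi> x $ k = 0)"
    "\<And>y. y \<in> V \<Longrightarrow> \<Psi> y \<in> affine_part i \<longleftrightarrow> (\<forall>k. k \<notin> J \<longrightarrow> y $ k = 0)"
proof -
  have d: "holomorphic_map \<Phi> U" "holomorphic_map \<Psi> V" "\<Phi> ` U = V" "\<And>x. x \<in> U \<Longrightarrow> \<Psi> (\<Phi> x) = x" "card J = m"
    "\<And>x. x \<in> U \<Longrightarrow> x \<in> affine_part i \<longleftrightarrow> (\<forall>k. k \<notin> J \<longrightarrow> \<Phi> x $ k = 0)"
    using assms unfolding local_chart_def by blast+
  have inv: "\<Psi> y \<in> U" "\<Phi> (\<Psi> y) = y" if "y \<in> V" for y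
    using that d(3,4) by auto
  show "open U" "open V" "holomorphic_map \<Phi> U" "holomorphic_map \<Psi> V" "card J = m"
    using d holomorphic_map_open by blast+
  show "\<Phi> x \<in> V" "\<Psi> (\<Phi> x) = x" "x \<in> affine_part i \<longleftrightarrow> (\<forall>k. k \<notin> J \<longrightarrow> \<Phi> x $ k = 0)" if "x \<in> U" for x
    using that d by blast+
  show "\<Psi> y \<in> U" "\<Phi> (\<Psi> y) = y" "\<Psi> y \<in> affine_part i \<longleftrightarrow> (\<forall>k. k \<notin> J \<longrightarrow> y $ k = 0)" if "y \<in> V" for y
    using inv[OF that] d(6)[OF inv(1)[OF that]] by simp_all
qed

lemma mapd_inverse:
  assumes "local_chart i U V \<Phi> \<Psi> J"
  shows "x \<in> U \<Longrightarrow> mapd \<Psi> (\<Phi> x) (mapd \<Phi> x v) = v" "y \<in> V \<Longrightarrow> mapd \<Phi> (\<Psi> y) (mapd \<Psi> y v) = v"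
proof -
  note c = local_chartD[OF assms]
  have id: "((\<lambda>x. x) has_derivative (\<lambda>h. h)) (at z)" for z :: "complex ^ 'n" by (rule has_derivative_ident)
  show "mapd \<Psi> (\<Phi> x) (mapd \<Phi> x v) = v" if x: "x \<in> U"
  proof -
    have "((\<lambda>x. \<Psi> (\<Phi> x)) has_derivative (\<lambda>h. mapd \<Psi> (\<Phi> x) (mapd \<Phi> x h))) (at x)"
      by (rule has_derivative_compose[OF holomorphic_map_has_derivative[OF c(3) x] holomorphic_map_has_derivative[OF c(4) c(5)[OF x]]])
    then have "((\<lambda>x. x) has_derivative (\<lambda>h. mapd \<Psi> (\<Phi> x) (mapd \<Phi> x h))) (at x)"
      by (rule has_derivative_transform_within_open[OF _ c(1) x]) (rule c(7))
    from fun_cong[OF has_derivative_unique[OF this id]] show ?thesis .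
  qed
  show "mapd \<Phi> (\<Psi> y) (mapd \<Psi> y v) = v" if y: "y \<in> V"
  proof -
    have "((\<lambda>x. \<Phi> (\<Psi> x)) has_derivative (\<lambda>h. mapd \<Phi> (\<Psi> y) (mapd \<Psi> y h))) (at y)"
      by (rule has_derivative_compose[OF holomorphic_map_has_derivative[OF c(4) y] holomorphic_map_has_derivative[OF c(3) c(6)[OF y]]])
    then have "((\<lambda>x. x) has_derivative (\<lambda>h. mapd \<Phi> (\<Psi> y) (mapd \<Psi> y h))) (at y)"
      by (rule has_derivative_transform_within_open[OF _ c(2) y]) (rule c(8))
    from fun_cong[OF has_derivative_unique[OF this id]] show ?thesis .
  qed
qed

text \<open>The component \<open>i\<close> of the velocity vanishes because the affine part lies in the hyperplane
  \<open>x\<^sub>i = 1\<close>; so \<open>v\<close> really is the coordinate vector of a tangent vector.\<close>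

lemma lift_curve:
  assumes T: "open T" and c: "\<And>s. s \<in> T \<Longrightarrow> c s \<in> affine_part i"
    and d: "\<And>s. s \<in> T \<Longrightarrow> (c has_derivative (\<lambda>h. h *s v s)) (at s)"
  shows "holomorphic_curve M T (\<lambda>s. abs_cproj (c s))"
    and "\<And>s. s \<in> T \<Longrightarrow> velocity (\<lambda>s. abs_cproj (c s)) s (tvec_of i (abs_cproj (c s)) (v s)) \<and> v s $ i = 0"
proof -
  show vel: "velocity (\<lambda>s. abs_cproj (c s)) s (tvec_of i (abs_cproj (c s)) (v s)) \<and> v s $ i = 0" if s: "s \<in> T" for s
  proof
    have "((\<lambda>s. chart i (abs_cproj (c s))) has_derivative (\<lambda>h. h *s v s)) (at s)"
      by (rule has_derivative_transform_within_open[OF d[OF s] T s]) (use c affine_partD in force)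
    then show "velocity (\<lambda>s. abs_cproj (c s)) s (tvec_of i (abs_cproj (c s)) (v s))"
      by (rule velocity_tvec_of) (use c[OF s] affine_partD in blast)
    have "((\<lambda>s. c s $ i) has_field_derivative v s $ i) (at s)"
      using d[OF s] unfolding has_derivative_smult_iff by blast
    moreover have "((\<lambda>s. c s $ i) has_field_derivative 0) (at s)"
      by (rule has_field_derivative_transform_within_open[OF DERIV_const[of 1] T s]) (use c affine_partD in force)
    ultimately show "v s $ i = 0" by (rule DERIV_unique)
  qed
  have "continuous_on T c"
    using d by (meson continuous_at_imp_continuous_on has_derivative_continuous)
  then have "continuous_on T (\<lambda>s. abs_cproj (c s))"
    by (rule continuous_on_compose2[OF continuous_on_abs_cproj_affine]) (use c affine_partD in blast)
  then show "holomorphic_curve M T (\<lambda>s. abs_cproj (c s))"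
    unfolding holomorphic_curve_def using T vel c affine_partD by blast
qed

lemma velocity_tangent:
  assumes lc: "local_chart i U V \<Phi> \<Psi> J" and p: "\<gamma> t \<in> chart_dom i" "chart i (\<gamma> t) \<in> U"
    and v: "velocity \<gamma> t w" and M: "\<forall>\<^sub>F s in nhds t. \<gamma> s \<in> M" and k: "k \<notin> J"
  shows "mapd \<Phi> (chart i (\<gamma> t)) (w $ i) $ k = 0"
proof -
  note c = local_chartD[OF lc]
  note d = velocity_chart[OF v p(1)]
  have "((\<lambda>s. \<Phi> (chart i (\<gamma> s)) $ k) has_field_derivative mapd \<Phi> (chart i (\<gamma> t)) (w $ i) $ k) (at t)"
    using holomorphic_map_along_curve[OF c(3) d p(2)] unfolding has_derivative_smult_iff by blast
  moreover have "((\<lambda>s. \<Phi> (chart i (\<gamma> s)) $ k) has_field_derivative 0) (at t)"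
  proof -
    have "((\<lambda>s. chart i (\<gamma> s)) \<longlongrightarrow> chart i (\<gamma> t)) (nhds t)"
      using has_derivative_continuous[OF d] by (simp add: isCont_def tendsto_nhds_iff)
    then have "\<forall>\<^sub>F s in nhds t. chart i (\<gamma> s) \<in> U" using c(1) p(2) by (simp add: topological_tendstoD)
    moreover have "\<forall>\<^sub>F s in nhds t. \<gamma> s \<in> chart_dom i"
      using eventually_in_chart_dom[OF d p(1), of i] p(1) by (simp add: chart_dom_iff eventually_conj_iff)
    ultimately have "\<forall>\<^sub>F s in nhds t. \<Phi> (chart i (\<gamma> s)) $ k = 0"
      using M by eventually_elim (use c(10) k chart_in_affine_part in blast)
    then show ?thesis by (subst DERIV_cong_ev[OF refl _ refl]) auto
  qed
  ultimately show ?thesis by (rule DERIV_unique)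
qed

lemma holomorphic_curve_eventually:
  "holomorphic_curve M T \<gamma> \<Longrightarrow> t \<in> T \<Longrightarrow> \<forall>\<^sub>F s in nhds t. \<gamma> s \<in> M"
  unfolding holomorphic_curve_def eventually_nhds by blast

lemma tangent_spaceD:
  assumes "w \<in> tangent_space M p"
  obtains \<gamma> where "\<gamma> 0 = p" "velocity \<gamma> 0 w" "\<forall>\<^sub>F s in nhds 0. \<gamma> s \<in> M"
proof -
  obtain \<gamma> r where "\<gamma> 0 = p" "velocity \<gamma> 0 w" "r > 0" "holomorphic_curve M (ball 0 r) \<gamma>"
    using assms by (auto simp: tangent_space_def curve_through_def)
  then show ?thesis using that holomorphic_curve_eventually[of "ball 0 r" \<gamma> 0] by auto
qed

text \<open>The set of velocities of curves is the linear space suggested by a chart.  That every such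
  vector is a velocity is seen from the image under \<open>\<Psi>\<close> of a straight line in the model subspace.\<close>

lemma tangent_space_iff:
  assumes lc: "local_chart i U V \<Phi> \<Psi> J" and p: "p \<in> M" "p \<in> chart_dom i" "chart i p \<in> U"
  shows "w \<in> tangent_space M p \<longleftrightarrow> w = tvec_of i p (w $ i) \<and> (\<forall>k. k \<notin> J \<longrightarrow> mapd \<Phi> (chart i p) (w $ i) $ k = 0)"
    and "(\<forall>k. k \<notin> J \<longrightarrow> mapd \<Phi> (chart i p) v $ k = 0) \<Longrightarrow> tvec_of i p v \<in> tangent_space M p \<and> tvec_of i p v $ i = v"
proof -
  note c = local_chartD[OF lc]
  define x where "x = chart i p"
  have x: "x \<in> U" "x \<in> affine_part i" using p chart_in_affine_part by (auto simp: x_def)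
  show B: "tvec_of i p v \<in> tangent_space M p \<and> tvec_of i p v $ i = v"
    if v: "\<forall>k. k \<notin> J \<longrightarrow> mapd \<Phi> (chart i p) v $ k = 0" for v
  proof -
    define u where "u = mapd \<Phi> x v"
    define c0 where "c0 = (\<lambda>s :: complex. \<Phi> x + s *s u)"
    have "open (c0 -` V)" unfolding c0_def
      by (intro open_vimage c(2)) (auto simp: vector_scalar_mult_def intro!: continuous_intros)
    moreover have c00: "c0 0 = \<Phi> x" by (simp add: c0_def)
    then have "0 \<in> c0 -` V" using c(5) x by simp
    ultimately obtain r where r: "r > 0" "ball 0 r \<subseteq> c0 -` V" by (meson openE)
    define e where "e = (\<lambda>s. \<Psi> (c0 s))"
    have inV: "c0 s \<in> V" if "s \<in> ball 0 r" for s using that r by auto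
    have e: "e s \<in> affine_part i" if "s \<in> ball 0 r" for s
    proof -
      have "c0 s $ k = 0" if "k \<notin> J" for k
        using that v c(10)[OF x(1)] x(2) by (simp add: c0_def u_def x_def)
      then show ?thesis unfolding e_def using c(11)[OF inV[OF that]] by blast
    qed
    have d: "(e has_derivative (\<lambda>h. h *s mapd \<Psi> (c0 s) u)) (at s)" if "s \<in> ball 0 r" for s
      unfolding e_def
      by (rule holomorphic_map_along_curve[OF c(4)]) (use inV[OF that] in \<open>auto simp: c0_def intro: has_derivative_line\<close>)
    have 0: "0 \<in> ball (0::complex) r" using r by simp
    have e0: "e 0 = x" using c(7) x c00 by (simp add: e_def)
    have m0: "mapd \<Psi> (c0 0) u = v" using mapd_inverse(1)[OF lc x(1)] c00 by (simp add: u_def)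
    have "velocity (\<lambda>s. abs_cproj (e s)) 0 (tvec_of i p v) \<and> v $ i = 0"
      using lift_curve(2)[of "ball 0 r" e i "\<lambda>s. mapd \<Psi> (c0 s) u", OF open_ball e d 0] e0 m0 p by (simp add: x_def)
    moreover have "holomorphic_curve M (ball 0 r) (\<lambda>s. abs_cproj (e s))"
      using lift_curve(1)[of "ball 0 r" e i "\<lambda>s. mapd \<Psi> (c0 s) u", OF open_ball e d] by blast
    moreover have "abs_cproj (e 0) = p" using e0 p by (simp add: x_def)
    ultimately have "curve_through M p (tvec_of i p v) (\<lambda>s. abs_cproj (e s))" "v $ i = 0"
      unfolding curve_through_def using r(1) by auto
    then show ?thesis using tvec_of_self[OF p(2)] by (auto simp: tangent_space_def)
  qed
  show "w \<in> tangent_space M p \<longleftrightarrow> w = tvec_of i p (w $ i) \<and> (\<forall>k. k \<notin> J \<longrightarrow> mapd \<Phi> (chart i p) (w $ i) $ k = 0)"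
  proof
    assume "w \<in> tangent_space M p"
    then obtain \<gamma> where g: "\<gamma> 0 = p" "velocity \<gamma> 0 w" "\<forall>\<^sub>F s in nhds 0. \<gamma> s \<in> M"
      by (rule tangent_spaceD)
    show "w = tvec_of i p (w $ i) \<and> (\<forall>k. k \<notin> J \<longrightarrow> mapd \<Phi> (chart i p) (w $ i) $ k = 0)"
      using velocity_eq_tvec_of[OF g(2), of i] velocity_tangent[OF lc, of \<gamma> 0] g p by metis
  next
    assume "w = tvec_of i p (w $ i) \<and> (\<forall>k. k \<notin> J \<longrightarrow> mapd \<Phi> (chart i p) (w $ i) $ k = 0)"
    then show "w \<in> tangent_space M p" using B[of "w $ i"] by metis
  qed
qed

end

section \<open>Irreducibility and generic points\<close>

context projective_mfd
begin

text \<open>In a ball of a chart any two points of \<open>M\<close> lie on a complex line whose image stays in \<open>M\<close>, so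
  the identity theorem in one variable carries zeros from a neighbourhood of one point to the other.\<close>

lemma identity_principle_local:
  assumes P: "homogeneous d P" and p: "p \<in> M"
  shows "\<exists>W. open W \<and> p \<in> W \<and> (\<forall>N q. open N \<and> q \<in> M \<and> q \<in> N \<and> q \<in> W \<and> (\<forall>q'\<in>M \<inter> N. P (rep_cproj q') = 0)
      \<longrightarrow> (\<forall>q'\<in>M \<inter> W. P (rep_cproj q') = 0))"
proof -
  obtain i where i: "p \<in> chart_dom i" using ex_chart_dom by blast
  obtain U V \<Phi> \<Psi> and J :: "'n set" where lc: "local_chart i U V \<Phi> \<Psi> J" and U: "chart i p \<in> U"
    using local_chart_exists[OF p i] by blast
  note c = local_chartD[OF lc]
  define y0 where "y0 = \<Phi> (chart i p)"
  obtain r where r: "r > 0" "ball y0 r \<subseteq> V" using c(2) c(5)[OF U] openE y0_def by metis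
  define A where "A = U \<inter> \<Phi> -` ball y0 r"
  have "open A"
    unfolding A_def using continuous_open_preimage[OF holomorphic_map_continuous_on[OF c(3)] c(1) open_ball] .
  then have oW: "open (chart_dom i \<inter> chart i -` A)" by (rule open_chart_preimage)
  show ?thesis
  proof (intro exI conjI allI impI ballI)
    show "open (chart_dom i \<inter> chart i -` A)" by (rule oW)
    show "p \<in> chart_dom i \<inter> chart i -` A" using i U r by (simp add: A_def y0_def)
    fix N q q'
    assume *: "open N \<and> q \<in> M \<and> q \<in> N \<and> q \<in> chart_dom i \<inter> chart i -` A \<and> (\<forall>q'\<in>M \<inter> N. P (rep_cproj q') = 0)"
      and "q' \<in> M \<inter> (chart_dom i \<inter> chart i -` A)"
    then have N: "open N" "q \<in> M" "q \<in> N" "q \<in> chart_dom i \<inter> chart i -` A"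
      and zero: "\<And>q'. q' \<in> M \<Longrightarrow> q' \<in> N \<Longrightarrow> P (rep_cproj q') = 0"
      and q': "q' \<in> M" "q' \<in> chart_dom i \<inter> chart i -` A" by auto
    define y1 where "y1 = \<Phi> (chart i q)"
    define y2 where "y2 = \<Phi> (chart i q')"
    have y: "y1 \<in> ball y0 r" "y2 \<in> ball y0 r" using N(4) q'(2) by (auto simp: A_def y1_def y2_def)
    have y1k: "y1 $ k = 0" and y2k: "y2 $ k = 0" if "k \<notin> J" for k
      using c(10)[of "chart i q"] c(10)[of "chart i q'"] N q' that chart_in_affine_part
      by (auto simp: A_def y1_def y2_def)
    define l where "l = (\<lambda>s :: complex. y1 + s *s (y2 - y1))"
    define T where "T = l -` ball y0 r"
    have lc: "continuous_on UNIV l"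
      unfolding l_def vector_scalar_mult_def by (intro continuous_intros)
    have oT: "open T" unfolding T_def by (rule open_vimage[OF open_ball lc])
    have cT: "convex T"
    proof (rule convexI)
      fix s t u v assume st: "s \<in> T" "t \<in> T" "0 \<le> u" "0 \<le> v" "u + v = (1::real)"
      have "l (u *\<^sub>R s + v *\<^sub>R t) = u *\<^sub>R l s + v *\<^sub>R l t"
      proof -
        have "y1 $ k = u *\<^sub>R y1 $ k + v *\<^sub>R y1 $ k" for k
          using st(5) by (simp flip: scaleR_add_left)
        then show ?thesis by (simp add: vec_eq_iff l_def algebra_simps)
      qed
      moreover have "u *\<^sub>R l s + v *\<^sub>R l t \<in> ball y0 r"
        using st by (intro convexD[OF convex_ball]) (auto simp: T_def)
      ultimately show "u *\<^sub>R s + v *\<^sub>R t \<in> T" by (simp add: T_def)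
    qed
    define e where "e = (\<lambda>s. \<Psi> (l s))"
    have aff: "e s \<in> affine_part i" if "s \<in> T" for s
      unfolding e_def using that r(2) y1k y2k by (subst c(11)) (auto simp: T_def l_def)
    have hol: "(\<lambda>s. P (e s)) holomorphic_on T"
      unfolding e_def l_def
      by (rule holomorphic_mv_on_line[OF holomorphic_mv_compose[OF homogeneous_holomorphic[OF P open_UNIV] c(4)]])
        (use r(2) in \<open>auto simp: T_def l_def\<close>)
    have T01: "0 \<in> T" "1 \<in> T" using y by (auto simp: T_def l_def)
    have cont: "continuous_on T (\<lambda>s. abs_cproj (e s))"
    proof (rule continuous_on_compose2[OF continuous_on_abs_cproj_affine])
      show "continuous_on T e"
        unfolding e_def
        by (rule continuous_on_compose2[OF holomorphic_map_continuous_on[OF c(4)] continuous_on_subset[OF lc]])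
          (use r(2) in \<open>auto simp: T_def\<close>)
      show "e ` T \<subseteq> {x. x $ i = 1}" using aff affine_partD by blast
    qed
    define S where "S = T \<inter> (\<lambda>s. abs_cproj (e s)) -` N"
    have oS: "open S" unfolding S_def using continuous_open_preimage[OF cont oT N(1)] .
    have Pz: "P x = 0 \<longleftrightarrow> P (rep_cproj (abs_cproj x)) = 0" if "x \<in> affine_part i" for x
      using homogeneous_chart_zero_iff[OF P, of "abs_cproj x" i] affine_partD[OF that] by simp
    have e0: "e 0 = chart i q" "e 1 = chart i q'"
      using N q' c(7) by (auto simp: e_def l_def y1_def y2_def A_def)
    have "P (e 1) = 0"
    proof (rule analytic_continuation_open[of S T "\<lambda>s. P (e s)" "\<lambda>_. 0" 1])
      show "S \<noteq> {}" using T01 e0 N by (auto simp: S_def)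
      show "P (e s) = 0" if "s \<in> S" for s
      proof -
        have a: "e s \<in> affine_part i" using that aff by (simp add: S_def)
        then show ?thesis using Pz[OF a] zero[of "abs_cproj (e s)"] affine_partD[OF a] that by (simp add: S_def)
      qed
    qed (use oS oT cT convex_connected hol T01 in \<open>auto simp: S_def\<close>)
    then show "P (rep_cproj q') = 0"
      using e0 q' homogeneous_chart_zero_iff[OF P] by auto
  qed
qed

text \<open>The interior of the zero set of \<open>P\<close> in \<open>M\<close> is open by definition and closed by the local
  principle; \<open>M\<close> is connected.\<close>

lemma identity_principle:
  assumes P: "homogeneous d P" and N: "open N" "q \<in> M" "q \<in> N"
    and zero: "\<And>q'. q' \<in> M \<Longrightarrow> q' \<in> N \<Longrightarrow> P (rep_cproj q') = 0"
    and p: "p \<in> M"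
  shows "P (rep_cproj p) = 0"
proof -
  \<comment> \<open>Within \<open>M\<close> these are the interior of the zero set and the complement of its closure.\<close>
  define A where "A = \<Union>{N. open N \<and> (\<forall>q\<in>M \<inter> N. P (rep_cproj q) = 0)}"
  define B where "B = \<Union>{W. open W \<and> W \<inter> (M \<inter> A) = {}}"
  have "open A" "open B" by (auto simp: A_def B_def)
  moreover have "A \<inter> B \<inter> M = {}" by (auto simp: B_def)
  moreover have "M \<subseteq> A \<union> B"
  proof
    fix x assume x: "x \<in> M"
    obtain W where W: "open W" "x \<in> W"
      "\<And>N q. open N \<and> q \<in> M \<and> q \<in> N \<and> q \<in> W \<and> (\<forall>q'\<in>M \<inter> N. P (rep_cproj q') = 0)
      \<Longrightarrow> (\<forall>q'\<in>M \<inter> W. P (rep_cproj q') = 0)"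
      using identity_principle_local[OF P x] by blast
    show "x \<in> A \<union> B"
    proof (cases "W \<inter> (M \<inter> A) = {}")
      case True
      then show ?thesis using W by (auto simp: B_def)
    next
      case False
      then obtain N' q1 where q1: "q1 \<in> W" "q1 \<in> M" "q1 \<in> N'" "open N'" "\<forall>q\<in>M \<inter> N'. P (rep_cproj q) = 0"
        by (auto simp: A_def)
      have "P (rep_cproj q') = 0" if "q' \<in> M" "q' \<in> W" for q'
        using W(3)[of N' q1] q1 that by blast
      then have "x \<in> A" unfolding A_def using W by blast
      then show ?thesis by simp
    qed
  qed
  ultimately have "A \<inter> M = {} \<or> B \<inter> M = {}" using connectedD[OF conn] by blast
  moreover have "q \<in> A" unfolding A_def using N zero by blast
  ultimately have "B \<inter> M = {}" using N by blast
  then have "p \<in> A" using p \<open>M \<subseteq> A \<union> B\<close> by blast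
  then show ?thesis using p by (auto simp: A_def)
qed

definition nonvanishing :: "(complex ^ 'n \<Rightarrow> complex) \<Rightarrow> bool" where
  "nonvanishing Q \<longleftrightarrow> (\<exists>d. homogeneous d Q) \<and> (\<exists>q\<in>M. Q (rep_cproj q) \<noteq> 0)"

lemma nonvanishing_dense:
  assumes "nonvanishing Q" "open N" "p \<in> M" "p \<in> N"
  shows "\<exists>q\<in>M \<inter> N. Q (rep_cproj q) \<noteq> 0"
proof (rule ccontr)
  assume "\<not> ?thesis"
  then have z: "\<And>q'. q' \<in> M \<Longrightarrow> q' \<in> N \<Longrightarrow> Q (rep_cproj q') = 0" by blast
  obtain d q where "homogeneous d Q" "q \<in> M" "Q (rep_cproj q) \<noteq> 0" using assms(1) by (auto simp: nonvanishing_def)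
  then show False using identity_principle[of d Q N p q] assms(2-4) z by blast
qed

lemma nonvanishing_mult:
  assumes "nonvanishing P" "nonvanishing Q"
  shows "nonvanishing (\<lambda>x. P x * Q x)"
proof -
  obtain d e q where h: "homogeneous d P" "homogeneous e Q" "q \<in> M" "Q (rep_cproj q) \<noteq> 0"
    using assms unfolding nonvanishing_def by metis
  have "\<exists>p\<in>M \<inter> {p. Q (rep_cproj p) \<noteq> 0}. P (rep_cproj p) \<noteq> 0"
    by (rule nonvanishing_dense[OF assms(1) open_nonzero_form[OF h(2)]]) (use h in auto)
  then show ?thesis unfolding nonvanishing_def using homogeneous_mult[OF h(1,2)] by auto
qed

text \<open>Generic points, as the filter generated by complements of hypersurfaces.  A property that
  holds eventually along this filter holds on a dense open subset, and by the identity principle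
  finitely many such properties can be combined.\<close>

definition generic :: "'n cproj filter" where
  "generic = (INF Q\<in>{Q. nonvanishing Q}. principal {p \<in> M. Q (rep_cproj p) \<noteq> 0})"

lemma nonvanishing_one: "nonvanishing (\<lambda>x. 1)"
  using nonempty homogeneous_const[of 1] by (auto simp: nonvanishing_def)

lemma eventually_generic_iff:
  "eventually P generic \<longleftrightarrow> (\<exists>Q. nonvanishing Q \<and> (\<forall>p\<in>M. Q (rep_cproj p) \<noteq> 0 \<longrightarrow> P p))"
proof -
  have "eventually P generic \<longleftrightarrow> (\<exists>Q\<in>{Q. nonvanishing Q}. eventually P (principal {p \<in> M. Q (rep_cproj p) \<noteq> 0}))"
    unfolding generic_def
  proof (rule eventually_INF_base)
    show "{Q. nonvanishing Q} \<noteq> {}" using nonvanishing_one by auto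
    fix P Q assume "P \<in> {Q. nonvanishing Q}" "Q \<in> {Q. nonvanishing Q}"
    then show "\<exists>R\<in>{Q. nonvanishing Q}. principal {p \<in> M. R (rep_cproj p) \<noteq> 0} \<le>
       inf (principal {p \<in> M. P (rep_cproj p) \<noteq> 0}) (principal {p \<in> M. Q (rep_cproj p) \<noteq> 0})"
      by (intro bexI[of _ "\<lambda>x. P x * Q x"]) (auto simp: nonvanishing_mult)
  qed
  then show ?thesis by (auto simp: eventually_principal)
qed

lemma generic_in_M: "\<forall>\<^sub>F p in generic. p \<in> M"
  unfolding eventually_generic_iff using nonvanishing_one by blast

lemma generic_nonzero: "nonvanishing Q \<Longrightarrow> \<forall>\<^sub>F p in generic. Q (rep_cproj p) \<noteq> 0"
  unfolding eventually_generic_iff by blast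

lemma generic_dense:
  assumes "eventually P generic" "open N" "p \<in> M" "p \<in> N"
  shows "\<exists>q\<in>M \<inter> N. P q"
  using assms nonvanishing_dense[OF _ assms(2-4)] unfolding eventually_generic_iff by blast

lemma generic_ex: "eventually P generic \<Longrightarrow> \<exists>p\<in>M. P p"
  using generic_dense[of P UNIV] nonempty by auto

lemma generic_neq_bot [simp]: "generic \<noteq> bot"
  using generic_ex[of "\<lambda>_. False"] by (auto simp: trivial_limit_def)

lemma generic_open:
  assumes "eventually P generic"
  shows "\<forall>\<^sub>F p in generic. \<exists>N. open N \<and> p \<in> N \<and> (\<forall>q\<in>M \<inter> N. P q)"
proof -
  obtain Q where Q: "nonvanishing Q" "\<And>p. p \<in> M \<Longrightarrow> Q (rep_cproj p) \<noteq> 0 \<Longrightarrow> P p"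
    using assms by (auto simp: eventually_generic_iff)
  then have "open {p. Q (rep_cproj p) \<noteq> 0}" unfolding nonvanishing_def using open_nonzero_form by blast
  with Q show ?thesis unfolding eventually_generic_iff by (intro exI[of _ Q]) blast
qed

text \<open>The way in which identities between rational functions reach the points of indeterminacy of
  the fractions that were used to prove them.\<close>

lemma vanishing_by_density:
  fixes f :: "'n cproj \<Rightarrow> 'b::t1_space"
  assumes N: "open N" "p \<in> M" "p \<in> N" and f: "continuous_on N f"
    and z: "\<forall>\<^sub>F q in generic. q \<in> N \<longrightarrow> f q = a"
  shows "f p = a"
proof (rule ccontr)
  assume "f p \<noteq> a"
  have "open (N \<inter> f -` (- {a}))"
    by (rule continuous_open_preimage[OF f N(1)]) auto
  then obtain q where "q \<in> N \<inter> f -` (- {a})" "q \<in> N \<longrightarrow> f q = a"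
    using generic_dense[OF z, of "N \<inter> f -` (- {a})" p] N \<open>f p \<noteq> a\<close> by auto
  then show False by auto
qed

section \<open>Rational functions\<close>

text \<open>Elements of the function field are represented by total functions that agree with a fraction
  at generic points; two of them are the same element iff they agree generically.  With this
  representation the field operations are pointwise, and domains of regularity need to be considered
  only for the partial functions that represent the same elements with their full domain.\<close>

definition rational :: "('n cproj \<Rightarrow> complex) \<Rightarrow> bool" where
  "rational f \<longleftrightarrow> (\<exists>d P Q. homogeneous d P \<and> homogeneous d Q \<and> nonvanishing Q \<and>
     (\<forall>p\<in>M. Q (rep_cproj p) \<noteq> 0 \<longrightarrow> f p = P (rep_cproj p) / Q (rep_cproj p)))"

lemma rationalI:
  assumes P: "homogeneous d P" and Q: "homogeneous d Q" "nonvanishing Q"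
    and f: "\<forall>\<^sub>F p in generic. f p = P (rep_cproj p) / Q (rep_cproj p)"
  shows "rational f"
proof -
  obtain R where R: "nonvanishing R" "\<And>p. p \<in> M \<Longrightarrow> R (rep_cproj p) \<noteq> 0 \<Longrightarrow> f p = P (rep_cproj p) / Q (rep_cproj p)"
    using f by (auto simp: eventually_generic_iff)
  obtain e where e: "homogeneous e R" using R(1) by (auto simp: nonvanishing_def)
  show ?thesis unfolding rational_def
    by (rule exI[of _ "d + e"], rule exI[of _ "\<lambda>x. P x * R x"], rule exI[of _ "\<lambda>x. Q x * R x"])
      (use homogeneous_mult[OF P e] homogeneous_mult[OF Q(1) e] nonvanishing_mult[OF Q(2) R(1)] R(2) in auto)
qed

lemma rationalE:
  assumes "rational f"
  obtains d P Q where "homogeneous d P" "homogeneous d Q" "nonvanishing Q"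
    "\<forall>\<^sub>F p in generic. Q (rep_cproj p) \<noteq> 0 \<and> f p = P (rep_cproj p) / Q (rep_cproj p)"
proof -
  obtain d P Q where h: "homogeneous d P" "homogeneous d Q" "nonvanishing Q"
    "\<And>p. p \<in> M \<Longrightarrow> Q (rep_cproj p) \<noteq> 0 \<Longrightarrow> f p = P (rep_cproj p) / Q (rep_cproj p)"
    using assms unfolding rational_def by blast
  have "\<forall>\<^sub>F p in generic. Q (rep_cproj p) \<noteq> 0 \<and> f p = P (rep_cproj p) / Q (rep_cproj p)"
    using generic_nonzero[OF h(3)] generic_in_M by eventually_elim (use h(4) in blast)
  with h that show ?thesis by blast
qed

lemma rational_cong:
  assumes "rational f" "\<forall>\<^sub>F p in generic. g p = f p"
  shows "rational g"
proof -
  obtain d P Q where h: "homogeneous d P" "homogeneous d Q" "nonvanishing Q"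
    "\<forall>\<^sub>F p in generic. Q (rep_cproj p) \<noteq> 0 \<and> f p = P (rep_cproj p) / Q (rep_cproj p)"
    by (rule rationalE[OF assms(1)]) (rule that)
  show ?thesis
    by (rule rationalI[OF h(1-3)]) (use h(4) assms(2) in eventually_elim, auto)
qed

lemma rational_const: "rational (\<lambda>p. a)"
  by (rule rationalI[OF homogeneous_const[of a] homogeneous_const[of 1] nonvanishing_one]) simp

lemma rational_add:
  assumes "rational f" "rational g"
  shows "rational (\<lambda>p. f p + g p)"
proof -
  obtain d P Q where f: "homogeneous d P" "homogeneous d Q" "nonvanishing Q"
    "\<forall>\<^sub>F p in generic. Q (rep_cproj p) \<noteq> 0 \<and> f p = P (rep_cproj p) / Q (rep_cproj p)"
    by (rule rationalE[OF assms(1)]) (rule that)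
  obtain e R S where g: "homogeneous e R" "homogeneous e S" "nonvanishing S"
    "\<forall>\<^sub>F p in generic. S (rep_cproj p) \<noteq> 0 \<and> g p = R (rep_cproj p) / S (rep_cproj p)"
    by (rule rationalE[OF assms(2)]) (rule that)
  have "homogeneous (d + e) (\<lambda>x. Q x * R x)" by (rule homogeneous_mult[OF f(2) g(1)])
  then have "homogeneous (d + e) (\<lambda>x. P x * S x + Q x * R x)"
    using homogeneous_add[OF homogeneous_mult[OF f(1) g(2)]] by blast
  then show ?thesis
    by (rule rationalI[OF _ homogeneous_mult[OF f(2) g(2)] nonvanishing_mult[OF f(3) g(3)]])
      (use f(4) g(4) in eventually_elim, auto simp: field_simps)
qed

lemma rational_mult:
  assumes "rational f" "rational g"
  shows "rational (\<lambda>p. f p * g p)"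
proof -
  obtain d P Q where f: "homogeneous d P" "homogeneous d Q" "nonvanishing Q"
    "\<forall>\<^sub>F p in generic. Q (rep_cproj p) \<noteq> 0 \<and> f p = P (rep_cproj p) / Q (rep_cproj p)"
    by (rule rationalE[OF assms(1)]) (rule that)
  obtain e R S where g: "homogeneous e R" "homogeneous e S" "nonvanishing S"
    "\<forall>\<^sub>F p in generic. S (rep_cproj p) \<noteq> 0 \<and> g p = R (rep_cproj p) / S (rep_cproj p)"
    by (rule rationalE[OF assms(2)]) (rule that)
  show ?thesis
    by (rule rationalI[OF homogeneous_mult[OF f(1) g(1)] homogeneous_mult[OF f(2) g(2)] nonvanishing_mult[OF f(3) g(3)]])
      (use f(4) g(4) in eventually_elim, auto)
qed

lemma form_vanishing_cases:
  assumes "homogeneous d P"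
  shows "(\<forall>p\<in>M. P (rep_cproj p) = 0) \<or> nonvanishing P"
  using assms by (auto simp: nonvanishing_def)

text \<open>This is the form in which nonzero elements of the function field are invertible.\<close>

lemma rational_cases:
  assumes "rational f"
  shows "(\<forall>\<^sub>F p in generic. f p = 0) \<or> (\<forall>\<^sub>F p in generic. f p \<noteq> 0)"
proof -
  obtain d P Q where h: "homogeneous d P" "homogeneous d Q" "nonvanishing Q"
    "\<forall>\<^sub>F p in generic. Q (rep_cproj p) \<noteq> 0 \<and> f p = P (rep_cproj p) / Q (rep_cproj p)"
    by (rule rationalE[OF assms]) (rule that)
  from form_vanishing_cases[OF h(1)] show ?thesis
  proof
    assume z: "\<forall>p\<in>M. P (rep_cproj p) = 0"
    have "\<forall>\<^sub>F p in generic. f p = 0" using h(4) generic_in_M by eventually_elim (use z in auto)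
    then show ?thesis ..
  next
    assume "nonvanishing P"
    from generic_nonzero[OF this] have "\<forall>\<^sub>F p in generic. f p \<noteq> 0" using h(4) by eventually_elim auto
    then show ?thesis ..
  qed
qed

lemma rational_inverse:
  assumes "rational f"
  shows "rational (\<lambda>p. inverse (f p))"
proof -
  obtain d P Q where h: "homogeneous d P" "homogeneous d Q" "nonvanishing Q"
    "\<forall>\<^sub>F p in generic. Q (rep_cproj p) \<noteq> 0 \<and> f p = P (rep_cproj p) / Q (rep_cproj p)"
    by (rule rationalE[OF assms]) (rule that)
  from form_vanishing_cases[OF h(1)] show ?thesis
  proof
    assume z: "\<forall>p\<in>M. P (rep_cproj p) = 0"
    have "\<forall>\<^sub>F p in generic. inverse (f p) = 0" using h(4) generic_in_M by eventually_elim (use z in auto)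
    then show ?thesis using rational_cong[OF rational_const[of 0]] by simp
  next
    assume P: "nonvanishing P"
    show ?thesis by (rule rationalI[OF h(2,1) P]) (use h(4) in eventually_elim, auto)
  qed
qed

lemma rational_divide: "rational f \<Longrightarrow> rational g \<Longrightarrow> rational (\<lambda>p. f p / g p)"
  unfolding divide_inverse by (intro rational_mult rational_inverse)

lemma rational_uminus: "rational f \<Longrightarrow> rational (\<lambda>p. - f p)"
  using rational_mult[OF rational_const[of "-1"]] by simp

lemma rational_sum: "(\<And>a. a \<in> A \<Longrightarrow> rational (f a)) \<Longrightarrow> rational (\<lambda>p. \<Sum>a\<in>A. f a p)"
  by (induction A rule: infinite_finite_induct) (auto intro: rational_const rational_add)

lemma rational_power: "rational f \<Longrightarrow> rational (\<lambda>p. f p ^ k)"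
  by (induction k) (auto intro: rational_const rational_mult)

lemma rational_chart:
  assumes "nonvanishing (\<lambda>x. x $ i)"
  shows "rational (\<lambda>p. chart i p $ k)"
  by (rule rationalI[OF homogeneous_coord[of k] homogeneous_coord[of i] assms])
    (simp add: chart_def field_simps)

lemma nonvanishing_coord_iff: "nonvanishing (\<lambda>x. x $ i) \<longleftrightarrow> M \<inter> chart_dom i \<noteq> {}"
  using homogeneous_coord[of i] by (auto simp: nonvanishing_def chart_dom_def)

subsection \<open>Partial functions with full domain of regularity\<close>

text \<open>The fractions representing one rational function form one equivalence class, because the
  homogeneous coordinate ring of \<open>M\<close> is an integral domain.\<close>

lemma fraction_equality_trans:
  assumes "nonvanishing Q" "homogeneous d' P'" "homogeneous e' Q'" "homogeneous d'' P''" "homogeneous e'' Q''"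
    and "d' + e'' = d'' + e'"
    and "\<And>q. q \<in> M \<Longrightarrow> P (rep_cproj q) * Q' (rep_cproj q) = P' (rep_cproj q) * Q (rep_cproj q)"
    and "\<And>q. q \<in> M \<Longrightarrow> P (rep_cproj q) * Q'' (rep_cproj q) = P'' (rep_cproj q) * Q (rep_cproj q)"
    and p: "p \<in> M"
  shows "P' (rep_cproj p) * Q'' (rep_cproj p) = P'' (rep_cproj p) * Q' (rep_cproj p)"
proof -
  define R where "R = (\<lambda>x. P' x * Q'' x + (- 1) * (P'' x * Q' x))"
  have R: "homogeneous (d' + e'') R"
    unfolding R_def
    by (intro homogeneous_add homogeneous_cmult homogeneous_mult[OF assms(2,5)])
      (use homogeneous_mult[OF assms(4,3)] assms(6) in simp)
  have "R (rep_cproj q) * Q (rep_cproj q) = 0" if "q \<in> M" for q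
  proof -
    have "R (rep_cproj q) * Q (rep_cproj q) = (P' (rep_cproj q) * Q (rep_cproj q)) * Q'' (rep_cproj q) - (P'' (rep_cproj q) * Q (rep_cproj q)) * Q' (rep_cproj q)"
      by (simp add: R_def algebra_simps)
    also have "\<dots> = 0"
      unfolding assms(7)[OF that, symmetric] assms(8)[OF that, symmetric] by (simp add: mult_ac)
    finally show ?thesis .
  qed
  then have "\<not> nonvanishing (\<lambda>x. R x * Q x)" by (auto simp: nonvanishing_def)
  then have "\<not> nonvanishing R" using nonvanishing_mult assms(1) by blast
  then show ?thesis using R p by (auto simp: nonvanishing_def R_def)
qed

lemma rational_functionsE:
  assumes "h \<in> rational_functions M"
  obtains d P Q where "homogeneous d P" "homogeneous d Q" "nonvanishing Q"
    "\<And>p c. h p = Some c \<longleftrightarrow> p \<in> M \<and> (\<exists>e P' Q'. homogeneous e P' \<and> homogeneous e Q' \<and>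
           (\<forall>q\<in>M. P (rep_cproj q) * Q' (rep_cproj q) = P' (rep_cproj q) * Q (rep_cproj q)) \<and>
           Q' (rep_cproj p) \<noteq> 0 \<and> c = P' (rep_cproj p) / Q' (rep_cproj p))"
proof -
  from assms obtain d P Q where h: "homogeneous d P" "homogeneous d Q" "\<exists>q\<in>M. Q (rep_cproj q) \<noteq> 0"
    "\<forall>p c. h p = Some c \<longleftrightarrow> p \<in> M \<and> (\<exists>e P' Q'. homogeneous e P' \<and> homogeneous e Q' \<and>
           (\<forall>q\<in>M. P (rep_cproj q) * Q' (rep_cproj q) = P' (rep_cproj q) * Q (rep_cproj q)) \<and>
           Q' (rep_cproj p) \<noteq> 0 \<and> c = P' (rep_cproj p) / Q' (rep_cproj p))"
    unfolding rational_functions_def by blast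
  show ?thesis by (rule that[OF h(1,2) _ h(4)[rule_format]]) (use h in \<open>auto simp: nonvanishing_def\<close>)
qed

lemma rational_functions_local:
  assumes "h \<in> rational_functions M" "h p = Some c"
  obtains e P' Q' where "homogeneous e P'" "homogeneous e Q'" "p \<in> M" "Q' (rep_cproj p) \<noteq> 0"
    "\<And>q. q \<in> M \<Longrightarrow> Q' (rep_cproj q) \<noteq> 0 \<Longrightarrow> h q = Some (P' (rep_cproj q) / Q' (rep_cproj q))"
proof -
  obtain d P Q where h: "homogeneous d P" "homogeneous d Q" "nonvanishing Q"
    "\<And>p c. h p = Some c \<longleftrightarrow> p \<in> M \<and> (\<exists>e P' Q'. homogeneous e P' \<and> homogeneous e Q' \<and>
           (\<forall>q\<in>M. P (rep_cproj q) * Q' (rep_cproj q) = P' (rep_cproj q) * Q (rep_cproj q)) \<and>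
           Q' (rep_cproj p) \<noteq> 0 \<and> c = P' (rep_cproj p) / Q' (rep_cproj p))"
    by (rule rational_functionsE[OF assms(1)]) (rule that)
  from h(4)[THEN iffD1, OF assms(2)] obtain e P' Q' where l: "p \<in> M" "homogeneous e P'" "homogeneous e Q'"
    "\<forall>q\<in>M. P (rep_cproj q) * Q' (rep_cproj q) = P' (rep_cproj q) * Q (rep_cproj q)" "Q' (rep_cproj p) \<noteq> 0"
    by blast
  show ?thesis
    by (rule that[OF l(2,3,1,5)]) (use l h(4) in blast)
qed

lemma rational_functions_generic:
  assumes "h \<in> rational_functions M"
  shows "\<forall>\<^sub>F p in generic. p \<in> dom h" and "rational (\<lambda>p. the (h p))"
proof -
  obtain d P Q where h: "homogeneous d P" "homogeneous d Q" "nonvanishing Q"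
    "\<And>p c. h p = Some c \<longleftrightarrow> p \<in> M \<and> (\<exists>e P' Q'. homogeneous e P' \<and> homogeneous e Q' \<and>
           (\<forall>q\<in>M. P (rep_cproj q) * Q' (rep_cproj q) = P' (rep_cproj q) * Q (rep_cproj q)) \<and>
           Q' (rep_cproj p) \<noteq> 0 \<and> c = P' (rep_cproj p) / Q' (rep_cproj p))"
    by (rule rational_functionsE[OF assms]) (rule that)
  have *: "\<forall>\<^sub>F p in generic. h p = Some (P (rep_cproj p) / Q (rep_cproj p))"
    using generic_nonzero[OF h(3)] generic_in_M
    by eventually_elim (use h(1,2) in \<open>subst h(4), blast\<close>)
  then show "\<forall>\<^sub>F p in generic. p \<in> dom h" by eventually_elim auto
  show "rational (\<lambda>p. the (h p))"
    by (rule rationalI[OF h(1-3)]) (use * in eventually_elim, simp)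
qed

lemma rational_functions_exists:
  assumes "rational f"
  obtains h where "h \<in> rational_functions M" "\<forall>\<^sub>F p in generic. h p = Some (f p)"
proof -
  obtain d P Q where f: "homogeneous d P" "homogeneous d Q" "nonvanishing Q"
    "\<forall>\<^sub>F p in generic. Q (rep_cproj p) \<noteq> 0 \<and> f p = P (rep_cproj p) / Q (rep_cproj p)"
    by (rule rationalE[OF assms]) (rule that)
  define R where "R = (\<lambda>p c. p \<in> M \<and> (\<exists>e P' Q'. homogeneous e P' \<and> homogeneous e Q' \<and>
           (\<forall>q\<in>M. P (rep_cproj q) * Q' (rep_cproj q) = P' (rep_cproj q) * Q (rep_cproj q)) \<and>
           Q' (rep_cproj p) \<noteq> 0 \<and> c = P' (rep_cproj p) / Q' (rep_cproj p)))"
  have uniq: "c = c'" if cc: "R p c" "R p c'" for p c c'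
  proof -
    obtain e P' Q' where 1: "p \<in> M" "homogeneous e P'" "homogeneous e Q'"
      "\<And>q. q \<in> M \<Longrightarrow> P (rep_cproj q) * Q' (rep_cproj q) = P' (rep_cproj q) * Q (rep_cproj q)"
      "Q' (rep_cproj p) \<noteq> 0" "c = P' (rep_cproj p) / Q' (rep_cproj p)"
      using cc(1) unfolding R_def by blast
    obtain e' P'' Q'' where 2: "homogeneous e' P''" "homogeneous e' Q''"
      "\<And>q. q \<in> M \<Longrightarrow> P (rep_cproj q) * Q'' (rep_cproj q) = P'' (rep_cproj q) * Q (rep_cproj q)"
      "Q'' (rep_cproj p) \<noteq> 0" "c' = P'' (rep_cproj p) / Q'' (rep_cproj p)"
      using cc(2) unfolding R_def by blast
    have "P' (rep_cproj p) * Q'' (rep_cproj p) = P'' (rep_cproj p) * Q' (rep_cproj p)"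
      by (rule fraction_equality_trans[OF f(3) 1(2,3) 2(1,2) _ 1(4) 2(3) 1(1)]) auto
    then show ?thesis unfolding 1(6) 2(5) using 1(5) 2(4) by (simp add: frac_eq_eq)
  qed
  define h where "h = (\<lambda>p. if \<exists>c. R p c then Some (THE c. R p c) else None)"
  have hR: "h p = Some c \<longleftrightarrow> R p c" for p c
  proof
    assume "h p = Some c"
    then obtain c' where "R p c'" "c = (THE c. R p c)" by (auto simp: h_def split: if_splits)
    moreover have "(THE c. R p c) = c'" by (rule the_equality[where P = "R p", OF \<open>R p c'\<close> uniq[OF _ \<open>R p c'\<close>]])
    ultimately show "R p c" by simp
  next
    assume c: "R p c"
    have "(THE c. R p c) = c" by (rule the_equality[where P = "R p", OF c uniq[OF _ c]])
    then show "h p = Some c" using c by (auto simp: h_def)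
  qed
  have "h \<in> rational_functions M"
    unfolding rational_functions_def using f(1,2,3) hR unfolding R_def nonvanishing_def by blast
  moreover have "\<forall>\<^sub>F p in generic. h p = Some (f p)"
    using f(4) generic_in_M by eventually_elim (unfold hR R_def, use f(1,2) in blast)
  ultimately show ?thesis using that by blast
qed

end

section \<open>Algebraic dependence of more than dim M rational functions\<close>

text \<open>The comparison of growth that makes the polynomial losses in the interpolation harmless.\<close>

lemma polynomial_times_geometric_small:
  fixes a m :: nat
  shows "\<exists>N0. \<forall>N\<ge>N0. 2 * real m * (real (a * N) + 1) ^ m * (1/2) ^ N < 1"
proof -
  have "filterlim (\<lambda>N. ln 2 * real N) at_top sequentially"
    by (rule filterlim_tendsto_pos_mult_at_top[OF tendsto_const _ filterlim_real_sequentially]) simp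
  then have lim: "(\<lambda>N. (ln 2 * real N) ^ m / exp (ln 2 * real N)) \<longlonglongrightarrow> 0"
    by (rule filterlim_compose[OF tendsto_power_div_exp_0])
  define C where "C = 2 * real m * ((real a + 1) / ln 2) ^ m"
  have "(\<lambda>N. C * ((ln 2 * real N) ^ m / exp (ln 2 * real N))) \<longlonglongrightarrow> 0"
    by (rule tendsto_mult_right_zero[OF lim])
  then have "\<forall>\<^sub>F N in sequentially. C * ((ln 2 * real N) ^ m / exp (ln 2 * real N)) < 1"
    by (rule order_tendstoD(2)) simp
  then have "\<forall>\<^sub>F N in sequentially. 2 * real m * (real (a * N) + 1) ^ m * (1/2) ^ N < 1"
    using eventually_ge_at_top[of 1]
  proof eventually_elim
    case (elim N)
    have "exp (ln 2 * real N) = 2 ^ N" by (simp add: exp_of_nat2_mult)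
    have "(real (a * N) + 1) ^ m \<le> ((real a + 1) * real N) ^ m"
      using elim by (intro power_mono) (auto simp: algebra_simps)
    also have "\<dots> = ((real a + 1) / ln 2) ^ m * (ln 2 * real N) ^ m"
      by (simp add: power_mult_distrib power_divide)
    finally have "2 * real m * (real (a * N) + 1) ^ m * (1/2) ^ N
        \<le> 2 * real m * (((real a + 1) / ln 2) ^ m * (ln 2 * real N) ^ m) * (1/2) ^ N"
      by (intro mult_right_mono mult_left_mono) auto
    also have "\<dots> = C * ((ln 2 * real N) ^ m / exp (ln 2 * real N))"
      unfolding \<open>exp (ln 2 * real N) = 2 ^ N\<close> by (simp add: C_def power_divide)
    finally show ?case using elim by linarith
  qed
  then show ?thesis by (simp add: eventually_sequentially)
qed

context projective_mfd
begin

text \<open>A parametrisation \<open>E\<close> of a neighbourhood of \<open>p\<close> in \<open>M\<close> by a polydisc of radius 3, in which the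
  points over \<open>W\<close> have parameters in the unit polydisc.  Parameters are functions on all indices, of
  which only the values on \<open>J\<close> are constrained.\<close>

definition polydisc_chart where
  "polydisc_chart p i E W b J \<longleftrightarrow> open W \<and> p \<in> W \<and> W \<subseteq> chart_dom i \<and> card J = m \<and> (b::real) \<ge> 1 \<and>
    (\<forall>t. (\<forall>k\<in>J. norm (t k) < 3) \<longrightarrow> E t \<in> affine_part i \<and> norm (E t) \<le> b) \<and>
    (\<forall>t k P d. homogeneous d P \<and> k \<in> J \<and> (\<forall>k\<in>J. norm (t k) < 3) \<longrightarrow> (\<lambda>z. P (E (t(k := z)))) holomorphic_on ball 0 3) \<and>
    (\<forall>q. q \<in> M \<and> q \<in> W \<longrightarrow> (\<exists>t :: 'n \<Rightarrow> complex. (\<forall>k\<in>J. norm (t k) \<le> 1) \<and> (\<forall>k. k \<notin> J \<longrightarrow> t k = 0) \<and> E t = chart i q))"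

lemma polydisc_chart_exists:
  assumes p: "p \<in> M"
  shows "\<exists>i E W b J. polydisc_chart p i E W b J"
proof -
  obtain i where i: "p \<in> chart_dom i" using ex_chart_dom by blast
  obtain U V \<Phi> \<Psi> and J :: "'n set" where lc: "local_chart i U V \<Phi> \<Psi> J" and U: "chart i p \<in> U"
    by (rule local_chart_exists[OF p i]) (rule that)
  note c = local_chartD[OF lc]
  define y0 where "y0 = \<Phi> (chart i p)"
  have y0J: "y0 $ k = 0" if "k \<notin> J" for k
    using c(10)[OF U] chart_in_affine_part[OF i] p that by (simp add: y0_def)
  obtain r where r: "r > 0" "cball y0 r \<subseteq> V"
    using c(2) c(5)[OF U] open_contains_cball unfolding y0_def by metis
  define \<rho> where "\<rho> = r / (3 * CARD('n))"
  have \<rho>: "\<rho> > 0" using r by (simp add: \<rho>_def)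
  define l where "l = (\<lambda>t :: 'n \<Rightarrow> complex. \<chi> k. if k \<in> J then y0 $ k + of_real \<rho> * t k else 0)"
  have lV: "l t \<in> cball y0 r" if t: "\<And>k. k \<in> J \<Longrightarrow> norm (t k) < 3" for t
  proof -
    have "norm (l t - y0) \<le> (\<Sum>k\<in>UNIV. norm ((l t - y0) $ k))" by (rule norm_le_sum_components)
    also have "\<dots> \<le> (\<Sum>k\<in>(UNIV :: 'n set). \<rho> * 3)"
    proof (rule sum_mono)
      fix k
      show "norm ((l t - y0) $ k) \<le> \<rho> * 3"
      proof (cases "k \<in> J")
        case True
        then show ?thesis using t[OF True] \<rho> by (simp add: l_def norm_mult)
      next
        case False
        then show ?thesis using y0J[OF False] \<rho> by (simp add: l_def)
      qed
    qed
    also have "\<dots> = r" by (simp add: \<rho>_def)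
    finally show ?thesis by (simp add: dist_norm norm_minus_commute)
  qed
  define E where "E = (\<lambda>t. \<Psi> (l t))"
  have "compact (\<Psi> ` cball y0 r)"
    by (intro compact_continuous_image continuous_on_subset[OF holomorphic_map_continuous_on[OF c(4)] r(2)]) auto
  then obtain b0 where b0: "\<And>y. y \<in> cball y0 r \<Longrightarrow> norm (\<Psi> y) \<le> b0"
    by (metis bounded_iff compact_imp_bounded imageI)
  define b where "b = max 1 b0"
  define A where "A = U \<inter> \<Phi> -` {y. \<forall>k. norm (y $ k - y0 $ k) < \<rho>}"
  have "open (\<Inter>k. {y. norm (y $ k - y0 $ k) < \<rho>})"
    by (intro open_INT ballI finite open_Collect_less continuous_intros)
  moreover have "(\<Inter>k. {y. norm (y $ k - y0 $ k) < \<rho>}) = {y. \<forall>k. norm (y $ k - y0 $ k) < \<rho>}" by auto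
  ultimately have "open {y. \<forall>k. norm (y $ k - y0 $ k) < \<rho>}" by simp
  then have "open A"
    unfolding A_def by (rule continuous_open_preimage[OF holomorphic_map_continuous_on[OF c(3)] c(1)])
  then have oW: "open (chart_dom i \<inter> chart i -` A)" by (rule open_chart_preimage)
  show ?thesis
    unfolding polydisc_chart_def
  proof (rule exI[of _ i], rule exI[of _ E], rule exI[of _ "chart_dom i \<inter> chart i -` A"],
      rule exI[of _ b], rule exI[of _ J], intro conjI allI impI)
    show "open (chart_dom i \<inter> chart i -` A)" by (rule oW)
    show "p \<in> chart_dom i \<inter> chart i -` A" using i U \<rho> by (simp add: A_def y0_def)
    show "card J = m" by (rule c(9))
    show "b \<ge> 1" by (simp add: b_def)
  next
    fix t :: "'n \<Rightarrow> complex" assume t: "\<forall>k\<in>J. norm (t k) < 3"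
    have "l t \<in> V" "norm (E t) \<le> b0" using lV[of t] t r(2) b0 by (auto simp: E_def)
    then show "E t \<in> affine_part i" "norm (E t) \<le> b"
      using c(11)[of "l t"] by (auto simp: E_def b_def l_def)
  next
    fix t :: "'n \<Rightarrow> complex" and k and P :: "complex ^ 'n \<Rightarrow> complex" and d assume *: "homogeneous d P \<and> k \<in> J \<and> (\<forall>k\<in>J. norm (t k) < 3)"
    define w where "w = l (t(k := 0))"
    have eq: "l (t(k := z)) = w + z *s axis k (of_real \<rho>)" for z
      using * by (simp add: w_def l_def vec_eq_iff axis_def)
    have P: "holomorphic_mv P UNIV" using * homogeneous_holomorphic[of d P UNIV] by simp
    show "(\<lambda>z. P (E (t(k := z)))) holomorphic_on ball 0 3"
      unfolding E_def eq
    proof (rule holomorphic_mv_on_line[OF holomorphic_mv_compose[OF P c(4) subset_UNIV]])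
      have "l (t(k := z)) \<in> V" if "z \<in> ball 0 3" for z
        using lV[of "t(k := z)"] * r(2) that by auto
      then show "(\<lambda>z. w + z *s axis k (of_real \<rho>)) ` ball 0 3 \<subseteq> V"
        unfolding eq[symmetric] by blast
    qed
  next
    fix q assume q: "q \<in> M \<and> q \<in> chart_dom i \<inter> chart i -` A"
    define y where "y = \<Phi> (chart i q)"
    have yJ: "y $ k = 0" if "k \<notin> J" for k
      using q c(10)[of "chart i q"] chart_in_affine_part that by (auto simp: y_def A_def)
    define t where "t = (\<lambda>k. if k \<in> J then (y $ k - y0 $ k) / of_real \<rho> else 0)"
    have "l t = y" using \<rho> yJ by (auto simp: l_def t_def vec_eq_iff)
    then have "E t = chart i q" using c(7) q by (auto simp: E_def y_def A_def)
    moreover have "norm (t k) \<le> 1" if "k \<in> J" for k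
    proof -
      have "norm (y $ k - y0 $ k) < \<rho>" using q by (simp add: A_def y_def)
      then show ?thesis using \<rho> that by (simp add: t_def norm_divide field_simps)
    qed
    ultimately show "\<exists>t. (\<forall>k\<in>J. norm (t k) \<le> 1) \<and> (\<forall>k. k \<notin> J \<longrightarrow> t k = 0) \<and> E t = chart i q"
      by (intro exI[of _ t]) (auto simp: t_def)
  qed auto
qed

text \<open>The norm of \<open>F\<close> as a section of the line bundle \<open>\<O>(N)\<close>: unlike \<open>|F|\<close> it does not depend on
  the homogeneous coordinates.\<close>

definition form_size :: "nat \<Rightarrow> (complex ^ 'n \<Rightarrow> complex) \<Rightarrow> 'n cproj \<Rightarrow> real" where
  "form_size N F p = norm (F (rep_cproj p)) / norm (rep_cproj p) ^ N"

lemma form_size_chart: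
  assumes "homogeneous N F" "p \<in> chart_dom i"
  shows "form_size N F p = norm (F (chart i p)) / norm (chart i p) ^ N"
proof -
  have "rep_cproj p $ i \<noteq> 0" using assms(2) by (simp add: chart_dom_def)
  then show ?thesis
    unfolding form_size_def
    by (subst (1 2) rep_eq_chart[OF assms(2)])
      (simp add: homogeneous_smult[OF assms(1)] norm_vector_smult norm_mult norm_power power_mult_distrib)
qed

lemma continuous_form_size:
  assumes "homogeneous N F"
  shows "continuous_on UNIV (form_size N F)"
proof -
  have "continuous_on (chart_dom i) (form_size N F)" for i
  proof -
    have "continuous_on (chart_dom i) (\<lambda>p. norm (F (chart i p)) / norm (chart i p) ^ N)"
      by (intro continuous_intros continuous_on_compose2[OF homogeneous_continuous[OF assms, of UNIV]] continuous_on_chart)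
        (auto simp: chart_nonzero)
    then show ?thesis
      by (rule continuous_on_eq) (simp add: form_size_chart[OF assms])
  qed
  then have "continuous_on (\<Union>i\<in>UNIV. chart_dom i) (form_size N F)"
    by (intro continuous_on_open_UN) (auto intro: open_chart_dom)
  moreover have "(\<Union>i\<in>UNIV. chart_dom i) = (UNIV :: 'n cproj set)" using ex_chart_dom by auto
  ultimately show ?thesis by simp
qed

lemma compact_M: "compact M"
  using compact_Int_closed[OF compact_UNIV_cproj closed] by simp

text \<open>Cover \<open>M\<close> by finitely many polydiscs and let \<open>F\<close> vanish at the points whose parameters are
  \<open>k\<close>-th roots of unity, where \<open>k = a * N\<close>.  If the size of \<open>F\<close> attains its maximum \<open>S\<close> at \<open>p\<^sub>0\<close>, then on
  the polydisc around \<open>p\<^sub>0\<close> the function \<open>F\<close> is bounded by \<open>S * b ^ N\<close>, where \<open>b\<close> bounds the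
  coordinates, so interpolation yields \<open>S \<le> poly(k) * (b / 2 ^ a) ^ N * S\<close>.  With \<open>a\<close> large this
  forces \<open>S = 0\<close>.  The number of conditions is of order \<open>N\<^sup>m\<close>.\<close>

lemma finite_determination_of_forms:
  "\<exists>s a N0. \<forall>N\<ge>N0. \<exists>Z. finite Z \<and> card Z \<le> s * (a * N) ^ m \<and>
     (\<forall>N' F. N' \<le> N \<longrightarrow> homogeneous N' F \<longrightarrow> (\<forall>z\<in>Z. F (rep_cproj z) = 0) \<longrightarrow> (\<forall>p\<in>M. F (rep_cproj p) = 0))"
proof -
  obtain i E W b J where D: "\<And>p. p \<in> M \<Longrightarrow> polydisc_chart p (i p) (E p) (W p) (b p) (J p)"
    using polydisc_chart_exists by metis
  obtain I where I: "I \<subseteq> M" "finite I" "M \<subseteq> (\<Union>p\<in>I. W p)"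
  proof (rule compactE_image[OF compact_M, of M W])
    show "open (W p)" if "p \<in> M" for p using D[OF that] by (simp add: polydisc_chart_def)
    show "M \<subseteq> (\<Union>p\<in>M. W p)" using D by (auto simp: polydisc_chart_def)
  qed (use that in blast)
  define b' where "b' = 1 + sum b I"
  have b: "b p \<le> b'" if "p \<in> I" for p
  proof -
    have "0 \<le> b q" if "q \<in> I" for q using D[of q] I(1) that by (auto simp: polydisc_chart_def)
    then have "b p \<le> sum b I" using I(2) that by (intro member_le_sum) auto
    then show ?thesis by (simp add: b'_def)
  qed
  have b'1: "b' \<ge> 1" using D I(1) unfolding b'_def polydisc_chart_def by (smt (verit, ccfv_threshold) subset_iff sum_nonneg)
  \<comment> \<open>Then \<open>(b' / 2 ^ a) ^ N \<le> (1/2) ^ N\<close>.\<close>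
  obtain a where a: "2 * b' < 2 ^ a" using real_arch_pow[of 2 "2 * b'"] by auto
  obtain N0 where N0: "\<And>N. N \<ge> N0 \<Longrightarrow> 2 * real m * (real (a * N) + 1) ^ m * (1/2) ^ N < 1"
    using polynomial_times_geometric_small by blast
  have a1: "a \<ge> 1" using a b'1 by (cases a) auto
  show ?thesis
  proof (rule exI[of _ "card I"], rule exI[of _ a], rule exI[of _ "Suc N0"], intro allI impI)
    \<comment> \<open>\<open>Suc\<close> excludes \<open>N = 0\<close>, for which there would be no roots of unity of order \<open>k\<close>.\<close>
    fix N assume N: "N \<ge> Suc N0"
    define k where "k = a * N"
    have k1: "k \<ge> 1" using a1 N by (simp add: k_def)
    define R where "R = {z :: complex. z ^ k = 1}"
    have R: "finite R" "card R \<le> k" unfolding R_def using card_roots_unity[OF k1] finite_roots_unity[OF k1] by auto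
    define nodes where "nodes = (\<lambda>J. (\<lambda>g (b :: 'n). if b \<in> J then g b else 0) ` (PiE J (\<lambda>_. R)))"
    have nodes: "finite (nodes J) \<and> card (nodes J) \<le> k ^ card J" for J
    proof -
      have f: "finite (PiE J (\<lambda>_. R))" using R by (intro finite_PiE) auto
      have "card (nodes J) \<le> card (PiE J (\<lambda>_. R))" unfolding nodes_def by (rule card_image_le[OF f])
      also have "\<dots> = card R ^ card J" by (simp add: card_PiE)
      also have "\<dots> \<le> k ^ card J" using R by (intro power_mono) auto
      finally show ?thesis using f by (simp add: nodes_def)
    qed
    have nodesI: "t \<in> nodes J" if "\<And>b. b \<in> J \<Longrightarrow> t b ^ k = 1" "\<And>b. b \<notin> J \<Longrightarrow> t b = 0" for t J
    proof -
      have "t = (\<lambda>b. if b \<in> J then restrict t J b else 0)" using that by auto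
      moreover have "restrict t J \<in> PiE J (\<lambda>_. R)" using that by (auto simp: R_def)
      ultimately show ?thesis unfolding nodes_def by blast
    qed
    define Z where "Z = (\<Union>p\<in>I. (\<lambda>t. abs_cproj (E p t)) ` nodes (J p))"
    have "finite Z" using I(2) nodes by (simp add: Z_def)
    moreover have "card Z \<le> card I * k ^ m"
    proof -
      have "card Z \<le> (\<Sum>p\<in>I. card ((\<lambda>t. abs_cproj (E p t)) ` nodes (J p)))"
        unfolding Z_def by (rule card_UN_le[OF I(2)])
      also have "\<dots> \<le> (\<Sum>p\<in>I. k ^ m)"
      proof (rule sum_mono)
        fix p assume "p \<in> I"
        then have "card (J p) = m" using D I(1) by (auto simp: polydisc_chart_def)
        then show "card ((\<lambda>t. abs_cproj (E p t)) ` nodes (J p)) \<le> k ^ m"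
          using nodes[of "J p"] card_image_le order_trans by metis
      qed
      finally show ?thesis by simp
    qed
    moreover have "\<forall>p\<in>M. F (rep_cproj p) = 0"
      if F: "N' \<le> N" "homogeneous N' F" "\<forall>z\<in>Z. F (rep_cproj z) = 0" for N' F
    proof -
      obtain p0 where p0: "p0 \<in> M" "\<And>p. p \<in> M \<Longrightarrow> form_size N' F p \<le> form_size N' F p0"
        using continuous_attains_sup[OF compact_M nonempty continuous_on_subset[OF continuous_form_size[OF F(2)] subset_UNIV]] by blast
      define S where "S = form_size N' F p0"
      have S0: "S \<ge> 0" by (simp add: S_def form_size_def)
      obtain p where p: "p \<in> I" "p0 \<in> W p" using I(3) p0(1) by blast
      then have pM: "p \<in> M" using I(1) by auto
      have d: "W p \<subseteq> chart_dom (i p)" "card (J p) = m"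
         "\<And>t. \<forall>k\<in>J p. norm (t k) < 3 \<Longrightarrow> E p t \<in> affine_part (i p) \<and> norm (E p t) \<le> b p"
         "\<And>t k P d. homogeneous d P \<Longrightarrow> k \<in> J p \<Longrightarrow> \<forall>k\<in>J p. norm (t k) < 3 \<Longrightarrow> (\<lambda>z. P (E p (t(k := z)))) holomorphic_on ball 0 3"
         "\<And>q. q \<in> M \<Longrightarrow> q \<in> W p \<Longrightarrow> \<exists>t. (\<forall>k\<in>J p. norm (t k) \<le> 1) \<and> (\<forall>k. k \<notin> J p \<longrightarrow> t k = 0) \<and> E p t = chart (i p) q"
        using D[OF pM] unfolding polydisc_chart_def by blast+
      obtain t where t: "\<forall>k\<in>J p. norm (t k) \<le> 1" "\<forall>k. k \<notin> J p \<longrightarrow> t k = 0" "E p t = chart (i p) p0"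
        using d(5)[OF p0(1) p(2)] by blast
      \<comment> \<open>One of the affine coordinates is 1.\<close>
      have norm1: "norm (chart (i p) q) \<ge> 1" if "q \<in> chart_dom (i p)" for q
        using that Finite_Cartesian_Product.norm_nth_le[of "chart (i p) q" "i p"] by simp
      define G where "G = (\<lambda>t. F (E p t))"
      have Gt: "norm (G t) \<le> 2 * card (J p) * (k + 1) ^ card (J p) * (S * b' ^ N) / 2 ^ k"
      proof (rule polydisc_bound_by_roots_of_unity[where G = G and t = t and S = "S * b' ^ N", OF k1])
        show "finite (J p)" by simp
        show "(\<lambda>z. G (t(b := z))) holomorphic_on ball 0 3" if "b \<in> J p" "\<And>b. b \<in> J p \<Longrightarrow> norm (t b) < 3" for t b
          unfolding G_def using d(4)[OF F(2)] that by blast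
        show "norm (G t) \<le> S * b' ^ N" if "\<And>b. b \<in> J p \<Longrightarrow> norm (t b) < 3" for t
        proof -
          have E: "E p t \<in> affine_part (i p)" "norm (E p t) \<le> b p" using d(3) that by blast+
          define q where "q = abs_cproj (E p t)"
          have q: "q \<in> M" "q \<in> chart_dom (i p)" "chart (i p) q = E p t"
            using affine_partD[OF E(1)] by (auto simp: q_def)
          have "norm (G t) = form_size N' F q * norm (E p t) ^ N'"
            using form_size_chart[OF F(2) q(2)] chart_nonzero[OF q(2)] q(3) by (simp add: G_def)
          also have "\<dots> \<le> S * b' ^ N'"
            using p0(2)[OF q(1)] S0 E(2) b[OF p(1)] unfolding S_def by (intro mult_mono power_mono) auto
          also have "\<dots> \<le> S * b' ^ N"
            using S0 b'1 F(1) by (intro mult_left_mono power_increasing) auto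
          finally show ?thesis .
        qed
        show "G t = 0" if "\<And>b. b \<in> J p \<Longrightarrow> t b ^ k = 1" "\<And>b. b \<notin> J p \<Longrightarrow> t b = 0" for t
        proof -
          have "t \<in> nodes (J p)" using nodesI that by blast
          then have "abs_cproj (E p t) \<in> Z" using p(1) by (auto simp: Z_def)
          then have z: "F (rep_cproj (abs_cproj (E p t))) = 0" using F(3) by blast
          have "norm (t b) = 1" if "b \<in> J p" for b using norm_root_of_unity[OF _ k1] \<open>b \<in> J p \<Longrightarrow> t b ^ k = 1\<close> that by blast
          then have "E p t \<in> affine_part (i p)" using d(3)[of t] by simp
          then have "E p t \<noteq> 0" using affine_partD by fastforce
          then show ?thesis using homogeneous_rep_abs_zero_iff[OF F(2)] z by (simp add: G_def)
        qed
      qed (use t in auto)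
      have q: "p0 \<in> chart_dom (i p)" using p d(1) by blast
      have "S \<le> norm (G t)"
      proof -
        have "norm (chart (i p) p0) ^ N' \<ge> 1" using norm1[OF q] by simp
        then have "S * 1 \<le> S * norm (chart (i p) p0) ^ N'" using S0 by (intro mult_left_mono)
        also have "\<dots> = norm (G t)"
          using form_size_chart[OF F(2) q] chart_nonzero[OF q] t(3) by (simp add: G_def S_def)
        finally show ?thesis by simp
      qed
      also have "\<dots> \<le> S * (2 * real m * (real k + 1) ^ m * (b' ^ N / 2 ^ k))"
        using Gt d(2) by (simp add: field_simps)
      also have "\<dots> \<le> S * (2 * real m * (real k + 1) ^ m * (1/2) ^ N)"
      proof -
        have "b' ^ N / 2 ^ k = (b' / 2 ^ a) ^ N" by (simp add: k_def power_mult power_divide)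
        also have "\<dots> \<le> (1/2) ^ N" using a b'1 by (intro power_mono) (auto simp: field_simps)
        finally show ?thesis using S0 by (intro mult_left_mono) auto
      qed
      finally have "S * (1 - 2 * real m * (real k + 1) ^ m * (1/2) ^ N) \<le> 0" by (simp add: algebra_simps)
      then have "S \<le> 0" using N0[of N] N unfolding k_def by (simp add: mult_le_0_iff)
      then have "form_size N' F q \<le> 0" if "q \<in> M" for q using p0(2)[OF that] by (simp add: S_def)
      moreover have "F (rep_cproj q) = 0" if "form_size N' F q \<le> 0" for q
      proof -
        have pos: "norm (rep_cproj q) ^ N' > 0" by simp
        have "norm (F (rep_cproj q)) \<le> 0 * norm (rep_cproj q) ^ N'"
          using that unfolding form_size_def pos_divide_le_eq[OF pos] .
        then show ?thesis by simp
      qed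
      ultimately show ?thesis by blast
    qed
    ultimately show "\<exists>Z. finite Z \<and> card Z \<le> card I * (a * N) ^ m \<and>
     (\<forall>N' F. N' \<le> N \<longrightarrow> homogeneous N' F \<longrightarrow> (\<forall>z\<in>Z. F (rep_cproj z) = 0) \<longrightarrow> (\<forall>p\<in>M. F (rep_cproj p) = 0))"
      unfolding k_def by blast
  qed
qed

lemma common_denominator:
  assumes "finite A" "\<And>j. j \<in> A \<Longrightarrow> rational (u j)"
  obtains d P Q where "homogeneous d Q" "nonvanishing Q" "\<And>j. j \<in> A \<Longrightarrow> homogeneous d (P j)"
    "\<forall>\<^sub>F p in generic. \<forall>j\<in>A. u j p = P j (rep_cproj p) / Q (rep_cproj p)"
proof -
  have "\<exists>d P Q. homogeneous d Q \<and> nonvanishing Q \<and> (\<forall>j\<in>A. homogeneous d (P j)) \<and>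
    (\<forall>\<^sub>F p in generic. \<forall>j\<in>A. u j p = P j (rep_cproj p) / Q (rep_cproj p))"
    using assms
  proof (induction A rule: finite_induct)
    case empty
    show ?case by (rule exI[of _ 0], rule exI, rule exI[of _ "\<lambda>_. 1"]) (auto simp: homogeneous_const nonvanishing_one)
  next
    case (insert j A)
    then obtain d P Q where 1: "homogeneous d Q" "nonvanishing Q" "\<forall>j\<in>A. homogeneous d (P j)"
      "\<forall>\<^sub>F p in generic. \<forall>j\<in>A. u j p = P j (rep_cproj p) / Q (rep_cproj p)"
      by auto
    obtain e R S where 2: "homogeneous e R" "homogeneous e S" "nonvanishing S"
      "\<forall>\<^sub>F p in generic. S (rep_cproj p) \<noteq> 0 \<and> u j p = R (rep_cproj p) / S (rep_cproj p)"
      by (rule rationalE[OF insert.prems[of j]]) (auto intro: that)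
    define P' where "P' = (\<lambda>l x. if l = j then Q x * R x else P l x * S x)"
    have "homogeneous (d + e) (P' l)" if "l \<in> insert j A" for l
    proof (cases "l = j")
      case True
      then show ?thesis unfolding P'_def using homogeneous_mult[OF 1(1) 2(1)] by simp
    next
      case False
      then show ?thesis unfolding P'_def using homogeneous_mult[OF bspec[OF 1(3)] 2(2)] that by simp
    qed
    moreover have "\<forall>\<^sub>F p in generic. \<forall>l\<in>insert j A. u l p = P' l (rep_cproj p) / (Q (rep_cproj p) * S (rep_cproj p))"
      using 1(4) 2(4) generic_nonzero[OF 1(2)]
      by eventually_elim (use insert.hyps(2) in \<open>auto simp: P'_def\<close>)
    ultimately show ?case
      using homogeneous_mult[OF 1(1) 2(2)] nonvanishing_mult[OF 1(2) 2(3)]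
      by (intro exI[of _ "d + e"] exI[of _ P'] exI[of _ "\<lambda>x. Q x * S x"]) auto
  qed
  then show ?thesis using that by blast
qed

text \<open>Bring the functions to a common denominator \<open>Q\<close> of degree \<open>d\<close>.  Monomials in them of degree
  at most \<open>e\<close> in each function become forms of degree \<open>d * e * (m + 1)\<close>; there are
  \<open>(e + 1) ^ (m + 1)\<close> of them, more than the conditions that force a form of this degree to vanish on \<open>M\<close>.\<close>

theorem algebraic_dependence:
  assumes u: "\<And>j. j < Suc m \<Longrightarrow> rational (u j)"
  obtains e c where "\<exists>\<alpha>\<in>PiE {..<Suc m} (\<lambda>_. {..e}). c \<alpha> \<noteq> 0"
    "\<forall>\<^sub>F p in generic. (\<Sum>\<alpha>\<in>PiE {..<Suc m} (\<lambda>_. {..e}). c \<alpha> * (\<Prod>j<Suc m. u j p ^ \<alpha> j)) = 0"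
proof -
  obtain d P Q where Q: "homogeneous d Q" "nonvanishing Q" and P: "\<And>j. j \<in> {..<Suc m} \<Longrightarrow> homogeneous d (P j)"
    and uP: "\<forall>\<^sub>F p in generic. \<forall>j\<in>{..<Suc m}. u j p = P j (rep_cproj p) / Q (rep_cproj p)"
    by (rule common_denominator[of "{..<Suc m}" u]) (use u that in auto)
  obtain s a N0 where Z: "\<And>N. N \<ge> N0 \<Longrightarrow> \<exists>Z. finite Z \<and> card Z \<le> s * (a * N) ^ m \<and>
     (\<forall>N' F. N' \<le> N \<longrightarrow> homogeneous N' F \<longrightarrow> (\<forall>z\<in>Z. F (rep_cproj z) = 0) \<longrightarrow> (\<forall>p\<in>M. F (rep_cproj p) = 0))"
    using finite_determination_of_forms by blast
  define K where "K = s * (a * (Suc m * Suc d)) ^ m"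
  \<comment> \<open>\<open>K * e ^ m\<close> bounds the number of conditions.\<close>
  define e where "e = max K N0"
  define N where "N = Suc m * Suc d * e"
  define N' where "N' = (\<Sum>j<Suc m. d * e)"
  have "N' = Suc m * (d * e)" by (simp add: N'_def)
  also have "\<dots> \<le> Suc m * (Suc d * e)" by (intro mult_le_mono) auto
  finally have NN: "N' \<le> N" unfolding N_def by (simp only: mult.assoc)
  have NN0: "N0 \<le> N" by (simp add: N_def e_def)
  obtain Z0 where Z0: "finite Z0" "card Z0 \<le> s * (a * N) ^ m"
    "\<And>N' F. N' \<le> N \<Longrightarrow> homogeneous N' F \<Longrightarrow> (\<forall>z\<in>Z0. F (rep_cproj z) = 0) \<Longrightarrow> (\<forall>p\<in>M. F (rep_cproj p) = 0)"
    using Z[OF NN0] by blast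
  define I where "I = PiE {..<Suc m} (\<lambda>_. {..e})"
  have fI: "finite I" by (simp add: I_def finite_PiE)
  define F where "F = (\<lambda>\<alpha> x. \<Prod>j<Suc m. P j x ^ \<alpha> j * Q x ^ (e - \<alpha> j))"
  have F: "homogeneous N' (F \<alpha>)" if "\<alpha> \<in> I" for \<alpha>
    unfolding F_def N'_def
  proof (rule homogeneous_prod)
    fix j assume j: "j \<in> {..<Suc m}"
    then have "\<alpha> j \<le> e" using that by (auto simp: I_def)
    then have "d * \<alpha> j + d * (e - \<alpha> j) = d * e" by (simp flip: distrib_left)
    then show "homogeneous (d * e) (\<lambda>x. P j x ^ \<alpha> j * Q x ^ (e - \<alpha> j))"
      using homogeneous_mult[OF homogeneous_power[OF P[OF j], of "\<alpha> j"] homogeneous_power[OF Q(1), of "e - \<alpha> j"]] by simp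
  qed simp
  have "card Z0 < card I"
  proof -
    have "a * N = a * (Suc m * Suc d) * e" by (simp only: N_def mult.assoc)
    then have "(a * N) ^ m = (a * (Suc m * Suc d)) ^ m * e ^ m" by (simp only: power_mult_distrib)
    then have "card Z0 \<le> K * e ^ m" using Z0(2) by (simp only: K_def mult.assoc)
    also have "\<dots> \<le> e * e ^ m" by (intro mult_right_mono) (auto simp: e_def)
    also have "\<dots> < Suc e ^ Suc m" using power_strict_mono[of e "Suc e" "Suc m"] by simp
    also have "\<dots> = card I" by (simp add: I_def card_PiE)
    finally show ?thesis .
  qed
  then obtain c where c: "\<exists>\<alpha>\<in>I. c \<alpha> \<noteq> 0" "\<forall>z\<in>Z0. (\<Sum>\<alpha>\<in>I. F \<alpha> (rep_cproj z) * c \<alpha>) = 0"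
    using homogeneous_linear_system_nontrivial_solution[OF Z0(1) fI, of "\<lambda>z \<alpha>. F \<alpha> (rep_cproj z)"] by blast
  have "homogeneous N' (\<lambda>x. \<Sum>\<alpha>\<in>I. c \<alpha> * F \<alpha> x)"
    by (intro homogeneous_sum homogeneous_cmult F)
  then have van: "\<forall>p\<in>M. (\<Sum>\<alpha>\<in>I. c \<alpha> * F \<alpha> (rep_cproj p)) = 0"
    using Z0(3)[OF NN] c(2) by (simp add: mult.commute)
  have "\<forall>\<^sub>F p in generic. (\<Sum>\<alpha>\<in>I. c \<alpha> * (\<Prod>j<Suc m. u j p ^ \<alpha> j)) = 0"
    using uP generic_in_M generic_nonzero[OF Q(2)]
  proof eventually_elim
    case (elim p)
    define x where "x = rep_cproj p"
    have "(\<Prod>j<Suc m. u j p ^ \<alpha> j) = F \<alpha> x / (Q x ^ e) ^ Suc m" if "\<alpha> \<in> I" for \<alpha>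
    proof -
      have "F \<alpha> x = (\<Prod>j<Suc m. u j p ^ \<alpha> j * Q x ^ e)"
        unfolding F_def
      proof (rule prod.cong[OF refl])
        fix j assume j: "j \<in> {..<Suc m}"
        then have "\<alpha> j \<le> e" using that by (auto simp: I_def)
        then have "Q x ^ e = Q x ^ \<alpha> j * Q x ^ (e - \<alpha> j)" by (simp flip: power_add)
        then show "P j x ^ \<alpha> j * Q x ^ (e - \<alpha> j) = u j p ^ \<alpha> j * Q x ^ e"
          using elim j by (simp add: x_def power_divide)
      qed
      also have "\<dots> = (\<Prod>j<Suc m. u j p ^ \<alpha> j) * (Q x ^ e) ^ Suc m"
        by (simp only: prod.distrib prod_constant card_lessThan)
      finally show ?thesis using elim by (simp add: x_def)
    qed
    then have "(\<Sum>\<alpha>\<in>I. c \<alpha> * (\<Prod>j<Suc m. u j p ^ \<alpha> j)) = (\<Sum>\<alpha>\<in>I. c \<alpha> * F \<alpha> x) / (Q x ^ e) ^ Suc m"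
      by (simp add: sum_divide_distrib)
    then show ?case using van elim by (simp add: x_def)
  qed
  then show ?thesis using that c(1) unfolding I_def by blast
qed

end

section \<open>Tangential derivatives\<close>

lemma velocity_tendsto:
  assumes "velocity \<gamma> t w" "open N" "\<gamma> t \<in> N"
  shows "\<forall>\<^sub>F s in nhds t. \<gamma> s \<in> N"
proof -
  obtain i where i: "\<gamma> t \<in> chart_dom i" using ex_chart_dom by blast
  note d = velocity_chart[OF assms(1) i]
  have "open {x. x \<noteq> 0 \<and> abs_cproj x \<in> N}" using assms(2) by (simp add: open_cproj_iff)
  moreover have "((\<lambda>s. chart i (\<gamma> s)) \<longlongrightarrow> chart i (\<gamma> t)) (nhds t)"
    using has_derivative_continuous[OF d] by (simp add: isCont_def tendsto_nhds_iff)
  ultimately have "\<forall>\<^sub>F s in nhds t. chart i (\<gamma> s) \<in> {x. x \<noteq> 0 \<and> abs_cproj x \<in> N}"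
    using i assms(3) chart_nonzero by (intro topological_tendstoD) auto
  moreover have "\<forall>\<^sub>F s in nhds t. \<gamma> s \<in> chart_dom i"
    using eventually_in_chart_dom[OF d i, of i] i by (simp add: eventually_conj_iff)
  ultimately show ?thesis by eventually_elim auto
qed

context projective_mfd
begin

text \<open>The derivative of \<open>f\<close> in the direction \<open>w\<close>, required along all curves in \<open>M\<close> with that
  velocity.  Quantifying over curves makes the rules of calculus immediate; for rational \<open>f\<close> such a
  derivative exists at generic points.\<close>

definition has_tderiv :: "('n cproj \<Rightarrow> complex) \<Rightarrow> 'n cproj \<Rightarrow> 'n tvec \<Rightarrow> complex \<Rightarrow> bool" where
  "has_tderiv f p w c \<longleftrightarrow> (\<forall>\<gamma> t. \<gamma> t = p \<and> velocity \<gamma> t w \<and> (\<forall>\<^sub>F s in nhds t. \<gamma> s \<in> M) \<longrightarrow>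
     ((\<lambda>s. f (\<gamma> s)) has_field_derivative c) (at t))"

lemma has_tderiv_unique:
  "w \<in> tangent_space M p \<Longrightarrow> has_tderiv f p w c \<Longrightarrow> has_tderiv f p w c' \<Longrightarrow> c = c'"
  by (elim tangent_spaceD) (metis DERIV_unique has_tderiv_def)

lemma has_tderiv_const: "has_tderiv (\<lambda>q. a) p w 0"
  by (simp add: has_tderiv_def)

lemma has_tderiv_add: "has_tderiv f p w a \<Longrightarrow> has_tderiv g p w b \<Longrightarrow> has_tderiv (\<lambda>q. f q + g q) p w (a + b)"
  by (simp add: has_tderiv_def DERIV_add)

lemma has_tderiv_mult:
  "has_tderiv f p w a \<Longrightarrow> has_tderiv g p w b \<Longrightarrow> has_tderiv (\<lambda>q. f q * g q) p w (a * g p + b * f p)"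
  unfolding has_tderiv_def
proof (intro allI impI)
  fix \<gamma> t
  assume f: "\<forall>\<gamma> t. \<gamma> t = p \<and> velocity \<gamma> t w \<and> (\<forall>\<^sub>F s in nhds t. \<gamma> s \<in> M) \<longrightarrow> ((\<lambda>s. f (\<gamma> s)) has_field_derivative a) (at t)"
    and g: "\<forall>\<gamma> t. \<gamma> t = p \<and> velocity \<gamma> t w \<and> (\<forall>\<^sub>F s in nhds t. \<gamma> s \<in> M) \<longrightarrow> ((\<lambda>s. g (\<gamma> s)) has_field_derivative b) (at t)"
    and \<gamma>: "\<gamma> t = p \<and> velocity \<gamma> t w \<and> (\<forall>\<^sub>F s in nhds t. \<gamma> s \<in> M)"
  show "((\<lambda>s. f (\<gamma> s) * g (\<gamma> s)) has_field_derivative a * g p + b * f p) (at t)"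
    using DERIV_mult[OF f[rule_format, OF \<gamma>] g[rule_format, OF \<gamma>]] \<gamma> by simp
qed

lemma has_tderiv_sum:
  "(\<And>a. a \<in> A \<Longrightarrow> has_tderiv (f a) p w (c a)) \<Longrightarrow> has_tderiv (\<lambda>q. \<Sum>a\<in>A. f a q) p w (\<Sum>a\<in>A. c a)"
  by (induction A rule: infinite_finite_induct) (auto intro: has_tderiv_const has_tderiv_add)

lemma has_tderiv_power:
  assumes "has_tderiv f p w c"
  shows "has_tderiv (\<lambda>q. f q ^ k) p w (of_nat k * f p ^ (k - 1) * c)"
proof (induction k)
  case (Suc k)
  have "has_tderiv (\<lambda>q. f q * f q ^ k) p w (c * f p ^ k + (of_nat k * f p ^ (k - 1) * c) * f p)"
    by (rule has_tderiv_mult[OF assms Suc])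
  moreover have "c * f p ^ k + (of_nat k * f p ^ (k - 1) * c) * f p = of_nat (Suc k) * f p ^ (Suc k - 1) * c"
    by (cases k) (auto simp: algebra_simps)
  ultimately show ?case by simp
qed (simp add: has_tderiv_const)

lemma has_tderiv_cong_local:
  assumes "open N" "p \<in> N" "\<And>q. q \<in> M \<Longrightarrow> q \<in> N \<Longrightarrow> f q = g q" "has_tderiv f p w c"
  shows "has_tderiv g p w c"
  unfolding has_tderiv_def
proof (intro allI impI)
  fix \<gamma> t assume g: "\<gamma> t = p \<and> velocity \<gamma> t w \<and> (\<forall>\<^sub>F s in nhds t. \<gamma> s \<in> M)"
  then have "((\<lambda>s. f (\<gamma> s)) has_field_derivative c) (at t)" using assms(4) by (simp add: has_tderiv_def)
  moreover have "\<forall>\<^sub>F s in nhds t. \<gamma> s \<in> N"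
    using velocity_tendsto[of \<gamma> t w N] g assms(1,2) by blast
  with conjunct2[OF conjunct2[OF g]] have "\<forall>\<^sub>F s in nhds t. f (\<gamma> s) = g (\<gamma> s)"
    by eventually_elim (rule assms(3))
  ultimately show "((\<lambda>s. g (\<gamma> s)) has_field_derivative c) (at t)"
    by (subst (asm) DERIV_cong_ev[OF refl _ refl]) auto
qed

lemma has_tderiv_cong_generic:
  assumes "\<forall>\<^sub>F p in generic. f p = g p"
  shows "\<forall>\<^sub>F p in generic. \<forall>w c. has_tderiv f p w c \<longleftrightarrow> has_tderiv g p w c"
  using generic_open[OF assms] 
proof eventually_elim
  case (elim p)
  then obtain N where N: "open N" "p \<in> N" "\<And>q. q \<in> M \<Longrightarrow> q \<in> N \<Longrightarrow> f q = g q" by blast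
  show ?case
    using has_tderiv_cong_local[of N p f g] has_tderiv_cong_local[of N p g f] N by auto
qed

lemma has_tderiv_form_quotient:
  assumes P: "homogeneous d P" and Q: "homogeneous d Q" "Q (rep_cproj p) \<noteq> 0" and i: "p \<in> chart_dom i"
  shows "has_tderiv (\<lambda>q. P (rep_cproj q) / Q (rep_cproj q)) p w (mvd (\<lambda>x. P x / Q x) (chart i p) (w $ i))"
  unfolding has_tderiv_def
proof (intro allI impI)
  fix \<gamma> t assume g: "\<gamma> t = p \<and> velocity \<gamma> t w \<and> (\<forall>\<^sub>F s in nhds t. \<gamma> s \<in> M)"
  then have d: "((\<lambda>s. chart i (\<gamma> s)) has_derivative (\<lambda>h. h *s (w $ i))) (at t)"
    using velocity_chart i by blast
  have o: "open {x. Q x \<noteq> 0}" using homogeneous_continuous[OF Q(1)] by (intro open_Collect_neq) auto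
  have hol: "holomorphic_mv (\<lambda>x. P x / Q x) {x. Q x \<noteq> 0}"
    by (rule holomorphic_mv_divide[OF homogeneous_holomorphic[OF P o] homogeneous_holomorphic[OF Q(1) o]]) simp
  have "((\<lambda>s. P (chart i (\<gamma> s)) / Q (chart i (\<gamma> s))) has_field_derivative
      mvd (\<lambda>x. P x / Q x) (chart i (\<gamma> t)) (w $ i)) (at t)"
    by (rule holomorphic_mv_along_curve[OF hol d]) (use g i Q homogeneous_chart_zero_iff[OF Q(1) i] in auto)
  moreover have "\<forall>\<^sub>F s in nhds t. \<gamma> s \<in> chart_dom i"
    using velocity_tendsto[of \<gamma> t w "chart_dom i"] g i open_chart_dom by auto
  then have "\<forall>\<^sub>F s in nhds t. P (chart i (\<gamma> s)) / Q (chart i (\<gamma> s)) = P (rep_cproj (\<gamma> s)) / Q (rep_cproj (\<gamma> s))"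
    by eventually_elim (simp add: homogeneous_chart_quotient[OF P Q(1)])
  ultimately show "((\<lambda>s. P (rep_cproj (\<gamma> s)) / Q (rep_cproj (\<gamma> s))) has_field_derivative
      mvd (\<lambda>x. P x / Q x) (chart i p) (w $ i)) (at t)"
    using g by (subst (asm) DERIV_cong_ev[OF refl _ refl]) auto
qed

text \<open>Linearity in the direction is expressed in an affine chart, where tangent vectors can be
  added.\<close>

lemma has_tderiv_rational:
  assumes "rational f"
  shows "\<forall>\<^sub>F p in generic. \<forall>i. p \<in> chart_dom i \<longrightarrow>
    (\<exists>D. (\<forall>v v'. D (v + v') = D v + D v') \<and> (\<forall>c v. D (c *s v) = c * D v) \<and> (\<forall>w. has_tderiv f p w (D (w $ i))))"
proof -
  obtain d P Q where f: "homogeneous d P" "homogeneous d Q" "nonvanishing Q"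
    "\<forall>\<^sub>F p in generic. Q (rep_cproj p) \<noteq> 0 \<and> f p = P (rep_cproj p) / Q (rep_cproj p)"
    by (rule rationalE[OF assms]) (rule that)
  have "\<forall>\<^sub>F p in generic. P (rep_cproj p) / Q (rep_cproj p) = f p"
    using f(4) by eventually_elim simp
  from has_tderiv_cong_generic[OF this] f(4) show ?thesis
  proof eventually_elim
    case (elim p)
    show ?case
    proof (intro allI impI)
      fix i assume i: "p \<in> chart_dom i"
      have o: "open {x. Q x \<noteq> 0}" using homogeneous_continuous[OF f(2)] by (intro open_Collect_neq) auto
      have hol: "holomorphic_mv (\<lambda>x. P x / Q x) {x. Q x \<noteq> 0}"
        by (rule holomorphic_mv_divide[OF homogeneous_holomorphic[OF f(1) o] homogeneous_holomorphic[OF f(2) o]]) simp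
      have x: "chart i p \<in> {x. Q x \<noteq> 0}" using homogeneous_chart_zero_iff[OF f(2) i] elim by simp
      have "has_tderiv f p w (mvd (\<lambda>x. P x / Q x) (chart i p) (w $ i))" for w
        using has_tderiv_form_quotient[OF f(1,2) _ i] elim by blast
      then show "\<exists>D. (\<forall>v v'. D (v + v') = D v + D v') \<and> (\<forall>c v. D (c *s v) = c * D v) \<and> (\<forall>w. has_tderiv f p w (D (w $ i)))"
        using mvd_linear(1)[OF hol x] holomorphic_mvD(2)[OF hol x]
        by (intro exI[of _ "mvd (\<lambda>x. P x / Q x) (chart i p)"]) auto
    qed
  qed
qed

lemma has_tderiv_rational_exists:
  assumes "rational f"
  shows "\<forall>\<^sub>F p in generic. \<forall>w. \<exists>c. has_tderiv f p w c"
  using has_tderiv_rational[OF assms] by eventually_elim (metis ex_chart_dom)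

lemma has_tderiv_chart:
  assumes "p \<in> chart_dom i"
  shows "has_tderiv (\<lambda>q. chart i q $ k) p w (w $ i $ k)"
  unfolding has_tderiv_def using velocity_chart assms has_derivative_smult_iff by metis

end

section \<open>Algebraic dependence over a family of functions\<close>

text \<open>The algebra of polynomials in members of \<open>U\<close> with complex coefficients, as functions.  Products
  by generators suffice as constructors, which keeps inductions short.\<close>

inductive_set polys :: "('a \<Rightarrow> complex) set \<Rightarrow> ('a \<Rightarrow> complex) set" for U where
  const: "(\<lambda>p. a) \<in> polys U"
| add: "b \<in> polys U \<Longrightarrow> c \<in> polys U \<Longrightarrow> (\<lambda>p. b p + c p) \<in> polys U"
| gen: "u \<in> U \<Longrightarrow> b \<in> polys U \<Longrightarrow> (\<lambda>p. u p * b p) \<in> polys U"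

lemma polys_cmult: "b \<in> polys U \<Longrightarrow> (\<lambda>p. a * b p) \<in> polys U"
proof (induction rule: polys.induct)
  case (const c)
  show ?case by (rule polys.const)
next
  case (add b c)
  then show ?case using polys.add[OF add.IH] by (simp add: distrib_left)
next
  case (gen u b)
  then show ?case using polys.gen[OF gen.hyps(1) gen.IH] by (simp add: mult.left_commute)
qed

lemma polys_mult: "b \<in> polys U \<Longrightarrow> c \<in> polys U \<Longrightarrow> (\<lambda>p. b p * c p) \<in> polys U"
proof (induction rule: polys.induct)
  case (const a)
  then show ?case by (rule polys_cmult)
next
  case (add b d)
  then show ?case using polys.add[OF add.IH] by (simp add: distrib_right)
next
  case (gen u b)
  then show ?case using polys.gen[OF gen.hyps(1) gen.IH] by (simp add: mult.assoc)
qed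

lemma polys_base: "u \<in> U \<Longrightarrow> u \<in> polys U"
  using polys.gen[OF _ polys.const[of 1]] by simp

lemma polys_power: "b \<in> polys U \<Longrightarrow> (\<lambda>p. b p ^ k) \<in> polys U"
  by (induction k) (auto intro: polys.const polys_mult)

lemma polys_sum: "(\<And>a. a \<in> A \<Longrightarrow> b a \<in> polys U) \<Longrightarrow> (\<lambda>p. \<Sum>a\<in>A. b a p) \<in> polys U"
  by (induction A rule: infinite_finite_induct) (auto intro: polys.const polys.add)

lemma polys_prod: "(\<And>a. a \<in> A \<Longrightarrow> b a \<in> polys U) \<Longrightarrow> (\<lambda>p. \<Prod>a\<in>A. b a p) \<in> polys U"
  by (induction A rule: infinite_finite_induct) (auto intro: polys.const polys_mult)

text \<open>The expansion of \<open>b\<close> in monomials of the functions \<open>u\<^sub>j\<close> with \<open>s\<^sub>0 \<le> j < s\<close>, with coefficients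
  polynomial in the preceding ones.  Coefficients are zero off \<open>A\<close>, so that several expansions can
  be brought to a common set of exponents.\<close>

definition monomial_expansion :: "(nat \<Rightarrow> 'a \<Rightarrow> complex) \<Rightarrow> nat \<Rightarrow> nat \<Rightarrow> ('a \<Rightarrow> complex)
    \<Rightarrow> (nat \<Rightarrow> nat) set \<Rightarrow> ((nat \<Rightarrow> nat) \<Rightarrow> 'a \<Rightarrow> complex) \<Rightarrow> bool" where
  "monomial_expansion u s0 s b A e \<longleftrightarrow> finite A \<and> A \<subseteq> {\<alpha>. \<forall>j. \<alpha> j \<noteq> 0 \<longrightarrow> j \<in> {s0..<s}} \<and>
     (\<forall>\<alpha>. e \<alpha> \<in> polys (u ` {..<s0})) \<and> (\<forall>\<alpha>. \<alpha> \<notin> A \<longrightarrow> e \<alpha> = (\<lambda>p. 0)) \<and>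
     (\<forall>p. b p = (\<Sum>\<alpha>\<in>A. e \<alpha> p * (\<Prod>j\<in>{s0..<s}. u j p ^ \<alpha> j)))"

lemma monomial_expansionD:
  assumes "monomial_expansion u s0 s b A e"
  shows "finite A" "A \<subseteq> {\<alpha>. \<forall>j. \<alpha> j \<noteq> 0 \<longrightarrow> j \<in> {s0..<s}}" "\<forall>\<alpha>. e \<alpha> \<in> polys (u ` {..<s0})"
    "\<forall>\<alpha>. \<alpha> \<notin> A \<longrightarrow> e \<alpha> = (\<lambda>p. 0)" "\<forall>p. b p = (\<Sum>\<alpha>\<in>A. e \<alpha> p * (\<Prod>j\<in>{s0..<s}. u j p ^ \<alpha> j))"
  using assms unfolding monomial_expansion_def by blast+

lemma polys_monomial_expansion:
  assumes "b \<in> polys (u ` {..<s})" "s0 \<le> s"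
  shows "\<exists>A e. monomial_expansion u s0 s b A e"
  using assms(1)
proof (induction rule: polys.induct)
  case (const a)
  show ?case
    unfolding monomial_expansion_def
    by (rule exI[of _ "{\<lambda>_. 0}"], rule exI[of _ "\<lambda>\<alpha>. if \<alpha> = (\<lambda>_. 0) then (\<lambda>p. a) else (\<lambda>p. 0)"])
      (auto intro: polys.const)
next
  case (add b c)
  obtain A e B f where "monomial_expansion u s0 s b A e" "monomial_expansion u s0 s c B f"
    using add.IH by blast
  note 1 = monomial_expansionD[OF this(1)] and 2 = monomial_expansionD[OF this(2)]
  have "b p + c p = (\<Sum>\<alpha>\<in>A \<union> B. (e \<alpha> p + f \<alpha> p) * (\<Prod>j\<in>{s0..<s}. u j p ^ \<alpha> j))" for p
  proof -
    have "b p = (\<Sum>\<alpha>\<in>A \<union> B. e \<alpha> p * (\<Prod>j\<in>{s0..<s}. u j p ^ \<alpha> j))"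
      unfolding 1(5)[rule_format] by (rule sum.mono_neutral_left) (use 1 2 in auto)
    moreover have "c p = (\<Sum>\<alpha>\<in>A \<union> B. f \<alpha> p * (\<Prod>j\<in>{s0..<s}. u j p ^ \<alpha> j))"
      unfolding 2(5)[rule_format] by (rule sum.mono_neutral_left) (use 1 2 in auto)
    ultimately show ?thesis by (simp add: sum.distrib distrib_right)
  qed
  then show ?case
    unfolding monomial_expansion_def
    using 1 2 by (intro exI[of _ "A \<union> B"] exI[of _ "\<lambda>\<alpha> p. e \<alpha> p + f \<alpha> p"]) (auto intro: polys.add)
next
  case (gen v b)
  then obtain k where k: "k < s" "v = u k" by auto
  obtain A e where "monomial_expansion u s0 s b A e" using gen.IH by blast
  note 1 = monomial_expansionD[OF this]
  show ?case
  proof (cases "k < s0")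
    case True
    have "v p * b p = (\<Sum>\<alpha>\<in>A. (u k p * e \<alpha> p) * (\<Prod>j\<in>{s0..<s}. u j p ^ \<alpha> j))" for p
      unfolding 1(5)[rule_format] k(2) by (simp add: sum_distrib_left mult.assoc)
    then show ?thesis
      unfolding monomial_expansion_def
      using 1 True by (intro exI[of _ A] exI[of _ "\<lambda>\<alpha> p. u k p * e \<alpha> p"]) (auto intro: polys.gen)
  next
    case False
    \<comment> \<open>Multiplication by \<open>u k\<close> shifts the exponents.\<close>
    define up where "up = (\<lambda>\<alpha> :: nat \<Rightarrow> nat. \<alpha>(k := Suc (\<alpha> k)))"
    define down where "down = (\<lambda>\<alpha> :: nat \<Rightarrow> nat. \<alpha>(k := \<alpha> k - 1))"
    have du: "down (up \<alpha>) = \<alpha>" for \<alpha> by (simp add: up_def down_def)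
    have inj: "inj_on up A" by (rule inj_on_inverseI[of _ down]) (rule du)
    have up: "(\<Prod>j\<in>{s0..<s}. u j p ^ (up \<alpha>) j) = u k p * (\<Prod>j\<in>{s0..<s}. u j p ^ \<alpha> j)" for p \<alpha>
    proof -
      have kin: "k \<in> {s0..<s}" using False k by auto
      have "(\<Prod>j\<in>{s0..<s}. u j p ^ (up \<alpha>) j) = u k p ^ Suc (\<alpha> k) * (\<Prod>j\<in>{s0..<s} - {k}. u j p ^ (up \<alpha>) j)"
        using kin by (subst prod.remove[of _ k]) (auto simp: up_def)
      also have "(\<Prod>j\<in>{s0..<s} - {k}. u j p ^ (up \<alpha>) j) = (\<Prod>j\<in>{s0..<s} - {k}. u j p ^ \<alpha> j)"
        by (rule prod.cong) (auto simp: up_def)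
      also have "u k p ^ Suc (\<alpha> k) * (\<Prod>j\<in>{s0..<s} - {k}. u j p ^ \<alpha> j) = u k p * (\<Prod>j\<in>{s0..<s}. u j p ^ \<alpha> j)"
        using kin by (subst (2) prod.remove[of _ k]) auto
      finally show ?thesis .
    qed
    define f where "f = (\<lambda>\<alpha>. if \<alpha> \<in> up ` A then e (down \<alpha>) else (\<lambda>p. 0))"
    have "v p * b p = (\<Sum>\<alpha>\<in>up ` A. f \<alpha> p * (\<Prod>j\<in>{s0..<s}. u j p ^ \<alpha> j))" for p
      unfolding sum.reindex[OF inj] 1(5)[rule_format] k(2)
      by (auto simp: sum_distrib_left f_def du up intro!: sum.cong)
    moreover have "\<forall>\<alpha>. f \<alpha> \<in> polys (u ` {..<s0})" using 1(3) by (auto simp: f_def intro: polys.const)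
    moreover have "up ` A \<subseteq> {\<alpha>. \<forall>j. \<alpha> j \<noteq> 0 \<longrightarrow> j \<in> {s0..<s}}"
    proof (intro subsetI CollectI allI impI)
      fix \<beta> j assume "\<beta> \<in> up ` A" and j: "\<beta> j \<noteq> 0"
      then obtain \<alpha> where "\<alpha> \<in> A" "\<beta> = up \<alpha>" by blast
      then show "j \<in> {s0..<s}" using 1(2) False k j by (cases "j = k") (auto simp: up_def)
    qed
    ultimately show ?thesis
      unfolding monomial_expansion_def
      using 1(1) by (intro exI[of _ "up ` A"] exI[of _ f]) (auto simp: f_def)
  qed
qed

context projective_mfd
begin

lemma polys_rational: "b \<in> polys U \<Longrightarrow> (\<And>u. u \<in> U \<Longrightarrow> rational u) \<Longrightarrow> rational b"
  by (induction rule: polys.induct) (auto intro: rational_const rational_add rational_mult)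

text \<open>The coefficients \<open>b'\<close> are the partial derivatives of a polynomial that represents \<open>b\<close>.\<close>

lemma polys_chain_rule:
  assumes "b \<in> polys (u ` I)" "finite I"
  shows "\<exists>b'. (\<forall>i\<in>I. b' i \<in> polys (u ` I)) \<and>
    (\<forall>p w du. (\<forall>i\<in>I. has_tderiv (u i) p w (du i)) \<longrightarrow> has_tderiv b p w (\<Sum>i\<in>I. b' i p * du i))"
  using assms(1)
proof (induction rule: polys.induct)
  case (const a)
  show ?case by (rule exI[of _ "\<lambda>_ _. 0"]) (auto intro: polys.const has_tderiv_const)
next
  case (add b c)
  then obtain b' c' where "\<forall>i\<in>I. b' i \<in> polys (u ` I)"
    "\<forall>p w du. (\<forall>i\<in>I. has_tderiv (u i) p w (du i)) \<longrightarrow> has_tderiv b p w (\<Sum>i\<in>I. b' i p * du i)"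
    "\<forall>i\<in>I. c' i \<in> polys (u ` I)"
    "\<forall>p w du. (\<forall>i\<in>I. has_tderiv (u i) p w (du i)) \<longrightarrow> has_tderiv c p w (\<Sum>i\<in>I. c' i p * du i)"
    by blast
  then show ?case
    by (intro exI[of _ "\<lambda>i p. b' i p + c' i p"])
      (auto intro: polys.add has_tderiv_add simp: distrib_right sum.distrib)
next
  case (gen v b)
  then obtain k where k: "k \<in> I" "v = u k" by auto
  obtain b' where b': "\<forall>i\<in>I. b' i \<in> polys (u ` I)"
    "\<forall>p w du. (\<forall>i\<in>I. has_tderiv (u i) p w (du i)) \<longrightarrow> has_tderiv b p w (\<Sum>i\<in>I. b' i p * du i)"
    using gen.IH by blast
  define c where "c = (\<lambda>i p. (if i = k then b p else 0) + u k p * b' i p)"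
  have "c i \<in> polys (u ` I)" if "i \<in> I" for i
    unfolding c_def using k gen.hyps b' that
    by (cases "i = k") (auto intro!: polys.add polys.gen polys.const)
  moreover have "has_tderiv (\<lambda>p. v p * b p) p w (\<Sum>i\<in>I. c i p * du i)" if "\<forall>i\<in>I. has_tderiv (u i) p w (du i)" for p w du
  proof -
    have "has_tderiv (\<lambda>p. v p * b p) p w (du k * b p + (\<Sum>i\<in>I. b' i p * du i) * v p)"
      using has_tderiv_mult[of v p w "du k" b] that b'(2) k by blast
    moreover have "(\<Sum>i\<in>I. c i p * du i) = du k * b p + (\<Sum>i\<in>I. b' i p * du i) * v p"
    proof -
      have "(\<Sum>i\<in>I. c i p * du i) = (\<Sum>i\<in>I. (if i = k then b p * du k else 0)) + (\<Sum>i\<in>I. u k p * b' i p * du i)"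
        unfolding sum.distrib[symmetric] c_def by (rule sum.cong) (auto simp: distrib_right)
      then show ?thesis using assms(2) k by (simp add: sum_distrib_right sum_distrib_left mult_ac)
    qed
    ultimately show ?thesis by simp
  qed
  ultimately show ?case by (intro exI[of _ c]) auto
qed

text \<open>\<open>f\<close> is algebraic over the field generated by \<open>U\<close>.  A leading coefficient that does not
  vanish identically suffices: denominators can be cleared.\<close>

definition alg_over :: "('n cproj \<Rightarrow> complex) set \<Rightarrow> ('n cproj \<Rightarrow> complex) \<Rightarrow> bool" where
  "alg_over U f \<longleftrightarrow> (\<exists>n b. (\<forall>j\<le>n. b j \<in> polys U) \<and> \<not> (\<forall>\<^sub>F p in generic. b n p = 0) \<and>
     (\<forall>\<^sub>F p in generic. (\<Sum>j\<le>n. b j p * f p ^ j) = 0))"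

text \<open>\<open>df = \<Sum> \<beta>\<^sub>i du\<^sub>i\<close> on the tangent spaces at generic points.\<close>

definition differential_combination ::
    "('i \<Rightarrow> 'n cproj \<Rightarrow> complex) \<Rightarrow> 'i set \<Rightarrow> ('n cproj \<Rightarrow> complex) \<Rightarrow> ('i \<Rightarrow> 'n cproj \<Rightarrow> complex) \<Rightarrow> bool" where
  "differential_combination u I f \<beta> \<longleftrightarrow> (\<forall>\<^sub>F p in generic. \<forall>w\<in>tangent_space M p. \<forall>du df.
     (\<forall>i\<in>I. has_tderiv (u i) p w (du i)) \<and> has_tderiv f p w df \<longrightarrow> df = (\<Sum>i\<in>I. \<beta> i p * du i))"

text \<open>In a relation \<open>\<Sum> b\<^sub>j f\<^sup>j = 0\<close> of least degree the derivative \<open>g = \<Sum> j b\<^sub>j f\<^sup>j\<^sup>-\<^sup>1\<close> with respect to \<open>f\<close>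
  is not zero, since otherwise it would be a relation of smaller degree.  Differentiating the
  relation and dividing by \<open>g\<close> expresses \<open>df\<close>.\<close>

lemma differential_of_algebraic_function:
  assumes I: "finite I" and u: "\<And>i. i \<in> I \<Longrightarrow> rational (u i)" and f: "rational f" and alg: "alg_over (u ` I) f"
  shows "\<exists>\<beta>. (\<forall>i\<in>I. rational (\<beta> i)) \<and> differential_combination u I f \<beta>"
proof -
  define rel where "rel = (\<lambda>n b. (\<forall>j\<le>n. b j \<in> polys (u ` I)) \<and> \<not> (\<forall>\<^sub>F p in generic. b n p = 0) \<and>
     (\<forall>\<^sub>F p in generic. (\<Sum>j\<le>n. b j p * f p ^ j) = 0))"
  define n where "n = (LEAST n. \<exists>b. rel n b)"
  have "\<exists>n b. rel n b" using alg unfolding alg_over_def rel_def .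
  then have "\<exists>b. rel n b" unfolding n_def by (rule LeastI_ex)
  then obtain b where b: "rel n b" by blast
  have min: "\<not> rel k c" if "k < n" for k c using not_less_Least[of k "\<lambda>n. \<exists>b. rel n b"] that unfolding n_def by blast
  have bpoly: "b j \<in> polys (u ` I)" if "j \<le> n" for j using b that by (simp add: rel_def)
  have prat: "rational c" if "c \<in> polys (u ` I)" for c using polys_rational[OF that] u by blast
  have "n \<noteq> 0" using b by (cases n) (auto simp: rel_def)
  then obtain n' where n': "n = Suc n'" using not0_implies_Suc by blast
  define g where "g = (\<lambda>p. \<Sum>j\<le>n'. (of_nat (Suc j) * b (Suc j) p) * f p ^ j)"
  have "\<not> (\<forall>\<^sub>F p in generic. g p = 0)"
  proof
    assume g0: "\<forall>\<^sub>F p in generic. g p = 0"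
    have "rel n' (\<lambda>j p. of_nat (Suc j) * b (Suc j) p)"
      unfolding rel_def
    proof (intro conjI allI impI)
      show "(\<lambda>p. of_nat (Suc j) * b (Suc j) p) \<in> polys (u ` I)" if "j \<le> n'" for j
        using that n' by (intro polys_cmult bpoly) simp
      show "\<not> (\<forall>\<^sub>F p in generic. of_nat (Suc n') * b (Suc n') p = 0)"
        using b n' by (simp add: rel_def del: of_nat_Suc)
      show "\<forall>\<^sub>F p in generic. (\<Sum>j\<le>n'. of_nat (Suc j) * b (Suc j) p * f p ^ j) = 0"
        using g0 by (simp add: g_def)
    qed
    then show False using min[of n'] n' by blast
  qed
  moreover have grat: "rational g"
    unfolding g_def by (intro rational_sum rational_mult rational_power f rational_const prat bpoly) (simp add: n')
  ultimately have gnz: "\<forall>\<^sub>F p in generic. g p \<noteq> 0" using rational_cases by blast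
  have "\<forall>j. \<exists>b'. j \<le> n \<longrightarrow> (\<forall>i\<in>I. b' i \<in> polys (u ` I)) \<and>
    (\<forall>p w du. (\<forall>i\<in>I. has_tderiv (u i) p w (du i)) \<longrightarrow> has_tderiv (b j) p w (\<Sum>i\<in>I. b' i p * du i))"
    using polys_chain_rule[OF bpoly I] by blast
  then obtain b' where b'0: "\<And>j. j \<le> n \<longrightarrow> (\<forall>i\<in>I. b' j i \<in> polys (u ` I)) \<and>
    (\<forall>p w du. (\<forall>i\<in>I. has_tderiv (u i) p w (du i)) \<longrightarrow> has_tderiv (b j) p w (\<Sum>i\<in>I. b' j i p * du i))"
    by metis
  have b': "b' j i \<in> polys (u ` I)" if "j \<le> n" "i \<in> I" for i j using b'0 that by blast
  have db: "has_tderiv (b j) p w (\<Sum>i\<in>I. b' j i p * du i)" if "j \<le> n" "\<forall>i\<in>I. has_tderiv (u i) p w (du i)" for j p w du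
    using b'0 that by blast
  define \<beta> where "\<beta> = (\<lambda>i p. - (\<Sum>j\<le>n. b' j i p * f p ^ j) / g p)"
  have "rational (\<beta> i)" if "i \<in> I" for i
    unfolding \<beta>_def using that
    by (intro rational_divide rational_uminus rational_sum rational_mult rational_power f grat prat b') auto
  moreover have "\<forall>\<^sub>F p in generic. (\<Sum>j\<le>n. b j p * f p ^ j) = 0" using b by (simp add: rel_def)
  from has_tderiv_cong_generic[OF this] gnz
  have "differential_combination u I f \<beta>"
    unfolding differential_combination_def
  proof eventually_elim
    case (elim p)
    show ?case
    proof (intro ballI allI impI)
      fix w du df assume w: "w \<in> tangent_space M p" and d: "(\<forall>i\<in>I. has_tderiv (u i) p w (du i)) \<and> has_tderiv f p w df"
      have "has_tderiv (\<lambda>p. \<Sum>j\<le>n. b j p * f p ^ j) p w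
        (\<Sum>j\<le>n. (\<Sum>i\<in>I. b' j i p * du i) * f p ^ j + (of_nat j * f p ^ (j - 1) * df) * b j p)"
        using d by (intro has_tderiv_sum has_tderiv_mult has_tderiv_power db) auto
      moreover have "has_tderiv (\<lambda>p. \<Sum>j\<le>n. b j p * f p ^ j) p w 0"
        using elim(1) has_tderiv_const[of 0] by blast
      ultimately have "(\<Sum>j\<le>n. (\<Sum>i\<in>I. b' j i p * du i) * f p ^ j + (of_nat j * f p ^ (j - 1) * df) * b j p) = 0"
        by (rule has_tderiv_unique[OF w])
      moreover have "(\<Sum>j\<le>n. (of_nat j * f p ^ (j - 1) * df) * b j p) = g p * df"
        unfolding n' sum.atMost_Suc_shift g_def by (simp add: sum_distrib_right sum_distrib_left mult_ac)
      moreover have "(\<Sum>j\<le>n. (\<Sum>i\<in>I. b' j i p * du i) * f p ^ j) = (\<Sum>i\<in>I. (\<Sum>j\<le>n. b' j i p * f p ^ j) * du i)"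
        unfolding sum_distrib_right by (subst sum.swap) (simp add: mult_ac)
      ultimately have "(\<Sum>i\<in>I. (\<Sum>j\<le>n. b' j i p * f p ^ j) * du i) = - (g p * df)"
        by (simp add: sum.distrib eq_neg_iff_add_eq_0)
      moreover have "(\<Sum>i\<in>I. \<beta> i p * du i) = - (\<Sum>i\<in>I. (\<Sum>j\<le>n. b' j i p * f p ^ j) * du i) / g p"
      proof -
        have "\<beta> i p * du i = - ((\<Sum>j\<le>n. b' j i p * f p ^ j) * du i) / g p" for i
          by (simp add: \<beta>_def)
        then show ?thesis by (simp only: sum_divide_distrib[symmetric] sum_negf)
      qed
      ultimately show "df = (\<Sum>i\<in>I. \<beta> i p * du i)" using elim(2) by simp
    qed
  qed
  ultimately show ?thesis by blast
qed

subsection \<open>Transcendence bases\<close>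

text \<open>A sequence in which no member is algebraic over its predecessors.  Building transcendence
  bases one element at a time in this way avoids the exchange lemma.\<close>

definition indep_seq :: "(nat \<Rightarrow> 'n cproj \<Rightarrow> complex) \<Rightarrow> nat \<Rightarrow> bool" where
  "indep_seq u s \<longleftrightarrow> (\<forall>j<s. rational (u j) \<and> \<not> alg_over (u ` {..<j}) (u j))"

lemma not_all_generic_zero_alg:
  assumes b: "\<And>j. j \<le> e \<Longrightarrow> b j \<in> polys U" and k: "k \<le> e" "\<not> (\<forall>\<^sub>F p in generic. b k p = 0)"
    and rel: "\<forall>\<^sub>F p in generic. (\<Sum>j\<le>e. b j p * f p ^ j) = 0"
  shows "alg_over U f"
proof -
  define S where "S = {j. j \<le> e \<and> \<not> (\<forall>\<^sub>F p in generic. b j p = 0)}"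
  define n where "n = Max S"
  have S: "finite S" "k \<in> S" using k by (auto simp: S_def)
  then have n: "n \<in> S" unfolding n_def by (intro Max_in) auto
  have above: "\<forall>\<^sub>F p in generic. b j p = 0" if "j \<le> e" "n < j" for j
  proof (rule ccontr)
    assume "\<not> (\<forall>\<^sub>F p in generic. b j p = 0)"
    then have "j \<in> S" using that by (simp add: S_def)
    then have "j \<le> n" unfolding n_def by (rule Max_ge[OF S(1)])
    then show False using that by simp
  qed
  have "\<forall>\<^sub>F p in generic. \<forall>j\<in>{n<..e}. b j p = 0"
    by (rule eventually_ball_finite) (use above in auto)
  with rel have "\<forall>\<^sub>F p in generic. (\<Sum>j\<le>n. b j p * f p ^ j) = 0"
  proof eventually_elim
    case (elim p)
    have "(\<Sum>j\<le>e. b j p * f p ^ j) = (\<Sum>j\<le>n. b j p * f p ^ j)"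
      by (rule sum.mono_neutral_right) (use n elim in \<open>auto simp: S_def\<close>)
    then show ?case using elim by simp
  qed
  then show ?thesis using n b unfolding alg_over_def S_def by (intro exI[of _ n] exI[of _ b]) auto
qed

text \<open>Ordered by powers of the last function, a relation has coefficients that are polynomials in
  the preceding ones.  If they all vanish, induction applies; otherwise the last function is algebraic
  over the others.\<close>

lemma indep_seq_no_relation:
  assumes "indep_seq u s"
    and "\<forall>\<^sub>F p in generic. (\<Sum>\<alpha>\<in>PiE {..<s} (\<lambda>_. {..e}). c \<alpha> * (\<Prod>j<s. u j p ^ \<alpha> j)) = 0"
  shows "\<forall>\<alpha>\<in>PiE {..<s} (\<lambda>_. {..e}). c \<alpha> = 0"
  using assms
proof (induction s arbitrary: c)
  case 0
  then show ?case by (simp add: eventually_const)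
next
  case (Suc s)
  define B where "B = PiE {..<s} (\<lambda>_::nat. {..e})"
  have set: "{..<Suc s} = insert s {..<s}" by auto
  define b where "b = (\<lambda>y p. \<Sum>g\<in>B. c (g(s := y)) * (\<Prod>j<s. u j p ^ g j))"
  have inj: "inj_on (\<lambda>(y, g). g(s := y)) ({..e} \<times> B)"
    unfolding B_def by (rule inj_combinator) simp
  have sum: "(\<Sum>\<alpha>\<in>PiE {..<Suc s} (\<lambda>_. {..e}). c \<alpha> * (\<Prod>j<Suc s. u j p ^ \<alpha> j)) = (\<Sum>y\<le>e. b y p * u s p ^ y)" for p
  proof -
    have "(\<Sum>\<alpha>\<in>PiE {..<Suc s} (\<lambda>_. {..e}). c \<alpha> * (\<Prod>j<Suc s. u j p ^ \<alpha> j))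
      = (\<Sum>(y, g)\<in>{..e} \<times> B. c (g(s := y)) * (\<Prod>j<Suc s. u j p ^ (g(s := y)) j))"
      unfolding set PiE_insert_eq B_def[symmetric] sum.reindex[OF inj]
      by (rule sum.cong) (auto simp: o_def)
    also have "\<dots> = (\<Sum>y\<le>e. \<Sum>g\<in>B. c (g(s := y)) * (\<Prod>j<s. u j p ^ g j) * u s p ^ y)"
      unfolding sum.cartesian_product[symmetric] by (simp add: mult.assoc)
    finally show ?thesis by (simp add: b_def sum_distrib_right)
  qed
  have poly: "b y \<in> polys (u ` {..<s})" for y
    unfolding b_def by (intro polys_sum polys_cmult polys_prod polys_power polys_base) auto
  have ind: "indep_seq u s" using Suc.prems(1) by (auto simp: indep_seq_def)
  have "\<forall>\<^sub>F p in generic. b y p = 0" if "y \<le> e" for y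
  proof (rule ccontr)
    assume "\<not> (\<forall>\<^sub>F p in generic. b y p = 0)"
    then have "alg_over (u ` {..<s}) (u s)"
      using not_all_generic_zero_alg[of e b "u ` {..<s}" y "u s"] poly that Suc.prems(2) unfolding sum by blast
    then show False using Suc.prems(1) by (auto simp: indep_seq_def)
  qed
  then have "\<forall>g\<in>B. c (g(s := y)) = 0" if "y \<le> e" for y
    using Suc.IH[OF ind, of "\<lambda>g. c (g(s := y))"] that unfolding b_def B_def by blast
  then show ?case unfolding set PiE_insert_eq B_def[symmetric] by auto
qed

lemma indep_seq_length: "indep_seq u s \<Longrightarrow> s \<le> m"
proof (rule ccontr)
  assume u: "indep_seq u s" and "\<not> s \<le> m"
  then have ind: "indep_seq u (Suc m)" by (auto simp: indep_seq_def)
  obtain e c where c: "\<exists>\<alpha>\<in>PiE {..<Suc m} (\<lambda>_. {..e}). c \<alpha> \<noteq> 0"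
    "\<forall>\<^sub>F p in generic. (\<Sum>\<alpha>\<in>PiE {..<Suc m} (\<lambda>_. {..e}). c \<alpha> * (\<Prod>j<Suc m. u j p ^ \<alpha> j)) = 0"
    by (rule algebraic_dependence[of u]) (use ind that in \<open>auto simp: indep_seq_def\<close>)
  then show False using indep_seq_no_relation[OF ind] by blast
qed

text \<open>The length of independent sequences is bounded by \<open>m\<close>, so an extension by functions satisfying
  \<open>P\<close> can be chosen of maximal length.  It is applied first to the field \<open>K\<close> of constants, then to extend the result to the whole
  function field.\<close>

lemma indep_seq_extension:
  assumes u0: "indep_seq u0 s0" and P: "\<And>f. P f \<Longrightarrow> rational f"
  shows "\<exists>u s. s0 \<le> s \<and> indep_seq u s \<and> (\<forall>j<s0. u j = u0 j) \<and> (\<forall>j. s0 \<le> j \<and> j < s \<longrightarrow> P (u j)) \<and>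
    (\<forall>f. P f \<longrightarrow> alg_over (u ` {..<s}) f)"
proof -
  define ok where "ok = (\<lambda>s u. s0 \<le> s \<and> indep_seq u s \<and> (\<forall>j<s0. u j = u0 j) \<and> (\<forall>j. s0 \<le> j \<and> j < s \<longrightarrow> P (u j)))"
  define S where "S = {s. \<exists>u. ok s u}"
  have "ok s0 u0" using u0 by (auto simp: ok_def)
  then have S: "s0 \<in> S" by (auto simp: S_def)
  have "S \<subseteq> {..m}" using indep_seq_length by (auto simp: S_def ok_def)
  then have fS: "finite S" by (rule finite_subset) simp
  define s where "s = Max S"
  have "s \<in> S" unfolding s_def using S fS by (intro Max_in) auto
  then obtain u where u: "ok s u" by (auto simp: S_def)
  have "alg_over (u ` {..<s}) f" if f: "P f" for f
  proof (rule ccontr)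
    assume na: "\<not> alg_over (u ` {..<s}) f"
    define u' where "u' = u(s := f)"
    have img: "u' ` {..<j} = u ` {..<j}" if "j \<le> s" for j using that by (auto simp: u'_def)
    have "indep_seq u' (Suc s)"
      unfolding indep_seq_def
    proof (intro allI impI)
      fix j assume "j < Suc s"
      then show "rational (u' j) \<and> \<not> alg_over (u' ` {..<j}) (u' j)"
        using img[of j] na u P[OF f] by (cases "j = s") (auto simp: u'_def ok_def indep_seq_def)
    qed
    then have "ok (Suc s) u'" using u f by (auto simp: ok_def u'_def)
    then have "Suc s \<in> S" by (auto simp: S_def)
    then have "Suc s \<le> s" unfolding s_def using fS by (rule Max_ge[rotated])
    then show False by simp
  qed
  then show ?thesis using u unfolding ok_def by blast
qed

subsection \<open>Eigenfunctions of a vector field\<close>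

text \<open>\<open>X f = g\<close> in the function field.\<close>

definition der :: "('n cproj \<Rightarrow> 'n tvec) \<Rightarrow> ('n cproj \<Rightarrow> complex) \<Rightarrow> ('n cproj \<Rightarrow> complex) \<Rightarrow> bool" where
  "der X f g \<longleftrightarrow> (\<forall>\<^sub>F p in generic. has_tderiv f p (X p) (g p))"

lemma der_unique:
  assumes "\<forall>\<^sub>F p in generic. X p \<in> tangent_space M p" "der X f g" "\<forall>\<^sub>F p in generic. f p = 0"
  shows "\<forall>\<^sub>F p in generic. g p = 0"
  using assms(1) assms(2)[unfolded der_def] has_tderiv_cong_generic[OF assms(3)]
  by eventually_elim (metis has_tderiv_const has_tderiv_unique)

lemma der_const: "der X (\<lambda>p. a) (\<lambda>p. 0)"
  by (simp add: der_def has_tderiv_const)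

lemma der_mult: "der X f a \<Longrightarrow> der X g b \<Longrightarrow> der X (\<lambda>p. f p * g p) (\<lambda>p. a p * g p + b p * f p)"
proof -
  assume "der X f a" "der X g b"
  then show ?thesis unfolding der_def by eventually_elim (rule has_tderiv_mult)
qed

lemma der_sum:
  assumes "finite A" "\<And>a. a \<in> A \<Longrightarrow> der X (f a) (g a)"
  shows "der X (\<lambda>p. \<Sum>a\<in>A. f a p) (\<lambda>p. \<Sum>a\<in>A. g a p)"
proof -
  have "\<forall>\<^sub>F p in generic. \<forall>a\<in>A. has_tderiv (f a) p (X p) (g a p)"
    by (rule eventually_ball_finite[OF assms(1)]) (use assms(2) in \<open>auto simp: der_def\<close>)
  then show ?thesis unfolding der_def by eventually_elim (rule has_tderiv_sum, blast)
qed

lemma der_power_eigen: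
  assumes "der X f (\<lambda>p. l * f p)"
  shows "der X (\<lambda>p. f p ^ k) (\<lambda>p. of_nat k * l * f p ^ k)"
  using assms unfolding der_def
proof eventually_elim
  case (elim p)
  have "of_nat k * f p ^ (k - 1) * (l * f p) = of_nat k * l * f p ^ k"
    by (cases k) auto
  then show ?case using has_tderiv_power[OF elim, of k] by (simp only:)
qed

lemma der_mult_eigen:
  assumes "der X f (\<lambda>p. l * f p)" "der X g (\<lambda>p. l' * g p)"
  shows "der X (\<lambda>p. f p * g p) (\<lambda>p. (l + l') * (f p * g p))"
  using der_mult[OF assms] by (simp add: algebra_simps)

lemma der_prod_eigen:
  assumes "finite A" "\<And>a. a \<in> A \<Longrightarrow> der X (f a) (\<lambda>p. l a * f a p)"
  shows "der X (\<lambda>p. \<Prod>a\<in>A. f a p) (\<lambda>p. (\<Sum>a\<in>A. l a) * (\<Prod>a\<in>A. f a p))"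
  using assms
proof (induction A rule: finite_induct)
  case empty
  then show ?case using der_const[of X 1] by simp
next
  case (insert a A)
  then show ?case using der_mult_eigen[of X "f a" "l a" "\<lambda>p. \<Prod>a\<in>A. f a p" "\<Sum>a\<in>A. l a"] by simp
qed

text \<open>The usual argument: apply \<open>X\<close> to the sum and subtract \<open>l b\<close> times the sum to remove one term.\<close>

lemma eigenfunctions_independent:
  assumes X: "\<forall>\<^sub>F p in generic. X p \<in> tangent_space M p"
    and "finite A" "inj_on l A" "\<And>a. a \<in> A \<Longrightarrow> der X (f a) (\<lambda>p. l a * f a p)"
    and "\<forall>\<^sub>F p in generic. (\<Sum>a\<in>A. f a p) = 0"
  shows "\<forall>a\<in>A. \<forall>\<^sub>F p in generic. f a p = 0"
  using assms(2-)
proof (induction A arbitrary: f rule: finite_induct)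
  case (insert b A)
  have "der X (\<lambda>p. \<Sum>a\<in>insert b A. f a p) (\<lambda>p. \<Sum>a\<in>insert b A. l a * f a p)"
    using insert by (intro der_sum) auto
  from der_unique[OF X this insert.prems(3)]
  have 0: "\<forall>\<^sub>F p in generic. (\<Sum>a\<in>insert b A. l a * f a p) = 0" .
  have "\<forall>\<^sub>F p in generic. (\<Sum>a\<in>A. (l a - l b) * f a p) = 0"
    using insert.prems(3) 0
  proof eventually_elim
    case (elim p)
    have "(\<Sum>a\<in>A. (l a - l b) * f a p) = (\<Sum>a\<in>insert b A. l a * f a p) - l b * (\<Sum>a\<in>insert b A. f a p)"
      using insert.hyps by (simp add: left_diff_distrib sum_subtractf sum_distrib_left distrib_left)
    then show ?case using elim by simp
  qed
  moreover have "der X (\<lambda>p. (l a - l b) * f a p) (\<lambda>p. l a * ((l a - l b) * f a p))" if "a \<in> A" for a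
    using der_mult[OF der_const[of X "l a - l b"], of "f a" "\<lambda>p. l a * f a p"] insert.prems(2) that by (simp add: mult_ac)
  moreover have "inj_on l A" using insert.prems(1) by (simp add: inj_on_def)
  ultimately have "\<forall>a\<in>A. \<forall>\<^sub>F p in generic. (l a - l b) * f a p = 0"
    using insert.IH[of "\<lambda>a p. (l a - l b) * f a p"] by blast
  moreover have "l a - l b \<noteq> 0" if "a \<in> A" for a
    using insert.prems(1) insert.hyps(2) that by (auto simp: inj_on_def)
  ultimately have A: "\<forall>a\<in>A. \<forall>\<^sub>F p in generic. f a p = 0" by simp
  then have "\<forall>\<^sub>F p in generic. \<forall>a\<in>A. f a p = 0"
    by (intro eventually_ball_finite insert.hyps) auto
  with insert.prems(3) have "\<forall>\<^sub>F p in generic. f b p = 0"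
    by eventually_elim (use insert.hyps in simp)
  with A show ?case by blast
qed simp

lemma der_polys_zero:
  assumes "b \<in> polys (u ` I)" "finite I" "\<And>i. i \<in> I \<Longrightarrow> der X (u i) (\<lambda>p. 0)"
  shows "der X b (\<lambda>p. 0)"
proof -
  obtain b' where b': "\<And>p w du. (\<forall>i\<in>I. has_tderiv (u i) p w (du i)) \<longrightarrow> has_tderiv b p w (\<Sum>i\<in>I. b' i p * du i)"
    using polys_chain_rule[OF assms(1,2)] by blast
  have "\<forall>\<^sub>F p in generic. \<forall>i\<in>I. has_tderiv (u i) p (X p) 0"
    by (rule eventually_ball_finite[OF assms(2)]) (use assms(3) in \<open>auto simp: der_def\<close>)
  then show ?thesis unfolding der_def
  proof eventually_elim
    case (elim p)
    then show ?case using b'[of p "X p" "\<lambda>_. 0"] by simp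
  qed
qed

lemma indep_seq_nonzero:
  assumes "indep_seq u s" "j < s"
  shows "\<forall>\<^sub>F p in generic. u j p \<noteq> 0"
proof -
  have "\<not> (\<forall>\<^sub>F p in generic. u j p = 0)"
  proof
    assume z: "\<forall>\<^sub>F p in generic. u j p = 0"
    have "alg_over (u ` {..<j}) (u j)"
      unfolding alg_over_def
      by (rule exI[of _ 1], rule exI[of _ "\<lambda>k p. if k = 1 then 1 else 0"]) (use z in \<open>auto intro: polys.const\<close>)
    then show False using assms by (auto simp: indep_seq_def)
  qed
  then show ?thesis using rational_cases assms by (auto simp: indep_seq_def)
qed

text \<open>Write the coefficients of a relation \<open>\<Sum> b\<^sub>j h\<^sup>j = 0\<close> as sums of monomials in the eigenfunctions
  \<open>u\<^sub>j\<close>, \<open>j \<ge> s\<^sub>0\<close>, with coefficients \<open>e\<^sub>j\<^sub>\<alpha>\<close> polynomial in the constants \<open>u\<^sub>j\<close>, \<open>j < s\<^sub>0\<close>.  Collecting the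
  monomial of exponent \<open>\<alpha>\<close> gives an eigenfunction with eigenvalue \<open>\<Sum> \<alpha>\<^sub>j c\<^sub>j\<close>.  These eigenvalues are
  distinct, so each \<open>\<Sum> e\<^sub>j\<^sub>\<alpha> h\<^sup>j\<close> vanishes, and one of these relations has a nonzero leading
  coefficient.\<close>

lemma constants_algebraic_over_kernel_part:
  assumes X: "\<forall>\<^sub>F p in generic. X p \<in> tangent_space M p"
    and u: "indep_seq u s" and s0: "s0 \<le> s"
    and d0: "\<And>j. j < s0 \<Longrightarrow> der X (u j) (\<lambda>p. 0)"
    and d1: "\<And>j. s0 \<le> j \<Longrightarrow> j < s \<Longrightarrow> der X (u j) (\<lambda>p. c j * u j p)"
    and inj: "inj_on (\<lambda>\<alpha>. \<Sum>j\<in>{s0..<s}. of_nat (\<alpha> j) * c j) {\<alpha>. \<forall>j. \<alpha> j \<noteq> 0 \<longrightarrow> j \<in> {s0..<s}}"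
    and h: "alg_over (u ` {..<s}) h" "der X h (\<lambda>p. 0)"
  shows "alg_over (u ` {..<s0}) h"
proof -
  obtain n b where b: "\<And>j. j \<le> n \<Longrightarrow> b j \<in> polys (u ` {..<s})" "\<not> (\<forall>\<^sub>F p in generic. b n p = 0)"
     "\<forall>\<^sub>F p in generic. (\<Sum>j\<le>n. b j p * h p ^ j) = 0"
    using h(1) unfolding alg_over_def by blast
  define E where "E = {\<alpha> :: nat \<Rightarrow> nat. \<forall>j. \<alpha> j \<noteq> 0 \<longrightarrow> j \<in> {s0..<s}}"
  define mon where "mon = (\<lambda>\<alpha> p. \<Prod>j\<in>{s0..<s}. u j p ^ \<alpha> j)"
  have "\<exists>A e. j \<le> n \<longrightarrow> monomial_expansion u s0 s (b j) A e" for j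
    using polys_monomial_expansion[OF b(1) s0] by blast
  then obtain A e where Ae: "\<And>j. j \<le> n \<Longrightarrow> monomial_expansion u s0 s (b j) (A j) (e j)" by metis
  note Ae = monomial_expansionD[OF Ae, folded E_def]
  define B where "B = (\<Union>j\<le>n. A j)"
  have B: "finite B" "B \<subseteq> E" using Ae(1) UN_least[of "{..n}" A E] Ae(2) by (simp_all add: B_def)
  have e: "e j \<alpha> \<in> polys (u ` {..<s0})" if "j \<le> n" for j \<alpha> using Ae(3)[OF that] by blast
  have bB: "b j p = (\<Sum>\<alpha>\<in>B. e j \<alpha> p * mon \<alpha> p)" if j: "j \<le> n" for j p
    unfolding Ae(5)[OF j, rule_format] mon_def
    by (rule sum.mono_neutral_left[OF B(1)]) (use Ae(4)[OF j] j in \<open>auto simp: B_def\<close>)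
  define g where "g = (\<lambda>\<alpha> p. \<Sum>j\<le>n. e j \<alpha> p * h p ^ j)"
  define l where "l = (\<lambda>\<alpha>. \<Sum>j\<in>{s0..<s}. of_nat (\<alpha> j) * c j)"
  have dh: "der X (\<lambda>p. h p ^ j) (\<lambda>p. 0)" for j
    using der_power_eigen[of X h 0 j] h(2) by simp
  have dg: "der X (g \<alpha>) (\<lambda>p. 0)" for \<alpha>
  proof -
    have "der X (\<lambda>p. e j \<alpha> p * h p ^ j) (\<lambda>p. 0)" if "j \<le> n" for j
      using der_mult[OF der_polys_zero[OF e[OF that]] dh[of j]] d0 by simp
    then show ?thesis unfolding g_def using der_sum[of "{..n}" X "\<lambda>j p. e j \<alpha> p * h p ^ j" "\<lambda>_ _. 0"] by simp
  qed
  have dm: "der X (mon \<alpha>) (\<lambda>p. l \<alpha> * mon \<alpha> p)" for \<alpha>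
    unfolding mon_def l_def by (rule der_prod_eigen) (use d1 der_power_eigen in auto)
  have "der X (\<lambda>p. mon \<alpha> p * g \<alpha> p) (\<lambda>p. l \<alpha> * (mon \<alpha> p * g \<alpha> p))" for \<alpha>
    using der_mult_eigen[OF dm[of \<alpha>], of "g \<alpha>" 0] dg by simp
  moreover have "\<forall>\<^sub>F p in generic. (\<Sum>\<alpha>\<in>B. mon \<alpha> p * g \<alpha> p) = 0"
    using b(3)
  proof eventually_elim
    case (elim p)
    have "(\<Sum>\<alpha>\<in>B. mon \<alpha> p * g \<alpha> p) = (\<Sum>j\<le>n. \<Sum>\<alpha>\<in>B. mon \<alpha> p * (e j \<alpha> p * h p ^ j))"
      unfolding g_def sum_distrib_left by (rule sum.swap)
    also have "\<dots> = (\<Sum>j\<le>n. b j p * h p ^ j)"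
      by (rule sum.cong) (auto simp: bB sum_distrib_right sum_distrib_left mult_ac)
    finally show ?case using elim by simp
  qed
  moreover have "inj_on l B" unfolding l_def using inj B(2) unfolding E_def by (rule inj_on_subset)
  ultimately have "\<forall>\<alpha>\<in>B. \<forall>\<^sub>F p in generic. mon \<alpha> p * g \<alpha> p = 0"
    by (intro eigenfunctions_independent[OF X B(1)]) auto
  moreover have "\<forall>\<^sub>F p in generic. mon \<alpha> p \<noteq> 0" for \<alpha>
  proof -
    have "\<forall>\<^sub>F p in generic. \<forall>j\<in>{s0..<s}. u j p \<noteq> 0"
      by (rule eventually_ball_finite) (use indep_seq_nonzero[OF u] in auto)
    then show ?thesis by eventually_elim (simp add: mon_def)
  qed
  ultimately have g0: "\<forall>\<^sub>F p in generic. g \<alpha> p = 0" if "\<alpha> \<in> B" for \<alpha>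
  proof -
    assume a: "\<forall>\<alpha>\<in>B. \<forall>\<^sub>F p in generic. mon \<alpha> p * g \<alpha> p = 0" and n: "\<And>\<alpha>. \<forall>\<^sub>F p in generic. mon \<alpha> p \<noteq> 0"
    from bspec[OF a that] n[of \<alpha>] show ?thesis by eventually_elim simp
  qed
  obtain \<alpha> where \<alpha>: "\<alpha> \<in> B" "\<not> (\<forall>\<^sub>F p in generic. e n \<alpha> p = 0)"
  proof (rule ccontr)
    assume "\<not> thesis"
    then have "\<forall>\<alpha>\<in>B. \<forall>\<^sub>F p in generic. e n \<alpha> p = 0" using that by blast
    then have "\<forall>\<^sub>F p in generic. \<forall>\<alpha>\<in>B. e n \<alpha> p = 0" by (intro eventually_ball_finite[OF B(1)])
    then have "\<forall>\<^sub>F p in generic. b n p = 0" by eventually_elim (simp add: bB)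
    then show False using b(2) by blast
  qed
  show ?thesis unfolding alg_over_def
    using g0[OF \<alpha>(1)] \<alpha>(2) e unfolding g_def by (intro exI[of _ n] exI[of _ "\<lambda>j. e j \<alpha>"]) auto
qed

end

section \<open>Rationally independent eigenvalues\<close>

text \<open>Unique factorisation makes the logarithms of primes linearly independent over the rationals.\<close>

lemma logarithms_of_primes_independent:
  "\<exists>c :: nat \<Rightarrow> complex. \<forall>a b. inj_on (\<lambda>\<alpha>. \<Sum>j\<in>{a..<b}. of_nat (\<alpha> j) * c j) {\<alpha> :: nat \<Rightarrow> nat. \<forall>j. \<alpha> j \<noteq> 0 \<longrightarrow> j \<in> {a..<b}}"
proof -
  define p where "p = enumerate {p :: nat. prime p}"
  have p: "prime (p j)" for j
    unfolding p_def using enumerate_in_set[OF primes_infinite, of j] by simp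
  have injp: "inj p"
    unfolding p_def using strict_mono_enumerate[OF primes_infinite] by (rule strict_mono_imp_inj_on)
  have pos: "p j > 0" for j using prime_gt_0_nat[OF p] .
  show ?thesis
  proof (intro exI[of _ "\<lambda>j. complex_of_real (ln (real (p j)))"] allI inj_onI)
    fix a b :: nat and \<alpha> \<beta> :: "nat \<Rightarrow> nat"
    assume \<alpha>: "\<alpha> \<in> {\<alpha>. \<forall>j. \<alpha> j \<noteq> 0 \<longrightarrow> j \<in> {a..<b}}" and \<beta>: "\<beta> \<in> {\<alpha>. \<forall>j. \<alpha> j \<noteq> 0 \<longrightarrow> j \<in> {a..<b}}"
      and eq: "(\<Sum>j\<in>{a..<b}. of_nat (\<alpha> j) * complex_of_real (ln (real (p j)))) =
          (\<Sum>j\<in>{a..<b}. of_nat (\<beta> j) * complex_of_real (ln (real (p j))))"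
    have ln: "(\<Sum>j\<in>{a..<b}. of_nat (\<alpha> j) * complex_of_real (ln (real (p j)))) =
        complex_of_real (ln (real (\<Prod>j\<in>{a..<b}. p j ^ \<alpha> j)))" for \<alpha> :: "nat \<Rightarrow> nat"
      using pos by (simp add: ln_prod ln_realpow)
    have "real (\<Prod>j\<in>{a..<b}. p j ^ \<alpha> j) = real (\<Prod>j\<in>{a..<b}. p j ^ \<beta> j)"
    proof (rule iffD1[OF ln_inj_iff])
      show "0 < real (\<Prod>j\<in>{a..<b}. p j ^ \<alpha> j)" "0 < real (\<Prod>j\<in>{a..<b}. p j ^ \<beta> j)"
        using pos by (auto intro!: prod_pos)
      show "ln (real (\<Prod>j\<in>{a..<b}. p j ^ \<alpha> j)) = ln (real (\<Prod>j\<in>{a..<b}. p j ^ \<beta> j))"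
        using eq unfolding ln of_real_eq_iff .
    qed
    then have prods: "(\<Prod>j\<in>{a..<b}. p j ^ \<alpha> j) = (\<Prod>j\<in>{a..<b}. p j ^ \<beta> j)" by (simp only: of_nat_eq_iff)
    have mult: "multiplicity (p k) (\<Prod>j\<in>{a..<b}. p j ^ \<alpha> j) = \<alpha> k" if k: "k \<in> {a..<b}" for k and \<alpha> :: "nat \<Rightarrow> nat"
    proof -
      have "(\<Prod>j\<in>{a..<b}. p j ^ \<alpha> j) = (\<Prod>q\<in>p ` {a..<b}. q ^ \<alpha> (the_inv p q))"
        using inj_on_subset[OF injp subset_UNIV] by (subst prod.reindex) (auto simp: the_inv_f_f[OF injp])
      moreover have "multiplicity (p k) (\<Prod>q\<in>p ` {a..<b}. q ^ \<alpha> (the_inv p q)) =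
          (if p k \<in> p ` {a..<b} then \<alpha> (the_inv p (p k)) else 0)"
        by (rule multiplicity_prod_prime_powers) (use p in auto)
      ultimately show ?thesis using k by (simp add: the_inv_f_f[OF injp])
    qed
    show "\<alpha> = \<beta>"
    proof
      fix k show "\<alpha> k = \<beta> k"
      proof (cases "k \<in> {a..<b}")
        case True
        then show ?thesis using mult[OF True, of \<alpha>] mult[OF True, of \<beta>] prods by simp
      next
        case False
        then show ?thesis using \<alpha> \<beta> by (metis (mono_tags, lifting) mem_Collect_eq)
      qed
    qed
  qed
qed

section \<open>Holomorphic differential equations\<close>

lemma difference_bound:
  fixes \<eta> :: "complex \<Rightarrow> complex ^ 'n::finite"
  assumes d: "\<And>t. t \<in> S \<Longrightarrow> (\<eta> has_derivative (\<lambda>h. h *s v t)) (at t within S)" and "convex S"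
    and B: "\<And>t. t \<in> S \<Longrightarrow> norm (v t) \<le> B" and "s \<in> S" "t \<in> S"
  shows "norm (\<eta> t - \<eta> s) \<le> B * norm (t - s)"
proof (rule differentiable_bound[OF \<open>convex S\<close> d])
  show "onorm (\<lambda>h. h *s v x) \<le> B" if "x \<in> S" for x
    using B[OF that] by (intro onorm_le) (auto simp: norm_vector_smult mult.commute[of B] intro!: mult_left_mono)
qed (use assms in auto)

text \<open>Picard iteration.  The integral operator is obtained from holomorphic primitives on a disc, on
  which it contracts uniform distances by the factor 1/2; uniform limits of holomorphic functions are holomorphic.\<close>

lemma holomorphic_ode_solution:
  fixes G :: "complex ^ 'n::finite \<Rightarrow> complex ^ 'n"
  assumes G: "holomorphic_map G W" and x0: "x0 \<in> W"
  obtains r \<gamma> where "r > 0" "\<gamma> 0 = x0"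
    "\<And>t. t \<in> ball 0 r \<Longrightarrow> \<gamma> t \<in> W \<and> (\<gamma> has_derivative (\<lambda>h. h *s G (\<gamma> t))) (at t)"
proof -
  obtain d L where dL: "d > 0" "L \<ge> 0" "ball x0 d \<subseteq> W"
    "\<And>x y. x \<in> ball x0 d \<Longrightarrow> y \<in> ball x0 d \<Longrightarrow> norm (G x - G y) \<le> L * norm (x - y)"
    using holomorphic_map_locally_Lipschitz[OF G x0] by metis
  define \<delta> where "\<delta> = d / 2"
  have \<delta>: "\<delta> > 0" "cball x0 \<delta> \<subseteq> ball x0 d" using dL(1) by (auto simp: \<delta>_def)
  define B where "B = norm (G x0) + L * d + 1"
  have B1: "B > 0" using dL by (simp add: B_def add_nonneg_pos)
  have B: "norm (G x) \<le> B" if "x \<in> cball x0 \<delta>" for x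
  proof -
    have "norm (G x) \<le> norm (G x0) + norm (G x - G x0)" using norm_triangle_ineq[of "G x0" "G x - G x0"] by simp
    also have "norm (G x - G x0) \<le> L * norm (x - x0)" using that \<delta> dL by (intro dL(4)) auto
    also have "\<dots> \<le> L * d" using that \<delta>(2) dL(2) by (intro mult_left_mono) (auto simp: dist_norm norm_minus_commute)
    finally show ?thesis by (simp add: B_def)
  qed
  \<comment> \<open>The first bound keeps the iterates in the ball of radius \<open>\<delta>\<close>, the second makes the iteration contract.\<close>
  define r where "r = min (\<delta> / B) (1 / (2 * (L + 1)))"
  have r: "r > 0" "B * r \<le> \<delta>" "L * r \<le> 1 / 2"
  proof -
    show "r > 0" using \<delta> B1 dL by (simp add: r_def)
    show "B * r \<le> \<delta>" using B1 mult_left_mono[of r "\<delta> / B" B] by (simp add: r_def)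
    have "L * r \<le> (L + 1) * (1 / (2 * (L + 1)))" using dL \<open>r > 0\<close> by (intro mult_mono) (auto simp: r_def)
    also have "\<dots> = 1 / 2" using dL(2) by (simp add: field_simps)
    finally show "L * r \<le> 1 / 2" .
  qed
  define D where "D = ball (0::complex) r"
  have D: "open D" "convex D" "0 \<in> D" "\<And>t. t \<in> D \<Longrightarrow> norm t < r" using r by (auto simp: D_def)
  define good where "good = (\<lambda>\<gamma>. (\<forall>t\<in>D. \<gamma> t \<in> cball x0 \<delta>) \<and> (\<forall>k. (\<lambda>t. \<gamma> t $ k) holomorphic_on D))"
  have step: "\<exists>\<eta>. good \<eta> \<and> \<eta> 0 = x0 \<and> (\<forall>t\<in>D. (\<eta> has_derivative (\<lambda>h. h *s G (\<gamma> t))) (at t))" if \<gamma>: "good \<gamma>" for \<gamma>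
  proof -
    have W: "\<gamma> t \<in> W" if "t \<in> D" for t
    proof -
      have "\<gamma> t \<in> cball x0 \<delta>" using \<gamma> that by (simp add: good_def)
      then show ?thesis using \<delta>(2) dL(3) by blast
    qed
    have d\<gamma>: "(\<gamma> has_derivative (\<lambda>h. h *s (\<chi> k. deriv (\<lambda>t. \<gamma> t $ k) t))) (at t)" if "t \<in> D" for t
      unfolding has_derivative_smult_iff using \<gamma> that holomorphic_derivI[OF _ D(1)] by (simp add: good_def)
    have "(\<lambda>t. G (\<gamma> t) $ k) holomorphic_on D" for k
      unfolding holomorphic_on_open[OF D(1)]
      using holomorphic_mv_along_curve[OF _ d\<gamma> W, of "\<lambda>x. G x $ k"] G by (auto simp: holomorphic_map_def)
    then have "\<exists>g. \<forall>t\<in>D. (g has_field_derivative G (\<gamma> t) $ k) (at t)" for k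
      using holomorphic_convex_primitive'[OF D(2,1)] at_within_open[OF _ D(1)] by metis
    then obtain g where g: "\<And>k t. t \<in> D \<Longrightarrow> (g k has_field_derivative G (\<gamma> t) $ k) (at t)" by metis
    define \<eta> where "\<eta> = (\<lambda>t. \<chi> k. x0 $ k + (g k t - g k 0))"
    have d: "(\<eta> has_derivative (\<lambda>h. h *s G (\<gamma> t))) (at t)" if "t \<in> D" for t
      unfolding has_derivative_smult_iff \<eta>_def using g[OF that] by (auto intro!: derivative_eq_intros)
    have \<eta>0: "\<eta> 0 = x0" by (simp add: \<eta>_def vec_eq_iff)
    have "\<eta> t \<in> cball x0 \<delta>" if t: "t \<in> D" for t
    proof -
      have "norm (\<eta> t - \<eta> 0) \<le> B * norm (t - 0)"
        by (rule difference_bound[of D \<eta> "\<lambda>t. G (\<gamma> t)"])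
          (use d D t B \<gamma> in \<open>auto simp: good_def intro: has_derivative_at_withinI\<close>)
      also have "\<dots> \<le> B * r" using D(4)[OF t] B1 by (intro mult_left_mono) auto
      finally show ?thesis using r(2) \<eta>0 by (simp add: dist_norm norm_minus_commute)
    qed
    moreover have "(\<lambda>t. \<eta> t $ k) holomorphic_on D" for k
      unfolding holomorphic_on_open[OF D(1)] using d unfolding has_derivative_smult_iff by blast
    ultimately have "good \<eta>" by (simp add: good_def)
    then show ?thesis using d \<eta>0 by blast
  qed
  then obtain P where P: "\<And>\<gamma>. good \<gamma> \<Longrightarrow> good (P \<gamma>)" "\<And>\<gamma>. good \<gamma> \<Longrightarrow> P \<gamma> 0 = x0"
    "\<And>\<gamma> t. good \<gamma> \<Longrightarrow> t \<in> D \<Longrightarrow> (P \<gamma> has_derivative (\<lambda>h. h *s G (\<gamma> t))) (at t)"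
    by metis
  have contraction: "norm (P \<gamma> t - P \<gamma>' t) \<le> e / 2"
    if g: "good \<gamma>" "good \<gamma>'" and e: "\<And>t. t \<in> D \<Longrightarrow> norm (\<gamma> t - \<gamma>' t) \<le> e" and t: "t \<in> D" for \<gamma> \<gamma>' e t
  proof -
    have e0: "e \<ge> 0" using order_trans[OF norm_ge_zero e[OF t]] .
    define \<eta> where "\<eta> = (\<lambda>t. P \<gamma> t - P \<gamma>' t)"
    have "norm (\<eta> t - \<eta> 0) \<le> (L * e) * norm (t - 0)"
    proof (rule difference_bound[of D \<eta> "\<lambda>t. G (\<gamma> t) - G (\<gamma>' t)"])
      fix s assume s: "s \<in> D"
      have "(\<eta> has_derivative (\<lambda>h. h *s G (\<gamma> s) - h *s G (\<gamma>' s))) (at s)"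
        unfolding \<eta>_def by (intro has_derivative_diff P g s)
      then show "(\<eta> has_derivative (\<lambda>h. h *s (G (\<gamma> s) - G (\<gamma>' s)))) (at s within D)"
        by (simp add: vec.scale_right_diff_distrib has_derivative_at_withinI)
      have "norm (G (\<gamma> s) - G (\<gamma>' s)) \<le> L * norm (\<gamma> s - \<gamma>' s)"
        using g s unfolding good_def by (intro dL(4) subsetD[OF \<delta>(2)]) auto
      also have "\<dots> \<le> L * e" using e[OF s] dL(2) by (rule mult_left_mono)
      finally show "norm (G (\<gamma> s) - G (\<gamma>' s)) \<le> L * e" .
    qed (use D t in auto)
    also have "\<dots> \<le> (L * e) * r" using D(4)[OF t] dL(2) e0 by (intro mult_left_mono) auto
    also have "\<dots> = e * (L * r)" by simp
    also have "\<dots> \<le> e * (1 / 2)" using r(3) e0 by (rule mult_left_mono)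
    finally show ?thesis using P(2)[OF g(1)] P(2)[OF g(2)] by (simp add: \<eta>_def)
  qed
  define g where "g = (\<lambda>n. (P ^^ n) (\<lambda>_. x0))"
  have gSuc: "g (Suc n) = P (g n)" for n by (simp add: g_def)
  have good: "good (g n)" for n
  proof (induction n)
    case 0
    show ?case using \<delta>(1) by (simp add: g_def good_def)
  next
    case (Suc n)
    then show ?case using P(1) gSuc by simp
  qed
  have diff: "norm (g (Suc n) t - g n t) \<le> \<delta> * (1/2) ^ n" if "t \<in> D" for n t
    using that
  proof (induction n arbitrary: t)
    case 0
    then show ?case using good[of 1] by (simp add: good_def g_def dist_norm norm_minus_commute)
  next
    case (Suc n)
    have "norm (P (g (Suc n)) t - P (g n) t) \<le> (\<delta> * (1/2) ^ n) / 2"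
      by (rule contraction[OF good good Suc.IH Suc.prems])
    then show ?case by (simp add: gSuc)
  qed
  define s where "s = (\<lambda>t. suminf (\<lambda>n. g (Suc n) t - g n t))"
  have "uniform_limit D (\<lambda>n t. \<Sum>i<n. g (Suc i) t - g i t) s sequentially"
    unfolding s_def by (rule Weierstrass_m_test[OF diff]) (auto intro: summable_mult summable_geometric)
  moreover have "(\<Sum>i<n. g (Suc i) t - g i t) = g n t - x0" for n t
    using sum_lessThan_telescope[of "\<lambda>i. g i t" n] by (simp add: g_def)
  ultimately have lim: "uniform_limit D (\<lambda>n t. g n t - x0) s sequentially" by simp
  define \<gamma> where "\<gamma> = (\<lambda>t. x0 + s t)"
  have conv: "\<forall>\<^sub>F n in sequentially. \<forall>t\<in>D. norm (g n t - \<gamma> t) < e" if "e > 0" for e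
    using uniform_limitD[OF lim that] by (simp add: \<gamma>_def dist_norm algebra_simps)
  have glim: "uniform_limit D g \<gamma> sequentially"
    unfolding uniform_limit_iff using conv by (simp add: dist_norm)
  have "\<gamma> t \<in> cball x0 \<delta>" if t: "t \<in> D" for t
    by (rule Lim_in_closed_set[OF closed_cball _ _ tendsto_uniform_limitI[OF glim t]])
      (use good t in \<open>auto simp: good_def\<close>)
  moreover have "(\<lambda>t. \<gamma> t $ k) holomorphic_on D" for k
  proof (rule holomorphic_uniform_sequence[OF D(1)])
    show "(\<lambda>t. g n t $ k) holomorphic_on D" for n using good[of n] by (simp add: good_def)
    fix t assume "t \<in> D"
    then obtain e where e: "e > 0" "cball t e \<subseteq> D" using D(1) open_contains_cball by blast
    have "uniform_limit D (\<lambda>n t. g n t $ k) (\<lambda>t. \<gamma> t $ k) sequentially"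
      by (rule bounded_linear.uniform_limit[OF bounded_linear_vec_nth glim])
    then show "\<exists>d>0. cball t d \<subseteq> D \<and> uniform_limit (cball t d) (\<lambda>n t. g n t $ k) (\<lambda>t. \<gamma> t $ k) sequentially"
      using e uniform_limit_on_subset by blast
  qed
  ultimately have g\<gamma>: "good \<gamma>" by (simp add: good_def)
  have fixp: "P \<gamma> t = \<gamma> t" if t: "t \<in> D" for t
  proof -
    have "norm (P \<gamma> t - \<gamma> t) \<le> e" if e: "e > 0" for e
    proof -
      obtain N where N: "\<And>n t. n \<ge> N \<Longrightarrow> t \<in> D \<Longrightarrow> norm (g n t - \<gamma> t) < e / 2"
        using conv[of "e / 2"] e unfolding eventually_sequentially by auto
      have "norm (P (g N) t - P \<gamma> t) \<le> (e / 2) / 2"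
        by (rule contraction[OF good g\<gamma> _ t]) (use N[of N] in \<open>auto intro: less_imp_le\<close>)
      moreover have "norm (P (g N) t - \<gamma> t) < e / 2" using N[of "Suc N"] t by (simp add: gSuc)
      ultimately show ?thesis
        using norm_triangle_ineq[of "P \<gamma> t - P (g N) t" "P (g N) t - \<gamma> t"] e by (simp add: norm_minus_commute)
    qed
    then have "norm (P \<gamma> t - \<gamma> t) \<le> 0" by (rule field_le_epsilon[of _ 0, simplified])
    then show ?thesis by simp
  qed
  have "(\<gamma> has_derivative (\<lambda>h. h *s G (\<gamma> t))) (at t)" if "t \<in> D" for t
    by (rule has_derivative_transform_within_open[OF P(3)[OF g\<gamma> that] D(1) that]) (rule fixp)
  moreover have "\<gamma> 0 = x0" using fixp[OF D(3)] P(2)[OF g\<gamma>] by simp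
  moreover have "\<gamma> t \<in> W" if "t \<in> D" for t
  proof -
    have "\<gamma> t \<in> cball x0 \<delta>" using g\<gamma> that by (simp add: good_def)
    then show ?thesis using \<delta>(2) dL(3) by blast
  qed
  ultimately show ?thesis using that[of r \<gamma>] r(1) by (simp add: D_def)
qed

text \<open>On a disc of radius at most \<open>1 / (2 * K)\<close> the mean value inequality bounds the maximum of \<open>F\<close> by
  half of itself.\<close>

lemma linear_differential_inequality_zero:
  fixes F :: "complex \<Rightarrow> complex ^ 'n::finite"
  assumes r: "r > 0" and d: "\<And>t. t \<in> ball 0 r \<Longrightarrow> (F has_derivative (\<lambda>h. h *s F' t)) (at t)"
    and K: "\<And>t. t \<in> ball 0 r \<Longrightarrow> norm (F' t) \<le> K * norm (F t)" and 0: "F 0 = 0"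
  shows "\<exists>r'>0. r' \<le> r \<and> (\<forall>t\<in>ball 0 r'. F t = 0)"
proof -
  define K' where "K' = max K 1"
  define r' where "r' = min (r / 2) (1 / (2 * K'))"
  have K': "K' > 0" "K \<le> K'" by (auto simp: K'_def)
  have r': "r' > 0" "r' < r" "K' * r' \<le> 1 / 2"
    using r K' mult_left_mono[of r' "1 / (2 * K')" K'] by (auto simp: r'_def)
  have sub: "cball 0 r' \<subseteq> ball (0::complex) r" using r' by auto
  have cont: "continuous_on (cball 0 r') (\<lambda>t. norm (F t))"
    using d sub by (intro continuous_on_norm continuous_at_imp_continuous_on ballI) (meson has_derivative_continuous subsetD)
  obtain t0 where t0: "t0 \<in> cball 0 r'" "\<And>t. t \<in> cball 0 r' \<Longrightarrow> norm (F t) \<le> norm (F t0)"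
    using continuous_attains_sup[OF compact_cball _ cont] r' by auto
  have "norm (F t0 - F 0) \<le> (K' * norm (F t0)) * norm (t0 - 0)"
  proof (rule difference_bound[of "cball 0 r'" F F'])
    fix t :: complex assume t: "t \<in> cball 0 r'"
    show "(F has_derivative (\<lambda>h. h *s F' t)) (at t within cball 0 r')"
      using d[OF subsetD[OF sub t]] by (rule has_derivative_at_withinI)
    have "norm (F' t) \<le> K * norm (F t)" using K sub t by blast
    also have "\<dots> \<le> K' * norm (F t0)" using K' t0(2)[OF t] by (intro mult_mono) auto
    finally show "norm (F' t) \<le> K' * norm (F t0)" .
  qed (use t0 r' in auto)
  also have "\<dots> \<le> (K' * norm (F t0)) * r'" using t0(1) K' by (intro mult_left_mono) auto
  also have "\<dots> = norm (F t0) * (K' * r')" by simp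
  also have "\<dots> \<le> norm (F t0) * (1 / 2)" using r'(3) by (intro mult_left_mono) auto
  finally have "norm (F t0) \<le> 0" using 0 by simp
  then have "F t = 0" if "t \<in> ball 0 r'" for t
    using t0(2)[of t] that by simp
  then show ?thesis using r' by (intro exI[of _ r']) auto
qed

context projective_mfd
begin

text \<open>The components of \<open>\<Phi> (\<gamma> t)\<close> outside \<open>J\<close> measure the distance of \<open>\<gamma> t\<close> from \<open>M\<close>.  As \<open>G\<close> is tangent to
  \<open>M\<close> along \<open>M\<close> and everything is Lipschitz, their derivative is bounded by a multiple of themselves,
  and they vanish at the start.\<close>

lemma solutions_stay_in_manifold:
  assumes lc: "local_chart i U V \<Phi> \<Psi> J" and G: "holomorphic_map G W"
    and x0: "x0 \<in> affine_part i" "x0 \<in> U" "x0 \<in> W"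
    and tang: "\<And>x k. x \<in> affine_part i \<Longrightarrow> x \<in> U \<Longrightarrow> x \<in> W \<Longrightarrow> k \<notin> J \<Longrightarrow> mapd \<Phi> x (G x) $ k = 0"
    and r: "r > 0" and \<gamma>: "\<gamma> 0 = x0" "\<And>t. t \<in> ball 0 r \<Longrightarrow> (\<gamma> has_derivative (\<lambda>h. h *s G (\<gamma> t))) (at t)"
  shows "\<exists>r'>0. r' \<le> r \<and> (\<forall>t\<in>ball 0 r'. \<gamma> t \<in> affine_part i)"
proof -
  note c = local_chartD[OF lc]
  define y0 where "y0 = \<Phi> x0"
  have y0J: "y0 $ k = 0" if "k \<notin> J" for k using c(10)[OF x0(2)] x0(1) that by (simp add: y0_def)
  obtain d1 L1 where \<Phi>: "d1 > 0" "L1 \<ge> 0" "ball x0 d1 \<subseteq> U"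
    "\<And>x v. x \<in> ball x0 d1 \<Longrightarrow> norm (mapd \<Phi> x v) \<le> L1 * norm v"
    "\<And>x y v. x \<in> ball x0 d1 \<Longrightarrow> y \<in> ball x0 d1 \<Longrightarrow> norm (mapd \<Phi> x v - mapd \<Phi> y v) \<le> L1 * norm (x - y) * norm v"
    using holomorphic_map_locally_Lipschitz[OF c(3) x0(2)] by (metis centre_in_ball)
  obtain d2 L2 where GL: "d2 > 0" "L2 \<ge> 0" "ball x0 d2 \<subseteq> W"
    "\<And>x y. x \<in> ball x0 d2 \<Longrightarrow> y \<in> ball x0 d2 \<Longrightarrow> norm (G x - G y) \<le> L2 * norm (x - y)"
    using holomorphic_map_locally_Lipschitz[OF G x0(3)] by metis
  obtain d3 L3 where \<Psi>: "d3 > 0" "L3 \<ge> 0" "ball y0 d3 \<subseteq> V"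
    "\<And>x y. x \<in> ball y0 d3 \<Longrightarrow> y \<in> ball y0 d3 \<Longrightarrow> norm (\<Psi> x - \<Psi> y) \<le> L3 * norm (x - y)"
    using holomorphic_map_locally_Lipschitz[OF c(4) c(5)[OF x0(2)]] unfolding y0_def by metis
  define d where "d = min d1 d2"
  have d: "d > 0" "ball x0 d \<subseteq> ball x0 d1" "ball x0 d \<subseteq> ball x0 d2" using \<Phi>(1) GL(1) by (auto simp: d_def)
  \<comment> \<open>The projections to the model subspace of \<open>M\<close> and to its complement.\<close>
  define pr where "pr = (\<lambda>y :: complex ^ 'n. \<chi> k. if k \<in> J then y $ k else 0)"
  define qr where "qr = (\<lambda>y :: complex ^ 'n. \<chi> k. if k \<in> J then 0 else y $ k)"
  have prqr: "y - pr y = qr y" for y by (simp add: pr_def qr_def vec_eq_iff)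
  have npr: "norm (pr y) \<le> norm y" and nqr: "norm (qr y) \<le> norm y" for y
    by (rule norm_le_componentwise_cart, simp add: pr_def qr_def)+
  have pry0: "pr y0 = y0" using y0J by (simp add: pr_def vec_eq_iff)
  have qrdiff: "qr (x - y) = qr x - qr y" for x y by (simp add: qr_def vec_eq_iff)
  have prdiff: "pr (x - y) = pr x - pr y" for x y by (simp add: pr_def vec_eq_iff)
  define e where "e = min d3 (d / (L3 + 1))"
  have e: "e > 0" "e \<le> d3" "L3 * e < d"
  proof -
    show "e > 0" "e \<le> d3" using \<Psi>(1,2) d(1) by (auto simp: e_def)
    have "L3 * e < (L3 + 1) * e" using \<open>e > 0\<close> by simp
    also have "\<dots> \<le> (L3 + 1) * (d / (L3 + 1))" using \<Psi>(2) by (intro mult_left_mono) (auto simp: e_def)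
    also have "\<dots> = d" using \<Psi>(2) by simp
    finally show "L3 * e < d" .
  qed
  define A where "A = ball x0 d \<inter> \<Phi> -` ball y0 e"
  have "A = (U \<inter> \<Phi> -` ball y0 e) \<inter> ball x0 d" using \<Phi>(3) d(2) by (auto simp: A_def)
  then have oA: "open A"
    using continuous_open_preimage[OF holomorphic_map_continuous_on[OF c(3)] c(1) open_ball] by (auto intro: open_Int)
  have x0A: "x0 \<in> A" using d(1) e(1) by (simp add: A_def y0_def)
  define B where "B = norm (G x0) + L2 * d"
  define K where "K = (L1 * L2 + L1 * B) * L3"
  have B0: "B \<ge> 0" using GL d by (simp add: B_def)
  have K0: "L1 * L2 + L1 * B \<ge> 0" using B0 \<Phi>(2) GL(2) by simp
  have key: "norm (qr (mapd \<Phi> x (G x))) \<le> K * norm (qr (\<Phi> x))" if x: "x \<in> A" for x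
  proof -
    have xd: "x \<in> ball x0 d" and xU: "x \<in> U" and ye: "\<Phi> x \<in> ball y0 e"
      using x \<Phi>(3) d(2) by (auto simp: A_def)
    have "norm (pr (\<Phi> x) - y0) \<le> norm (\<Phi> x - y0)"
      using npr[of "\<Phi> x - y0"] by (simp add: prdiff pry0)
    then have pe: "pr (\<Phi> x) \<in> ball y0 e" using ye by (simp add: dist_norm norm_minus_commute)
    have pV: "pr (\<Phi> x) \<in> V" using pe e(2) \<Psi>(3) by auto
    \<comment> \<open>The point \<open>x'\<close> of \<open>M\<close> is as close to \<open>x\<close> as \<open>qr (\<Phi> x)\<close> is to zero.\<close>
    define x' where "x' = \<Psi> (pr (\<Phi> x))"
    have x'aff: "x' \<in> affine_part i" unfolding x'_def using c(11)[OF pV] by (simp add: pr_def)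
    have "norm (x' - x0) \<le> L3 * norm (pr (\<Phi> x) - y0)"
      using \<Psi>(4)[of "pr (\<Phi> x)" y0] pe e(2) \<Psi>(1) c(7)[OF x0(2)] by (simp add: x'_def y0_def)
    also have "\<dots> \<le> L3 * e" using pe \<Psi>(2) by (intro mult_left_mono) (auto simp: dist_norm norm_minus_commute)
    also have "\<dots> < d" by (rule e(3))
    finally have x'd: "x' \<in> ball x0 d" by (simp add: dist_norm norm_minus_commute)
    have xx': "norm (x - x') \<le> L3 * norm (qr (\<Phi> x))"
      using \<Psi>(4)[of "\<Phi> x" "pr (\<Phi> x)"] ye pe e(2) c(7)[OF xU] by (simp add: x'_def prqr)
    have "mapd \<Phi> x' (G x') $ k = 0" if "k \<notin> J" for k
      using tang[OF x'aff _ _ that] x'd d(2,3) \<Phi>(3) GL(3) by blast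
    then have "qr (mapd \<Phi> x' (G x')) = 0" by (simp add: qr_def vec_eq_iff)
    then have "qr (mapd \<Phi> x (G x)) = qr (mapd \<Phi> x (G x) - mapd \<Phi> x' (G x'))" by (simp add: qrdiff)
    also have "norm \<dots> \<le> norm (mapd \<Phi> x (G x) - mapd \<Phi> x' (G x'))" by (rule nqr)
    also have "mapd \<Phi> x (G x) - mapd \<Phi> x' (G x') = mapd \<Phi> x (G x - G x') + (mapd \<Phi> x (G x') - mapd \<Phi> x' (G x'))"
      using mapd_linear(3)[OF c(3) xU] by simp
    also have "norm \<dots> \<le> L1 * (L2 * norm (x - x')) + L1 * norm (x - x') * B"
    proof (rule norm_triangle_le, rule add_mono)
      have "norm (mapd \<Phi> x (G x - G x')) \<le> L1 * norm (G x - G x')" using \<Phi>(4) xd d(2) by blast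
      also have "\<dots> \<le> L1 * (L2 * norm (x - x'))"
        by (intro mult_left_mono GL(4) subsetD[OF d(3)] xd x'd \<Phi>(2))
      finally show "norm (mapd \<Phi> x (G x - G x')) \<le> L1 * (L2 * norm (x - x'))" .
      have "norm (G x') \<le> norm (G x0) + norm (G x' - G x0)" using norm_triangle_ineq[of "G x0" "G x' - G x0"] by simp
      also have "norm (G x' - G x0) \<le> L2 * norm (x' - x0)"
        using GL(1) x'd d(3) by (intro GL(4)) auto
      also have "\<dots> \<le> L2 * d" using x'd GL(2) by (intro mult_left_mono) (auto simp: dist_norm norm_minus_commute)
      finally have "norm (G x') \<le> B" by (simp add: B_def)
      moreover have "norm (mapd \<Phi> x (G x') - mapd \<Phi> x' (G x')) \<le> L1 * norm (x - x') * norm (G x')"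
        using \<Phi>(5) xd x'd d(2) by blast
      ultimately show "norm (mapd \<Phi> x (G x') - mapd \<Phi> x' (G x')) \<le> L1 * norm (x - x') * B"
        using \<Phi>(2) by (meson mult_left_mono mult_nonneg_nonneg norm_ge_zero order_trans)
    qed
    also have "\<dots> = (L1 * L2 + L1 * B) * norm (x - x')" by (simp add: algebra_simps)
    also have "\<dots> \<le> (L1 * L2 + L1 * B) * (L3 * norm (qr (\<Phi> x)))" using xx' K0 by (rule mult_left_mono)
    also have "\<dots> = K * norm (qr (\<Phi> x))" by (simp add: K_def)
    finally show ?thesis .
  qed
  have c\<gamma>: "continuous_on (ball 0 r) \<gamma>"
    using \<gamma>(2) by (meson continuous_at_imp_continuous_on has_derivative_continuous)
  have "open (ball 0 r \<inter> \<gamma> -` A)" by (rule continuous_open_preimage[OF c\<gamma> open_ball oA])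
  moreover have "0 \<in> ball 0 r \<inter> \<gamma> -` A" using r \<gamma>(1) x0A by simp
  ultimately obtain r1 where r1: "r1 > 0" "ball 0 r1 \<subseteq> ball 0 r \<inter> \<gamma> -` A" by (rule openE)
  define F where "F = (\<lambda>t. qr (\<Phi> (\<gamma> t)))"
  have "\<exists>r'>0. r' \<le> r1 \<and> (\<forall>t\<in>ball 0 r'. F t = 0)"
  proof (rule linear_differential_inequality_zero[OF r1(1)])
    fix t :: complex assume t: "t \<in> ball 0 r1"
    then have tA: "\<gamma> t \<in> A" and tr: "t \<in> ball 0 r" using r1(2) by auto
    have "\<gamma> t \<in> U" using tA \<Phi>(3) d(2) by (auto simp: A_def)
    from holomorphic_map_along_curve[OF c(3) \<gamma>(2)[OF tr] this]
    show "(F has_derivative (\<lambda>h. h *s qr (mapd \<Phi> (\<gamma> t) (G (\<gamma> t))))) (at t)"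
      unfolding F_def has_derivative_smult_iff by (auto simp: qr_def)
    show "norm (qr (mapd \<Phi> (\<gamma> t) (G (\<gamma> t)))) \<le> K * norm (F t)"
      unfolding F_def by (rule key[OF tA])
  next
    show "F 0 = 0" using y0J by (simp add: F_def \<gamma>(1) qr_def vec_eq_iff flip: y0_def)
  qed
  then obtain r' where r': "r' > 0" "r' \<le> r1" "\<And>t. t \<in> ball 0 r' \<Longrightarrow> F t = 0" by blast
  have "\<gamma> t \<in> affine_part i" if t: "t \<in> ball 0 r'" for t
  proof -
    have "t \<in> ball 0 r1" using t r'(2) by simp
    then have "\<gamma> t \<in> A" using r1(2) by auto
    then have "\<gamma> t \<in> U" using \<Phi>(3) d(2) by (auto simp: A_def)
    moreover have "\<Phi> (\<gamma> t) $ k = 0" if "k \<notin> J" for k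
      using arg_cong[OF r'(3)[OF t], of "\<lambda>y. y $ k"] that by (simp add: F_def qr_def)
    ultimately show ?thesis using c(10) by blast
  qed
  moreover have "r' \<le> r"
  proof -
    have "ball (0::complex) r1 \<subseteq> ball 0 r" using r1(2) by auto
    then have "r1 \<le> r" using r1(1) by (simp add: ball_subset_ball_iff)
    then show ?thesis using r'(2) by simp
  qed
  ultimately show ?thesis using r'(1) by blast
qed

end

section \<open>Rational vector fields\<close>

lemma continuous_on_mvd:
  assumes F: "holomorphic_mv F V" and G: "continuous_on V G"
  shows "continuous_on V (\<lambda>x. mvd F x (G x))"
proof (rule continuous_at_imp_continuous_on, rule ballI)
  fix x0 assume x0: "x0 \<in> V"
  obtain d L where dL: "d > 0" "L \<ge> 0" "ball x0 d \<subseteq> V"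
    "\<And>x v. x \<in> ball x0 d \<Longrightarrow> norm (mvd F x v) \<le> L * norm v"
    "\<And>x y v. x \<in> ball x0 d \<Longrightarrow> y \<in> ball x0 d \<Longrightarrow> norm (mvd F x v - mvd F y v) \<le> L * norm (x - y) * norm v"
    using holomorphic_mv_locally_Lipschitz[OF F x0] by (metis centre_in_ball)
  have Gc: "(G \<longlongrightarrow> G x0) (at x0)"
    using G x0 holomorphic_mv_open[OF F] by (simp add: continuous_on_eq_continuous_at isCont_def)
  have "((\<lambda>x. mvd F x (G x) - mvd F x0 (G x0)) \<longlongrightarrow> 0) (at x0)"
  proof (rule Lim_null_comparison)
    show "\<forall>\<^sub>F x in at x0. norm (mvd F x (G x) - mvd F x0 (G x0)) \<le> L * norm (G x - G x0) + L * norm (x - x0) * norm (G x0)"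
      using eventually_at_ball[OF dL(1), of x0 UNIV]
    proof eventually_elim
      case (elim x)
      have xV: "x \<in> V" using elim dL(3) by auto
      have "mvd F x (G x) - mvd F x0 (G x0) = mvd F x (G x - G x0) + (mvd F x (G x0) - mvd F x0 (G x0))"
        using mvd_linear(2)[OF F xV] by simp
      then show ?case
        using dL(4)[of x "G x - G x0"] dL(5)[of x x0 "G x0"] elim dL(1)
        by (metis (no_types, lifting) Int_iff add_mono centre_in_ball norm_triangle_le)
    qed
    have "((\<lambda>x. L * norm (G x - G x0) + L * norm (x - x0) * norm (G x0)) \<longlongrightarrow> L * norm (G x0 - G x0) + L * norm (x0 - x0) * norm (G x0)) (at x0)"
      by (intro tendsto_intros Gc)
    then show "((\<lambda>x. L * norm (G x - G x0) + L * norm (x - x0) * norm (G x0)) \<longlongrightarrow> 0) (at x0)" by simp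
  qed
  then show "isCont (\<lambda>x. mvd F x (G x)) x0"
    unfolding isCont_def by (simp add: LIM_zero_iff)
qed

text \<open>The partial vector field with given components, as in the definition of rational vector
  fields but before tangency is known.\<close>

definition field_of :: "'n::finite cproj set \<Rightarrow> ('n \<Rightarrow> 'n \<Rightarrow> 'n cproj \<rightharpoonup> complex) \<Rightarrow> 'n cproj \<rightharpoonup> 'n tvec" where
  "field_of M a p = (if p \<in> M \<and> (\<forall>i k. p \<in> chart_dom i \<longrightarrow> p \<in> dom (a i k))
     then Some (\<chi> i k. if p \<in> chart_dom i then the (a i k p) else 0) else None)"

lemma rational_vector_field_iff:
  "rational_vector_field M X \<longleftrightarrow> (\<exists>a. (\<forall>i k. a i k \<in> rational_functions M) \<and> X = field_of M a) \<and>
     (\<forall>p w. X p = Some w \<longrightarrow> w \<in> tangent_space M p)"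
  unfolding rational_vector_field_def field_of_def fun_eq_iff by simp

lemma field_of_dom: "p \<in> dom (field_of M a) \<longleftrightarrow> p \<in> M \<and> (\<forall>i k. p \<in> chart_dom i \<longrightarrow> p \<in> dom (a i k))"
  by (simp add: dom_def field_of_def)

lemma field_of_component: "p \<in> dom (field_of M a) \<Longrightarrow> the (field_of M a p) $ i $ k = (if p \<in> chart_dom i then the (a i k p) else 0)"
  unfolding field_of_dom by (simp add: field_of_def)

context projective_mfd
begin

text \<open>The fractions that compute the components at \<open>p\<close> make sense on an open set of the ambient
  affine space, so that near \<open>p\<close> the field extends to a holomorphic map there.\<close>

lemma field_of_local_form:
  assumes a: "\<And>i k. a i k \<in> rational_functions M" and p: "p \<in> dom (field_of M a)" "p \<in> chart_dom i"
  obtains G W where "holomorphic_map G W" "chart i p \<in> W"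
    "\<And>q. q \<in> dom (field_of M a) \<Longrightarrow> q \<in> chart_dom i \<Longrightarrow> chart i q \<in> W \<Longrightarrow> the (field_of M a q) $ i = G (chart i q)"
proof -
  have "\<exists>e P Q. homogeneous e P \<and> homogeneous e Q \<and> Q (rep_cproj p) \<noteq> 0 \<and>
    (\<forall>q\<in>M. Q (rep_cproj q) \<noteq> 0 \<longrightarrow> a i k q = Some (P (rep_cproj q) / Q (rep_cproj q)))" for k
  proof -
    obtain c where "a i k p = Some c" using p by (auto simp: field_of_dom)
    then show ?thesis by (rule rational_functions_local[OF a]) blast
  qed
  then obtain e P Q where PQ: "\<And>k. homogeneous (e k) (P k)" "\<And>k. homogeneous (e k) (Q k)" "\<And>k. Q k (rep_cproj p) \<noteq> 0"
    "\<And>k q. q \<in> M \<Longrightarrow> Q k (rep_cproj q) \<noteq> 0 \<Longrightarrow> a i k q = Some (P k (rep_cproj q) / Q k (rep_cproj q))"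
    by metis
  define W where "W = (\<Inter>k. {x. Q k x \<noteq> 0})"
  define G where "G = (\<lambda>x. \<chi> k. P k x / Q k x)"
  have oW: "open W" unfolding W_def
    by (intro open_INT ballI finite open_Collect_neq homogeneous_continuous[OF PQ(2)] continuous_on_const)
  show ?thesis
  proof (rule that[of G W])
    show "holomorphic_map G W"
      unfolding holomorphic_map_def G_def vec_lambda_beta
    proof
      fix k
      show "holomorphic_mv (\<lambda>x. P k x / Q k x) W"
        by (rule holomorphic_mv_divide[OF homogeneous_holomorphic[OF PQ(1) oW] homogeneous_holomorphic[OF PQ(2) oW]])
          (simp add: W_def)
    qed
    show "chart i p \<in> W" using PQ(3) homogeneous_chart_zero_iff[OF PQ(2) p(2)] by (simp add: W_def)
    fix q assume q: "q \<in> dom (field_of M a)" "q \<in> chart_dom i" "chart i q \<in> W"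
    have "the (field_of M a q) $ i $ k = G (chart i q) $ k" for k
    proof -
      have "Q k (rep_cproj q) \<noteq> 0" using q(3) homogeneous_chart_zero_iff[OF PQ(2) q(2)] by (simp add: W_def)
      then show ?thesis
        using PQ(4)[of q k] q(1,2) homogeneous_chart_quotient[OF PQ(1) PQ(2) q(2)]
        by (simp add: field_of_component field_of_dom G_def)
    qed
    then show "the (field_of M a q) $ i = G (chart i q)" by (simp add: vec_eq_iff)
  qed
qed

lemma field_of_dom_generic:
  assumes "\<And>i k. a i k \<in> rational_functions M"
  shows "\<forall>\<^sub>F p in generic. p \<in> dom (field_of M a)"
proof -
  have "\<forall>\<^sub>F p in generic. \<forall>i. \<forall>k. p \<in> dom (a i k)"
    by (intro eventually_all_finite rational_functions_generic(1) assms)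
  with generic_in_M show ?thesis by eventually_elim (simp add: field_of_dom)
qed

lemma tangent_space_tvec_of:
  assumes "w \<in> tangent_space M p" "p \<in> chart_dom i"
  shows "w = tvec_of i p (w $ i)"
  using assms by (elim tangent_spaceD) (metis velocity_eq_tvec_of)

text \<open>Tangency in a chart and the compatibility between charts are both equations between continuous
  functions near \<open>p\<close>, and they hold at generic points.\<close>

lemma tangency_closure:
  assumes a: "\<And>i k. a i k \<in> rational_functions M"
    and gen: "\<forall>\<^sub>F p in generic. the (field_of M a p) \<in> tangent_space M p"
    and p: "p \<in> dom (field_of M a)"
  shows "the (field_of M a p) \<in> tangent_space M p"
proof -
  have pM: "p \<in> M" using p by (simp add: field_of_dom)
  obtain i where i: "p \<in> chart_dom i" using ex_chart_dom by blast
  obtain G W where G: "holomorphic_map G W" "chart i p \<in> W"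
    "\<And>q. q \<in> dom (field_of M a) \<Longrightarrow> q \<in> chart_dom i \<Longrightarrow> chart i q \<in> W \<Longrightarrow> the (field_of M a q) $ i = G (chart i q)"
    by (rule field_of_local_form[of a, OF a p i]) (rule that)
  obtain U V \<Phi> \<Psi> and J :: "'n set" where lc: "local_chart i U V \<Phi> \<Psi> J" and U: "chart i p \<in> U"
    by (rule local_chart_exists[OF pM i]) (rule that)
  note c = local_chartD[OF lc]
  define N where "N = chart_dom i \<inter> chart i -` (U \<inter> W)"
  have oN: "open N" unfolding N_def
    by (intro open_chart_preimage open_Int c(1) holomorphic_map_open[OF G(1)])
  have pN: "p \<in> N" using i U G(2) by (simp add: N_def)
  have cN: "continuous_on N (\<lambda>q. f (chart i q))" if "continuous_on (U \<inter> W) f" for f :: "complex ^ 'n \<Rightarrow> complex"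
    by (rule continuous_on_compose2[OF that continuous_on_subset[OF continuous_on_chart]]) (auto simp: N_def)
  have cG: "continuous_on (U \<inter> W) G"
    by (rule continuous_on_subset[OF holomorphic_map_continuous_on[OF G(1)]]) auto
  have "mapd \<Phi> (chart i p) (G (chart i p)) $ k = 0" if k: "k \<notin> J" for k
  proof (rule vanishing_by_density[OF oN pM pN])
    have hol: "holomorphic_mv (\<lambda>x. \<Phi> x $ k) (U \<inter> W)"
      using c(3) holomorphic_mv_subset[OF _ open_Int[OF c(1) holomorphic_map_open[OF G(1)]]]
      by (auto simp: holomorphic_map_def)
    show "continuous_on N (\<lambda>q. mapd \<Phi> (chart i q) (G (chart i q)) $ k)"
      unfolding mapd_def using cN[OF continuous_on_mvd[OF hol cG]] by simp
    show "\<forall>\<^sub>F q in generic. q \<in> N \<longrightarrow> mapd \<Phi> (chart i q) (G (chart i q)) $ k = 0"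
      using gen field_of_dom_generic[of a, OF a] generic_in_M
    proof eventually_elim
      case (elim q)
      show ?case
      proof
        assume "q \<in> N"
        then have q: "q \<in> chart_dom i" "chart i q \<in> U" "chart i q \<in> W" by (auto simp: N_def)
        then show "mapd \<Phi> (chart i q) (G (chart i q)) $ k = 0"
          using tangent_space_iff(1)[OF lc elim(3) q(1,2), of "the (field_of M a q)"] elim(1) G(3)[OF elim(2) q(1,3)] k
          by simp
      qed
    qed
  qed
  then have T: "tvec_of i p (G (chart i p)) \<in> tangent_space M p"
    using tangent_space_iff(2)[OF lc pM i U] by blast
  have "the (field_of M a p) $ j $ k = tvec_of i p (G (chart i p)) $ j $ k" for j k
  proof (cases "p \<in> chart_dom j")
    case False
    then show ?thesis using p by (simp add: field_of_component tvec_of_def)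
  next
    case True
    obtain H W' where H: "holomorphic_map H W'" "chart j p \<in> W'"
      "\<And>q. q \<in> dom (field_of M a) \<Longrightarrow> q \<in> chart_dom j \<Longrightarrow> chart j q \<in> W' \<Longrightarrow> the (field_of M a q) $ j = H (chart j q)"
      by (rule field_of_local_form[of a, OF a p True]) (rule that)
    define N' where "N' = N \<inter> (chart_dom j \<inter> chart j -` W')"
    have oN': "open N'" unfolding N'_def
      by (intro open_Int oN open_chart_preimage holomorphic_map_open[OF H(1)])
    have pN': "p \<in> N'" using pN True H(2) by (simp add: N'_def)
    have comp: "tvec_of i q v $ j $ k = (v $ k * chart i q $ j - chart i q $ k * v $ j) / (chart i q $ j)\<^sup>2"
      if "q \<in> N'" for q v
      using that by (simp add: tvec_of_def N'_def)
    have "H (chart j p) $ k - tvec_of i p (G (chart i p)) $ j $ k = 0"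
    proof (rule vanishing_by_density[OF oN' pM pN'])
      have "continuous_on N' (\<lambda>q. H (chart j q))"
        by (rule continuous_on_compose2[OF holomorphic_map_continuous_on[OF H(1)] continuous_on_subset[OF continuous_on_chart]])
          (auto simp: N'_def)
      moreover have "continuous_on N' (\<lambda>q. G (chart i q))"
        by (rule continuous_on_compose2[OF cG continuous_on_subset[OF continuous_on_chart]]) (auto simp: N'_def N_def)
      moreover have "continuous_on N' (chart i)"
        by (rule continuous_on_subset[OF continuous_on_chart]) (auto simp: N'_def N_def)
      moreover have "chart i q $ j \<noteq> 0" if "q \<in> N'" for q
        using that chart_in_other_dom[of q i j] by (auto simp: N'_def N_def)
      ultimately have "continuous_on N' (\<lambda>q. H (chart j q) $ k - (G (chart i q) $ k * chart i q $ j - chart i q $ k * G (chart i q) $ j) / (chart i q $ j)\<^sup>2)"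
        by (intro continuous_intros) auto
      then show "continuous_on N' (\<lambda>q. H (chart j q) $ k - tvec_of i q (G (chart i q)) $ j $ k)"
        by (rule continuous_on_eq) (simp add: comp)
      show "\<forall>\<^sub>F q in generic. q \<in> N' \<longrightarrow> H (chart j q) $ k - tvec_of i q (G (chart i q)) $ j $ k = 0"
        using gen field_of_dom_generic[of a, OF a]
      proof eventually_elim
        case (elim q)
        show ?case
        proof
          assume "q \<in> N'"
          then have q: "q \<in> chart_dom i" "chart i q \<in> W" "q \<in> chart_dom j" "chart j q \<in> W'"
            by (auto simp: N_def N'_def)
          have "the (field_of M a q) = tvec_of i q (G (chart i q))"
            using tangent_space_tvec_of[OF elim(1) q(1)] G(3)[OF elim(2) q(1,2)] by simp
          then show "H (chart j q) $ k - tvec_of i q (G (chart i q)) $ j $ k = 0"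
            using H(3)[OF elim(2) q(3,4)] by simp
        qed
      qed
    qed
    then show ?thesis using H(3)[OF p True H(2)] by simp
  qed
  then have "the (field_of M a p) = tvec_of i p (G (chart i p))" by (simp add: vec_eq_iff)
  then show ?thesis using T by simp
qed

lemma rational_vector_field_generic:
  assumes "rational_vector_field M X"
  shows "\<forall>\<^sub>F p in generic. p \<in> dom X" "\<forall>\<^sub>F p in generic. the (X p) \<in> tangent_space M p"
proof -
  show *: "\<forall>\<^sub>F p in generic. p \<in> dom X"
    using assms field_of_dom_generic unfolding rational_vector_field_iff by blast
  show "\<forall>\<^sub>F p in generic. the (X p) \<in> tangent_space M p"
    using * by eventually_elim (use assms in \<open>auto simp: rational_vector_field_iff\<close>)
qed

subsection \<open>Integral curves and first integrals\<close>

text \<open>Solve the equation for the ambient extension \<open>G\<close> of the field; near its start the solution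
  stays in the affine part of \<open>M\<close> and in the cone over \<open>N\<close>.\<close>

lemma integral_curve_exists:
  assumes X: "rational_vector_field M X" and p: "p \<in> M" and N: "open N" "p \<in> N"
    and dom: "\<And>q. q \<in> M \<Longrightarrow> q \<in> N \<Longrightarrow> q \<in> dom X"
  shows "\<exists>r>0. \<exists>\<gamma>. integral_curve M X (ball 0 r) \<gamma> \<and> \<gamma> 0 = p \<and> \<gamma> ` ball 0 r \<subseteq> N"
proof -
  obtain a where a: "\<And>i k. a i k \<in> rational_functions M" "X = field_of M a"
    and tan: "\<And>p w. X p = Some w \<Longrightarrow> w \<in> tangent_space M p"
    using X unfolding rational_vector_field_iff by blast
  have pd: "p \<in> dom (field_of M a)" using dom p N a(2) by blast
  obtain i where i: "p \<in> chart_dom i" using ex_chart_dom by blast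
  obtain G W where G: "holomorphic_map G W" "chart i p \<in> W"
    "\<And>q. q \<in> dom (field_of M a) \<Longrightarrow> q \<in> chart_dom i \<Longrightarrow> chart i q \<in> W \<Longrightarrow> the (field_of M a q) $ i = G (chart i q)"
    by (rule field_of_local_form[of a, OF a(1) pd i]) (rule that)
  obtain U V \<Phi> \<Psi> and J :: "'n set" where lc: "local_chart i U V \<Phi> \<Psi> J" and U: "chart i p \<in> U"
    by (rule local_chart_exists[OF p i]) (rule that)
  \<comment> \<open>The solution must not leave the cone over \<open>N\<close>.\<close>
  define W' where "W' = W \<inter> {x. x \<noteq> 0 \<and> abs_cproj x \<in> N}"
  have oW': "open W'" unfolding W'_def
    using holomorphic_map_open[OF G(1)] N(1) by (intro open_Int) (auto simp: open_cproj_iff)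
  have pW': "chart i p \<in> W'" using G(2) N(2) i chart_nonzero[OF i] by (simp add: W'_def)
  have G': "holomorphic_map G W'" by (rule holomorphic_map_subset[OF G(1) oW']) (auto simp: W'_def)
  have field: "abs_cproj x \<in> dom X \<and> the (X (abs_cproj x)) = tvec_of i (abs_cproj x) (G x) \<and>
      the (X (abs_cproj x)) \<in> tangent_space M (abs_cproj x) \<and> the (X (abs_cproj x)) $ i = G x"
    if x: "x \<in> affine_part i" "x \<in> W'" for x
  proof -
    define q where "q = abs_cproj x"
    have q: "q \<in> M" "q \<in> chart_dom i" "chart i q = x" using affine_partD[OF x(1)] by (auto simp: q_def)
    have qN: "q \<in> N" "chart i q \<in> W" using x(2) q(3) by (auto simp: W'_def q_def)
    have d: "q \<in> dom X" using dom q(1) qN(1) by blast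
    then have t: "the (X q) \<in> tangent_space M q" using tan by auto
    have "the (X q) $ i = G x" using G(3)[of q] d q qN a(2) by simp
    then show ?thesis using d t tangent_space_tvec_of[OF t q(2)] unfolding q_def by simp
  qed
  have x0: "chart i p \<in> affine_part i" using chart_in_affine_part[OF i] p by simp
  obtain r \<gamma> where ode: "r > 0" "\<gamma> 0 = chart i p"
    "\<And>t. t \<in> ball 0 r \<Longrightarrow> \<gamma> t \<in> W' \<and> (\<gamma> has_derivative (\<lambda>h. h *s G (\<gamma> t))) (at t)"
    by (rule holomorphic_ode_solution[OF G' pW']) (rule that)
  have "\<exists>r'>0. r' \<le> r \<and> (\<forall>t\<in>ball 0 r'. \<gamma> t \<in> affine_part i)"
  proof (rule solutions_stay_in_manifold[where \<gamma> = \<gamma> and r = r and G = G, OF lc G' x0 U pW' _ ode(1,2)])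
    fix x k assume x: "x \<in> affine_part i" "x \<in> U" "x \<in> W'" "k \<notin> J"
    have q: "abs_cproj x \<in> M" "abs_cproj x \<in> chart_dom i" "chart i (abs_cproj x) = x" using affine_partD[OF x(1)] by auto
    have xU: "chart i (abs_cproj x) \<in> U" using q(3) x(2) by simp
    have t: "the (X (abs_cproj x)) \<in> tangent_space M (abs_cproj x)" and e: "the (X (abs_cproj x)) $ i = G x"
      using field[OF x(1,3)] by blast+
    have "mapd \<Phi> (chart i (abs_cproj x)) (the (X (abs_cproj x)) $ i) $ k = 0"
      using iffD1[OF tangent_space_iff(1)[OF lc q(1,2) xU] t] x(4) by blast
    then show "mapd \<Phi> x (G x) $ k = 0" unfolding e q(3) .
  qed (use ode(3) in blast)
  then obtain r' where r': "r' > 0" "r' \<le> r" "\<And>t. t \<in> ball 0 r' \<Longrightarrow> \<gamma> t \<in> affine_part i" by blast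
  have sub: "t \<in> ball 0 r" if "t \<in> ball 0 r'" for t :: complex using that r'(2) by simp
  define \<eta> where "\<eta> = (\<lambda>t. abs_cproj (\<gamma> t))"
  have d\<gamma>: "(\<gamma> has_derivative (\<lambda>h. h *s G (\<gamma> t))) (at t)" if "t \<in> ball 0 r'" for t
    using ode(3)[OF sub[OF that]] by blast
  have lift1: "holomorphic_curve M (ball 0 r') \<eta>"
    unfolding \<eta>_def by (rule lift_curve(1)[of "ball 0 r'" \<gamma> i "\<lambda>t. G (\<gamma> t)", OF open_ball r'(3) d\<gamma>])
  have lift2: "velocity \<eta> t (tvec_of i (\<eta> t) (G (\<gamma> t)))" if "t \<in> ball 0 r'" for t
    unfolding \<eta>_def
    by (rule conjunct1[OF lift_curve(2)[of "ball 0 r'" \<gamma> i "\<lambda>t. G (\<gamma> t)", OF open_ball r'(3) d\<gamma> that]])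
  have "integral_curve M X (ball 0 r') \<eta>"
    unfolding integral_curve_def
  proof (intro conjI ballI)
    show "holomorphic_curve M (ball 0 r') \<eta>" by (rule lift1)
    show "\<eta> ` ball 0 r' \<subseteq> dom X"
    proof (rule image_subsetI)
      show "\<eta> t \<in> dom X" if "t \<in> ball 0 r'" for t
        unfolding \<eta>_def using field[OF r'(3)[OF that] conjunct1[OF ode(3)[OF sub[OF that]]]] by blast
    qed
    show "velocity \<eta> t (the (X (\<eta> t)))" if "t \<in> ball 0 r'" for t
      using lift2[OF that] field[OF r'(3)[OF that] conjunct1[OF ode(3)[OF sub[OF that]]]] by (simp add: \<eta>_def)
  qed auto
  moreover have "\<eta> 0 = p" using ode(2) i by (simp add: \<eta>_def)
  moreover have "\<eta> ` ball 0 r' \<subseteq> N" using ode(3)[OF sub] by (auto simp: \<eta>_def W'_def)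
  ultimately show ?thesis using r'(1) by blast
qed

text \<open>Around a generic point \<open>X\<close> and \<open>h\<close> are both defined, and an integral curve passes through
  it.\<close>

lemma der_zero_of_first_integral:
  assumes X: "rational_vector_field M X" and h: "h \<in> first_integrals M X"
  shows "der (\<lambda>p. the (X p)) (\<lambda>p. the (h p)) (\<lambda>p. 0)"
proof -
  have hr: "h \<in> rational_functions M" using h by (simp add: first_integrals_def)
  have "\<forall>\<^sub>F p in generic. p \<in> dom X \<and> p \<in> dom h"
    by (intro eventually_conj rational_vector_field_generic(1)[OF X] rational_functions_generic(1)[OF hr])
  from generic_open[OF this] generic_in_M has_tderiv_rational_exists[OF rational_functions_generic(2)[OF hr]]
  show ?thesis unfolding der_def
  proof eventually_elim
    case (elim p)
    obtain N where N: "open N" "p \<in> N" "\<And>q. q \<in> M \<Longrightarrow> q \<in> N \<Longrightarrow> q \<in> dom X \<and> q \<in> dom h"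
      using elim(1) by blast
    obtain c where c: "has_tderiv (\<lambda>p. the (h p)) p (the (X p)) c" using elim(3) by blast
    obtain r \<gamma> where g: "r > 0" "integral_curve M X (ball 0 r) \<gamma>" "\<gamma> 0 = p" "\<gamma> ` ball 0 r \<subseteq> N"
      using integral_curve_exists[OF X elim(2) N(1,2)] N(3) by blast
    have gM: "\<gamma> ` ball 0 r \<subseteq> M" using g(2) by (auto simp: integral_curve_def holomorphic_curve_def)
    have "\<gamma> ` ball 0 r \<subseteq> dom h" using gM g(4) N(3) by blast
    then have "(\<lambda>t. h (\<gamma> t)) constant_on ball 0 r" using h g(2) by (auto simp: first_integrals_def)
    then obtain y where y: "\<And>t. t \<in> ball 0 r \<Longrightarrow> h (\<gamma> t) = y" unfolding constant_on_def by blast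
    have 0: "0 \<in> ball (0::complex) r" using g(1) by simp
    have "((\<lambda>s. the (h (\<gamma> s))) has_field_derivative c) (at 0)"
      using c g(2,3) 0 holomorphic_curve_eventually[of "ball 0 r" \<gamma> 0]
      unfolding has_tderiv_def integral_curve_def by blast
    moreover have "((\<lambda>s. the (h (\<gamma> s))) has_field_derivative 0) (at 0)"
      by (rule has_field_derivative_transform_within_open[OF DERIV_const[of "the y"] open_ball 0]) (simp add: y)
    ultimately have "c = 0" by (rule DERIV_unique)
    then show ?case using c by simp
  qed
qed

text \<open>An integral curve may run entirely through points that are not generic, so \<open>X h = 0\<close> is first
  extended by continuity to all points where \<open>X\<close> and \<open>h\<close> are regular.\<close>

lemma first_integral_of_der_zero:
  assumes X: "rational_vector_field M X" and h: "h \<in> rational_functions M"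
    and der: "der (\<lambda>p. the (X p)) (\<lambda>p. the (h p)) (\<lambda>p. 0)"
  shows "h \<in> first_integrals M X"
  unfolding first_integrals_def
proof (intro CollectI conjI h allI impI)
  fix T \<gamma> assume *: "integral_curve M X T \<gamma> \<and> \<gamma> ` T \<subseteq> dom h"
  obtain a where a: "\<And>i k. a i k \<in> rational_functions M" "X = field_of M a"
    using X unfolding rational_vector_field_iff by blast
  have T: "open T" "connected T" and hc: "holomorphic_curve M T \<gamma>" and dX: "\<And>t. t \<in> T \<Longrightarrow> \<gamma> t \<in> dom X"
    and vel: "\<And>t. t \<in> T \<Longrightarrow> velocity \<gamma> t (the (X (\<gamma> t)))" and dh: "\<And>t. t \<in> T \<Longrightarrow> \<gamma> t \<in> dom h"
    using * by (auto simp: integral_curve_def holomorphic_curve_def)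
  have "((\<lambda>s. the (h (\<gamma> s))) has_field_derivative 0) (at t)" if t: "t \<in> T" for t
  proof -
    define p where "p = \<gamma> t"
    have pd: "p \<in> dom (field_of M a)" using dX[OF t] a(2) by (simp add: p_def)
    then have pM: "p \<in> M" by (simp add: field_of_dom)
    obtain i where i: "p \<in> chart_dom i" using ex_chart_dom by blast
    obtain G W where G: "holomorphic_map G W" "chart i p \<in> W"
      "\<And>q. q \<in> dom (field_of M a) \<Longrightarrow> q \<in> chart_dom i \<Longrightarrow> chart i q \<in> W \<Longrightarrow> the (field_of M a q) $ i = G (chart i q)"
      by (rule field_of_local_form[of a, OF a(1) pd i]) (rule that)
    obtain y where "h p = Some y" using dh[OF t] by (auto simp: p_def)
    then obtain d P Q where PQ: "homogeneous d P" "homogeneous d Q" "Q (rep_cproj p) \<noteq> 0"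
      "\<And>q. q \<in> M \<Longrightarrow> Q (rep_cproj q) \<noteq> 0 \<Longrightarrow> h q = Some (P (rep_cproj q) / Q (rep_cproj q))"
      by (rule rational_functions_local[OF h]) (rule that)
    define W' where "W' = W \<inter> {x. Q x \<noteq> 0}"
    have oW': "open W'" unfolding W'_def
      using holomorphic_map_open[OF G(1)] homogeneous_continuous[OF PQ(2)] by (intro open_Int open_Collect_neq) auto
    define F where "F = (\<lambda>x. P x / Q x)"
    have F: "holomorphic_mv F W'" unfolding F_def
      by (rule holomorphic_mv_divide[OF homogeneous_holomorphic[OF PQ(1) oW'] homogeneous_holomorphic[OF PQ(2) oW']])
        (auto simp: W'_def)
    define N where "N = chart_dom i \<inter> chart i -` W'"
    have oN: "open N" unfolding N_def by (rule open_chart_preimage[OF oW'])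
    have pN: "p \<in> N" using i G(2) PQ(3) homogeneous_chart_zero_iff[OF PQ(2) i] by (simp add: N_def W'_def)
    have td: "has_tderiv (\<lambda>q. the (h q)) q w (mvd F (chart i q) (w $ i))" if q: "q \<in> N" for q w
    proof (rule has_tderiv_cong_local[OF oN q])
      have qi: "q \<in> chart_dom i" "Q (chart i q) \<noteq> 0" using q by (auto simp: N_def W'_def)
      then have "Q (rep_cproj q) \<noteq> 0" using homogeneous_chart_zero_iff[OF PQ(2)] by blast
      then show "has_tderiv (\<lambda>q. P (rep_cproj q) / Q (rep_cproj q)) q w (mvd F (chart i q) (w $ i))"
        unfolding F_def by (rule has_tderiv_form_quotient[OF PQ(1,2) _ qi(1)])
      fix q' assume q': "q' \<in> M" "q' \<in> N"
      then have "Q (rep_cproj q') \<noteq> 0" using homogeneous_chart_zero_iff[OF PQ(2)] by (auto simp: N_def W'_def)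
      then show "P (rep_cproj q') / Q (rep_cproj q') = the (h q')" using PQ(4)[OF q'(1)] by simp
    qed
    have "mvd F (chart i p) (G (chart i p)) = 0"
    proof (rule vanishing_by_density[OF oN pM pN])
      have "continuous_on W' G"
        by (rule continuous_on_subset[OF holomorphic_map_continuous_on[OF G(1)]]) (auto simp: W'_def)
      from continuous_on_mvd[OF F this] show "continuous_on N (\<lambda>q. mvd F (chart i q) (G (chart i q)))"
        by (rule continuous_on_compose2[OF _ continuous_on_subset[OF continuous_on_chart]]) (auto simp: N_def)
      show "\<forall>\<^sub>F q in generic. q \<in> N \<longrightarrow> mvd F (chart i q) (G (chart i q)) = 0"
        using der[unfolded der_def] rational_vector_field_generic(1)[OF X] rational_vector_field_generic(2)[OF X]
      proof eventually_elim
        case (elim q)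
        show ?case
        proof
          assume q: "q \<in> N"
          have "mvd F (chart i q) (the (X q) $ i) = 0"
            using has_tderiv_unique[OF elim(3) td[OF q] elim(1)] .
          moreover have "the (X q) $ i = G (chart i q)"
            using G(3)[of q] elim(2) q a(2) by (auto simp: N_def W'_def)
          ultimately show "mvd F (chart i q) (G (chart i q)) = 0" by simp
        qed
      qed
    qed
    moreover have "the (X p) $ i = G (chart i p)" using G(3)[OF pd i G(2)] a(2) by simp
    ultimately have "has_tderiv (\<lambda>q. the (h q)) p (the (X p)) 0" using td[OF pN, of "the (X p)"] by simp
    then show ?thesis
      using vel[OF t] holomorphic_curve_eventually[OF hc t] unfolding has_tderiv_def p_def by blast
  qed
  then have const: "the (h (\<gamma> t)) = the (h (\<gamma> t'))" if "t \<in> T" "t' \<in> T" for t t'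
    by (intro has_derivative_zero_unique_connected[OF T _ that])
      (simp add: has_field_derivative_def lambda_zero)
  define y where "y = the (h (\<gamma> (SOME t. t \<in> T)))"
  have y: "the (h (\<gamma> t)) = y" if "t \<in> T" for t
    unfolding y_def by (rule const[OF that someI[of "\<lambda>t. t \<in> T", OF that]])
  show "(\<lambda>t. h (\<gamma> t)) constant_on T"
    unfolding constant_on_def
  proof (intro exI[of _ "Some y"] ballI)
    fix t assume t: "t \<in> T"
    show "h (\<gamma> t) = Some y" using y[OF t] dh[OF t] by auto
  qed
qed

section \<open>Construction of the vector field\<close>

text \<open>A linear system at a generic point \<open>p\<close>: the unknowns are the coordinates of \<open>w\<close> with respect to
  \<open>m\<close> tangent vectors coming from a chart, and one homogenising unknown \<open>b None\<close> that multiplies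
  \<open>\<epsilon>\<close>.  There are \<open>s \<le> m\<close> equations for \<open>m + 1\<close> unknowns, so a nontrivial solution exists.  If \<open>b None\<close> were zero, it would
  be a nonzero tangent vector on which all \<open>du\<^sub>j\<close> vanish; but then the differentials of the affine
  coordinates vanish on it, since these are algebraic over the \<open>u\<^sub>j\<close>.  The coefficients \<open>\<beta>\<close> do not depend on
  \<open>p\<close> or \<open>\<epsilon>\<close>, which makes the components rational as soon as \<open>\<epsilon>\<close> is.\<close>

lemma tangent_vector_with_prescribed_differentials:
  assumes u: "indep_seq u s" and coord: "\<And>i k. nonvanishing (\<lambda>x. x $ i) \<Longrightarrow> alg_over (u ` {..<s}) (\<lambda>p. chart i p $ k)"
  obtains \<beta> where "\<And>i k j. nonvanishing (\<lambda>x. x $ i) \<Longrightarrow> j < s \<Longrightarrow> rational (\<beta> i k j)"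
    "\<forall>\<^sub>F p in generic. \<forall>\<epsilon>. \<exists>w\<in>tangent_space M p. (\<forall>j<s. has_tderiv (u j) p w (\<epsilon> j)) \<and>
       (\<forall>i k. p \<in> chart_dom i \<longrightarrow> w $ i $ k = (\<Sum>j<s. \<beta> i k j p * \<epsilon> j))"
proof -
  have urat: "rational (u j)" if "j < s" for j using u that by (simp add: indep_seq_def)
  define ok where "ok = (\<lambda>i k \<beta>. nonvanishing (\<lambda>x :: complex ^ 'n. x $ i) \<longrightarrow>
    (\<forall>j\<in>{..<s}. rational (\<beta> j)) \<and> differential_combination u {..<s} (\<lambda>p. chart i p $ k) \<beta>)"
  have "\<exists>\<beta>. ok i k \<beta>" for i k
  proof (cases "nonvanishing (\<lambda>x. x $ i)")
    case True
    show ?thesis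
      unfolding ok_def
      using differential_of_algebraic_function[OF finite_lessThan _ rational_chart[OF True] coord[OF True]] urat by blast
  qed (simp add: ok_def)
  then obtain \<beta> where \<beta>: "\<And>i k. ok i k (\<beta> i k)" by metis
  have \<beta>rat: "rational (\<beta> i k j)" if "nonvanishing (\<lambda>x. x $ i)" "j < s" for i k j
    using \<beta>[of i k] that by (simp add: ok_def)
  have d: "\<forall>\<^sub>F p in generic. \<forall>i. \<forall>k. nonvanishing (\<lambda>x. x $ i) \<longrightarrow> (\<forall>w\<in>tangent_space M p. \<forall>du df.
     (\<forall>j\<in>{..<s}. has_tderiv (u j) p w (du j)) \<and> has_tderiv (\<lambda>p. chart i p $ k) p w df \<longrightarrow> df = (\<Sum>j<s. \<beta> i k j p * du j))"
    using \<beta> unfolding ok_def differential_combination_def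
    by (intro eventually_all_finite) (simp add: eventually_conj_iff eventually_const_iff)
  have lin: "\<forall>\<^sub>F p in generic. \<forall>j\<in>{..<s}. \<forall>i. p \<in> chart_dom i \<longrightarrow>
    (\<exists>D. (\<forall>v v'. D (v + v') = D v + D v') \<and> (\<forall>c v. D (c *s v) = c * D v) \<and> (\<forall>w. has_tderiv (u j) p w (D (w $ i))))"
    by (rule eventually_ball_finite) (use has_tderiv_rational urat in auto)
  have "\<forall>\<^sub>F p in generic. \<forall>\<epsilon>. \<exists>w\<in>tangent_space M p. (\<forall>j<s. has_tderiv (u j) p w (\<epsilon> j)) \<and>
       (\<forall>i k. p \<in> chart_dom i \<longrightarrow> w $ i $ k = (\<Sum>j<s. \<beta> i k j p * \<epsilon> j))"
    using d lin generic_in_M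
  proof eventually_elim
    case (elim p)
    note pM = elim(3)
    have coords: "w $ i $ k = (\<Sum>j<s. \<beta> i k j p * du j)"
      if "w \<in> tangent_space M p" "p \<in> chart_dom i" "\<forall>j<s. has_tderiv (u j) p w (du j)" for i k w du
    proof -
      have "nonvanishing (\<lambda>x. x $ i)" using pM that(2) by (auto simp: nonvanishing_coord_iff)
      then show ?thesis using elim(1) that has_tderiv_chart[OF that(2), of k w] by blast
    qed
    obtain i where i: "p \<in> chart_dom i" using ex_chart_dom by blast
    have "\<forall>j. \<exists>D. j < s \<longrightarrow> (\<forall>v v'. D (v + v') = D v + D v') \<and> (\<forall>c v. D (c *s v) = c * D v) \<and> (\<forall>w. has_tderiv (u j) p w (D (w $ i)))"
      using elim(2) i by blast
    then obtain D where D: "\<And>j. j < s \<longrightarrow> (\<forall>v v'. D j (v + v') = D j v + D j v') \<and> (\<forall>c v. D j (c *s v) = c * D j v) \<and> (\<forall>w. has_tderiv (u j) p w (D j (w $ i)))"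
      by metis
    have Dadd: "D j (v + v') = D j v + D j v'" and Dsm: "D j (c *s v) = c * D j v" and Dtd: "has_tderiv (u j) p w (D j (w $ i))"
      if "j < s" for j v v' c w using D that by blast+
    have Dsum: "D j (\<Sum>k\<in>K. f k) = (\<Sum>k\<in>K. D j (f k))" if "j < s" for j and K :: "'n set" and f
    proof -
      have "D j 0 = 0" using Dsm[OF that, of 0 0] by simp
      then show ?thesis by (induction K rule: infinite_finite_induct) (auto simp: Dadd[OF that])
    qed
    obtain U V \<Phi> \<Psi> and J :: "'n set" where lc: "local_chart i U V \<Phi> \<Psi> J" and U: "chart i p \<in> U"
      by (rule local_chart_exists[OF pM i]) (rule that)
    note c = local_chartD[OF lc]
    define x where "x = chart i p"
    define v where "v = (\<lambda>k :: 'n. mapd \<Psi> (\<Phi> x) (axis k 1))"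
    have \<Phi>v: "mapd \<Phi> x (v k) = axis k 1" for k
      using mapd_inverse(2)[OF lc c(5)[OF U], of "axis k 1"] c(7)[OF U] by (simp add: v_def x_def)
    have \<Phi>sum: "mapd \<Phi> x (\<Sum>k\<in>J. b k *s v k) = (\<Sum>k\<in>J. b k *s axis k 1)" for b
    proof -
      have "mapd \<Phi> x (\<Sum>k\<in>K. b k *s v k) = (\<Sum>k\<in>K. b k *s mapd \<Phi> x (v k))" for K
        by (induction K rule: infinite_finite_induct)
          (use mapd_linear[OF c(3) U] in \<open>auto simp: x_def\<close>)
      then show ?thesis using \<Phi>v by simp
    qed
    have axsum: "(\<Sum>k\<in>J. b k *s axis k 1) $ l = (if l \<in> J then b l else (0 :: complex))" for b l
      by (simp add: axis_def if_distrib[of "\<lambda>u. _ * u"] sum.delta cong: if_cong)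
    have tang: "tvec_of i p (\<Sum>k\<in>J. b k *s v k) \<in> tangent_space M p \<and>
        tvec_of i p (\<Sum>k\<in>J. b k *s v k) $ i = (\<Sum>k\<in>J. b k *s v k)" for b
      by (rule tangent_space_iff(2)[OF lc pM i U]) (use \<Phi>sum axsum in \<open>simp add: x_def\<close>)
    show ?case
    proof
      fix \<epsilon> :: "nat \<Rightarrow> complex"
      \<comment> \<open>The index \<open>None\<close> belongs to the homogenising unknown.\<close>
      define A where "A = (\<lambda>j. case_option (- \<epsilon> j) (\<lambda>k. D j (v k)))"
      have cardI: "card (insert None (Some ` J)) = Suc m"
        using c(9) by (subst card_insert_disjoint) (auto simp: card_image)
      have "card {..<s} < card (insert None (Some ` J))"
        unfolding cardI using indep_seq_length[OF u] by simp
      from homogeneous_linear_system_nontrivial_solution[OF _ _ this, of A]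
      obtain b where b: "\<exists>l\<in>insert None (Some ` J). b l \<noteq> 0"
        "\<forall>j\<in>{..<s}. (\<Sum>l\<in>insert None (Some ` J). A j l * b l) = 0" by auto
      define v0 where "v0 = (\<Sum>k\<in>J. b (Some k) *s v k)"
      have Dv0: "D j v0 = \<epsilon> j * b None" if j: "j < s" for j
      proof -
        have "(\<Sum>l\<in>insert None (Some ` J). A j l * b l) = - \<epsilon> j * b None + (\<Sum>k\<in>J. D j (v k) * b (Some k))"
          by (subst sum.insert) (auto simp: A_def sum.reindex)
        moreover have "D j v0 = (\<Sum>k\<in>J. D j (v k) * b (Some k))"
          unfolding v0_def by (simp add: Dsum[OF j] Dsm[OF j] mult.commute)
        ultimately show ?thesis using b(2) j by simp
      qed
      have bN: "b None \<noteq> 0"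
      proof
        assume z: "b None = 0"
        define w where "w = tvec_of i p v0"
        have w: "w \<in> tangent_space M p" "w $ i = v0" using tang unfolding w_def v0_def by auto
        have "\<forall>j<s. has_tderiv (u j) p w 0" using Dtd[of _ w] Dv0 w(2) z by simp
        then have "w $ i $ k = 0" for k using coords[OF w(1) i, of "\<lambda>_. 0"] by simp
        then have "v0 = 0" using w(2) by (simp add: vec_eq_iff)
        then have "mapd \<Phi> x v0 = 0" using mapd_linear(4)[OF c(3) U] by (simp add: x_def)
        then have "(\<Sum>k\<in>J. b (Some k) *s axis k 1) = 0" unfolding v0_def \<Phi>sum .
        then have "b (Some k) = 0" if "k \<in> J" for k using axsum[of "\<lambda>k. b (Some k)" k] that by simp
        then show False using b(1) z by auto
      qed
      define b' where "b' = (\<lambda>k. b (Some k) / b None)"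
      define v1 where "v1 = (\<Sum>k\<in>J. b' k *s v k)"
      have "v1 = inverse (b None) *s v0"
        unfolding v1_def v0_def b'_def vec.scale_sum_right by (rule sum.cong) (auto simp: field_simps)
      then have Dv1: "D j v1 = \<epsilon> j" if "j < s" for j using Dsm[OF that] Dv0[OF that] bN by simp
      define w where "w = tvec_of i p v1"
      have w: "w \<in> tangent_space M p" "w $ i = v1" using tang unfolding w_def v1_def by auto
      have td: "\<forall>j<s. has_tderiv (u j) p w (\<epsilon> j)" using Dtd[of _ w] Dv1 w(2) by metis
      show "\<exists>w\<in>tangent_space M p. (\<forall>j<s. has_tderiv (u j) p w (\<epsilon> j)) \<and>
       (\<forall>i k. p \<in> chart_dom i \<longrightarrow> w $ i $ k = (\<Sum>j<s. \<beta> i k j p * \<epsilon> j))"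
        using w(1) td coords[OF w(1) _ td] by blast
    qed
  qed
  then show ?thesis using that \<beta>rat by blast
qed

text \<open>A derivation is determined by its values on a transcendence basis; here it is realised by
  tangent vectors.  For a chart that misses \<open>M\<close> the components are arbitrary and set to zero.\<close>

lemma vector_field_with_prescribed_derivatives:
  assumes u: "indep_seq u s" and alg: "\<And>f. rational f \<Longrightarrow> alg_over (u ` {..<s}) f"
    and \<epsilon>: "\<And>j. j < s \<Longrightarrow> rational (\<epsilon> j)"
  obtains X where "rational_vector_field M X" "\<And>j. j < s \<Longrightarrow> der (\<lambda>p. the (X p)) (u j) (\<epsilon> j)"
proof -
  obtain \<beta> where \<beta>: "\<And>i k j. nonvanishing (\<lambda>x. x $ i) \<Longrightarrow> j < s \<Longrightarrow> rational (\<beta> i k j)"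
    "\<forall>\<^sub>F p in generic. \<forall>\<epsilon>. \<exists>w\<in>tangent_space M p. (\<forall>j<s. has_tderiv (u j) p w (\<epsilon> j)) \<and>
       (\<forall>i k. p \<in> chart_dom i \<longrightarrow> w $ i $ k = (\<Sum>j<s. \<beta> i k j p * \<epsilon> j))"
    by (rule tangent_vector_with_prescribed_differentials[OF u]) (use alg rational_chart that in auto)
  define f where "f = (\<lambda>i k p. if nonvanishing (\<lambda>x. x $ i) then \<Sum>j<s. \<beta> i k j p * \<epsilon> j p else 0)"
  have frat: "rational (f i k)" for i k
    unfolding f_def by (cases "nonvanishing (\<lambda>x. x $ i)") (auto intro!: rational_sum rational_mult \<beta>(1) \<epsilon> rational_const)
  have "\<exists>a. a \<in> rational_functions M \<and> (\<forall>\<^sub>F p in generic. a p = Some (f i k p))" for i k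
    by (rule rational_functions_exists[OF frat]) blast
  then obtain a where a: "\<And>i k. a i k \<in> rational_functions M"
    "\<And>i k. \<forall>\<^sub>F p in generic. a i k p = Some (f i k p)" by metis
  have "\<forall>\<^sub>F p in generic. \<forall>i. \<forall>k. a i k p = Some (f i k p)"
    by (intro eventually_all_finite a(2))
  with \<beta>(2) generic_in_M field_of_dom_generic[of a, OF a(1)]
  have gen: "\<forall>\<^sub>F p in generic. the (field_of M a p) \<in> tangent_space M p \<and>
      (\<forall>j<s. has_tderiv (u j) p (the (field_of M a p)) (\<epsilon> j p))"
  proof eventually_elim
    case (elim p)
    obtain w where w: "w \<in> tangent_space M p" "\<forall>j<s. has_tderiv (u j) p w (\<epsilon> j p)"
      "\<forall>i k. p \<in> chart_dom i \<longrightarrow> w $ i $ k = (\<Sum>j<s. \<beta> i k j p * \<epsilon> j p)"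
      using elim(1)[rule_format, of "\<lambda>j. \<epsilon> j p"] by blast
    obtain i0 where i0: "p \<in> chart_dom i0" using ex_chart_dom by blast
    have "the (field_of M a p) $ i $ k = w $ i $ k" for i k
    proof (cases "p \<in> chart_dom i")
      case True
      then have "nonvanishing (\<lambda>x. x $ i)" using elim(2) by (auto simp: nonvanishing_coord_iff)
      then show ?thesis using True elim(3,4) w(3) by (simp add: field_of_component f_def)
    next
      case False
      have "w $ i $ k = tvec_of i0 p (w $ i0) $ i $ k" using tangent_space_tvec_of[OF w(1) i0] by (rule arg_cong)
      also have "\<dots> = 0" using False by (simp add: tvec_of_def)
      finally have "w $ i $ k = 0" .
      then show ?thesis using False elim(3) by (simp add: field_of_component)
    qed
    then have "the (field_of M a p) = w" by (simp add: vec_eq_iff)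
    then show ?case using w by simp
  qed
  have "rational_vector_field M (field_of M a)"
    unfolding rational_vector_field_iff
  proof (intro conjI allI impI)
    show "\<exists>a'. (\<forall>i k. a' i k \<in> rational_functions M) \<and> field_of M a = field_of M a'" using a(1) by blast
    fix p w assume w: "field_of M a p = Some w"
    have "\<forall>\<^sub>F p in generic. the (field_of M a p) \<in> tangent_space M p" using gen by eventually_elim simp
    from tangency_closure[of a, OF a(1) this, of p] show "w \<in> tangent_space M p" using w by auto
  qed
  moreover have "der (\<lambda>p. the (field_of M a p)) (u j) (\<epsilon> j)" if "j < s" for j
    unfolding der_def using gen by eventually_elim (use that in blast)
  ultimately show ?thesis using that by blast
qed

text \<open>The kernel of a derivation is algebraically closed in the function field.\<close>

lemma der_algebraic_zero:
  fixes s :: nat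
  assumes X: "\<forall>\<^sub>F p in generic. X p \<in> tangent_space M p"
    and u: "\<And>j. j < s \<Longrightarrow> rational (u j)" "\<And>j. j < s \<Longrightarrow> der X (u j) (\<lambda>p. 0)"
    and f: "rational f" "alg_over (u ` {..<s}) f"
  shows "der X f (\<lambda>p. 0)"
proof -
  have ur: "\<And>i. i \<in> {..<s} \<Longrightarrow> rational (u i)" using u(1) by simp
  obtain \<beta> where \<beta>: "differential_combination u {..<s} f \<beta>"
    using differential_of_algebraic_function[of "{..<s}" u f, OF finite_lessThan] ur f by blast
  have "\<forall>\<^sub>F p in generic. \<forall>j\<in>{..<s}. has_tderiv (u j) p (X p) 0"
    by (rule eventually_ball_finite) (use u(2) in \<open>auto simp: der_def\<close>)
  with \<beta>[unfolded differential_combination_def] X has_tderiv_rational_exists[OF f(1)] show ?thesis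
    unfolding der_def
  proof eventually_elim
    case (elim p)
    obtain c where c: "has_tderiv f p (X p) c" using elim(3) by blast
    have "c = (\<Sum>i<s. \<beta> i p * 0)" using elim(1)[rule_format, OF elim(2), of "\<lambda>_. 0" c] elim(4) c by simp
    then show ?case using c by simp
  qed
qed

text \<open>The members of \<open>\<X>\<close> have the common kernel \<open>K\<close>, and \<open>X\<close> acts on a transcendence basis adapted
  to \<open>K\<close> by zeros and rationally independent eigenvalues.\<close>

theorem vector_field_with_common_first_integrals:
  assumes \<X>: "\<And>X. X \<in> \<X> \<Longrightarrow> rational_vector_field M X"
  shows "\<exists>X. rational_vector_field M X \<and>
    first_integrals M X = {h \<in> rational_functions M. \<forall>Y\<in>\<X>. h \<in> first_integrals M Y}"
proof -
  define K where "K = (\<lambda>f. rational f \<and> (\<forall>X\<in>\<X>. der (\<lambda>p. the (X p)) f (\<lambda>p. 0)))"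
  have "indep_seq (\<lambda>_ _. 0) 0" by (simp add: indep_seq_def)
  from indep_seq_extension[OF this, of K]
  obtain u0 s0 where u0: "indep_seq u0 s0" "\<And>j. j < s0 \<Longrightarrow> K (u0 j)" "\<And>f. K f \<Longrightarrow> alg_over (u0 ` {..<s0}) f"
    by (auto simp: K_def)
  from indep_seq_extension[OF u0(1), of rational]
  obtain u s where u: "s0 \<le> s" "indep_seq u s" "\<And>j. j < s0 \<Longrightarrow> u j = u0 j" "\<And>f. rational f \<Longrightarrow> alg_over (u ` {..<s}) f"
    by blast
  have img: "u0 ` {..<s0} = u ` {..<s0}" using u(3) by auto
  obtain c :: "nat \<Rightarrow> complex" where c: "\<And>a b. inj_on (\<lambda>\<alpha>. \<Sum>j\<in>{a..<b}. of_nat (\<alpha> j) * c j) {\<alpha> :: nat \<Rightarrow> nat. \<forall>j. \<alpha> j \<noteq> 0 \<longrightarrow> j \<in> {a..<b}}"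
    using logarithms_of_primes_independent by blast
  have urat: "rational (u j)" if "j < s" for j using u(2) that by (simp add: indep_seq_def)
  \<comment> \<open>Constants of the family remain constants; the other basis elements become eigenfunctions.\<close>
  define \<epsilon> where "\<epsilon> = (\<lambda>j p. if j < s0 then 0 else c j * u j p)"
  obtain X where X: "rational_vector_field M X" "\<And>j. j < s \<Longrightarrow> der (\<lambda>p. the (X p)) (u j) (\<epsilon> j)"
  proof (rule vector_field_with_prescribed_derivatives[OF u(2,4), of \<epsilon>])
    fix j assume "j < s"
    then show "rational (\<epsilon> j)"
      unfolding \<epsilon>_def using urat by (cases "j < s0") (auto intro!: rational_const rational_mult)
  qed (use that in auto)
  note tX = rational_vector_field_generic(2)[OF X(1)]
  have d0: "der (\<lambda>p. the (X p)) (u j) (\<lambda>p. 0)" if "j < s0" for j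
    using X(2)[of j] that u(1) by (simp add: \<epsilon>_def)
  have d1: "der (\<lambda>p. the (X p)) (u j) (\<lambda>p. c j * u j p)" if "s0 \<le> j" "j < s" for j
    using X(2)[of j] that by (simp add: \<epsilon>_def)
  have urat0: "rational (u j)" if "j < s0" for j using urat u(1) that by simp
  have "h \<in> first_integrals M X \<longleftrightarrow> h \<in> rational_functions M \<and> (\<forall>Y\<in>\<X>. h \<in> first_integrals M Y)" for h
  proof
    assume h: "h \<in> first_integrals M X"
    then have hr: "h \<in> rational_functions M" by (simp add: first_integrals_def)
    define f where "f = (\<lambda>p. the (h p))"
    have f: "rational f" unfolding f_def by (rule rational_functions_generic(2)[OF hr])
    have "der (\<lambda>p. the (X p)) f (\<lambda>p. 0)" unfolding f_def by (rule der_zero_of_first_integral[OF X(1) h])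
    then have alg: "alg_over (u ` {..<s0}) f"
      by (intro constants_algebraic_over_kernel_part[OF tX u(2,1) d0 d1 c u(4)[OF f]])
    have "h \<in> first_integrals M Y" if Y: "Y \<in> \<X>" for Y
    proof (rule first_integral_of_der_zero[OF \<X>[OF Y] hr])
      show "der (\<lambda>p. the (Y p)) (\<lambda>p. the (h p)) (\<lambda>p. 0)"
        unfolding f_def[symmetric]
        by (rule der_algebraic_zero[OF rational_vector_field_generic(2)[OF \<X>[OF Y]] urat0 _ f alg])
          (use u0(2) u(3) Y in \<open>auto simp: K_def\<close>)
    qed
    then show "h \<in> rational_functions M \<and> (\<forall>Y\<in>\<X>. h \<in> first_integrals M Y)" using hr by blast
  next
    assume h: "h \<in> rational_functions M \<and> (\<forall>Y\<in>\<X>. h \<in> first_integrals M Y)"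
    define f where "f = (\<lambda>p. the (h p))"
    have f: "rational f" unfolding f_def using rational_functions_generic(2) h by blast
    have "K f" unfolding K_def f_def using der_zero_of_first_integral \<X> h f[unfolded f_def] by blast
    then have alg: "alg_over (u ` {..<s0}) f" using u0(3) img by simp
    have "der (\<lambda>p. the (X p)) f (\<lambda>p. 0)"
      by (rule der_algebraic_zero[OF tX urat0 d0 f alg])
    then show "h \<in> first_integrals M X"
      using first_integral_of_der_zero[OF X(1)] h unfolding f_def by blast
  qed
  then have "first_integrals M X = {h \<in> rational_functions M. \<forall>Y\<in>\<X>. h \<in> first_integrals M Y}" by blast
  then show ?thesis using X(1) by blast
qed

end

theorem theorem1:
  fixes M :: "'n::finite cproj set"
    and D :: "'n cproj set \<Rightarrow> ('n cproj \<Rightarrow> 'n tvec) set"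
  assumes "projective_manifold M"
    and "singular_distribution M D"
    and "integrable_distribution M D"
  shows "\<exists>X. rational_vector_field M X \<and> first_integrals M X = distribution_first_integrals M D"
proof -
  obtain m where "projective_mfd M m"
    using assms(1) unfolding projective_manifold_def projective_mfd_def by blast
  then interpret projective_mfd M m .
  have "distribution_first_integrals M D =
      {h \<in> rational_functions M. \<forall>Y\<in>{X. rational_vector_field M X \<and> tangent_to M X D}. h \<in> first_integrals M Y}"
    by (auto simp: distribution_first_integrals_def)
  then show ?thesis
    using vector_field_with_common_first_integrals[of "{X. rational_vector_field M X \<and> tangent_to M X D}"] by auto
qed

end
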